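(* Let $(W,\lambda)$ be a Liouville domain with $h_{\rm top}(\varphi^1_{\lambda|_{\partial W}})>0$. Then for any $H\in\mathcal H(W,\lambda)$ we have $$h_{\rm top}\big(\varphi^1_{\hat\lambda|_{\partial W_H}}\big)>0\qquad\text{and}\qquad h_{\rm top}(\varphi^1_H)>0.$$
   Context: A Liouville domain $(W,\lambda)$ is a compact exact symplectic manifold with boundary (symplectic form $d\lambda$) whose Liouville vector field $Y_\lambda$, defined by $\iota_{Y_\lambda}d\lambda=\lambda$, is outward transverse to $\partial W$; then $\lambda|_{\partial W}$ is a contact form. Let $S^1=\mathbb R/\mathbb Z$. For smooth $H:S^1\times W\to\mathbb R$ put $H_t=H(t,\cdot)$, define $X_{H_t}$ by $\iota_{X_{H_t}}d\lambda=dH_t$, and $\tau_{\lambda,H}=\lambda(X_{H_t})+H$. $\mathcal H(W,\lambda)$ is the set of smooth $H:S^1\times W\to\mathbb R$ which are autonomous (independent of $t$) in a neighborhood of $\partial W$, vanish on $\partial W$, and satisfy $\tau_{\lambda,H}>0$ everywhere. $\varphi^1_H:W\to W$ is the time-1 map of the Hamiltonian flow of $H$. The tube is $W_H=\{(w,z)\in W\times\mathbb C\mid z=re^{2\pi i t},\ \pi|z|^2\le H(t,w)\}$ with $\hat\lambda=\lambda+\pi r^2dt$, a Liouville domain, so $\hat\lambda|_{\partial W_H}$ is a contact form. For a contact form $\alpha$, $\varphi^1_\alpha$ denotes the time-1 map of its Reeb flow. $h_{\rm top}$ is topological entropy. *)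

theory Defs
  imports "HOL-Analysis.Analysis"
begin

section \<open>Smooth maps between subsets of Euclidean spaces\<close>

fun Ck_on :: "nat \<Rightarrow> 'a::euclidean_space set \<Rightarrow> ('a \<Rightarrow> 'b::real_normed_vector) \<Rightarrow> bool" where
  "Ck_on 0 U f \<longleftrightarrow> continuous_on U f"
| "Ck_on (Suc k) U f \<longleftrightarrow>
     (\<forall>x\<in>U. f differentiable (at x)) \<and> (\<forall>v. Ck_on k U (\<lambda>x. frechet_derivative f (at x) v))"

text \<open>A map on an arbitrary subset is smooth if it locally extends to a smooth map on an open set;
  this is the usual notion for subsets of half-spaces.\<close>

definition smooth_in :: "'a::euclidean_space set \<Rightarrow> ('a \<Rightarrow> 'b::real_normed_vector) \<Rightarrow> bool" where
  "smooth_in S f \<longleftrightarrow>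
     (\<forall>x\<in>S. \<exists>U g. open U \<and> x \<in> U \<and> (\<forall>k. Ck_on k U g) \<and> (\<forall>y\<in>S \<inter> U. g y = f y))"

section \<open>Smooth manifolds with boundary\<close>

text \<open>A manifold is a subset \<open>M\<close> of a metric space together with a smooth atlas. The metric
  only stands for the topology it induces (compact manifolds are metrizable); it is not required
  to be related to the smooth structure. The dimension is \<open>DIM('e)\<close>.\<close>

type_synonym ('a, 'e) chart = "'a set \<times> ('a \<Rightarrow> 'e)"

definition img :: "('a, 'e) chart \<Rightarrow> 'e set" where
  "img c = snd c ` fst c"

definition chart_inv :: "('a, 'e) chart \<Rightarrow> 'e \<Rightarrow> 'a" where
  "chart_inv c = inv_into (fst c) (snd c)"

text \<open>For \<open>\<nu> = 0\<close> the half-space is the whole space, so charts onto open subsets of Euclidean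
  space are included.\<close>

definition half_space :: "'e::euclidean_space \<Rightarrow> 'e set" where
  "half_space \<nu> = {x. 0 \<le> x \<bullet> \<nu>}"

definition is_chart :: "'a::metric_space set \<Rightarrow> ('a, 'e::euclidean_space) chart \<Rightarrow> bool" where
  "is_chart M c \<longleftrightarrow>
     openin (top_of_set M) (fst c) \<and>
     (\<exists>\<nu>. openin (top_of_set (half_space \<nu>)) (img c)) \<and>
     homeomorphism (fst c) (img c) (snd c) (chart_inv c)"

text \<open>\<open>overlap c d\<close> is the domain, in the coordinates of \<open>c\<close>, of the coordinate change
  \<open>coord_change c d\<close>.\<close>

definition overlap :: "('a, 'e) chart \<Rightarrow> ('a, 'e) chart \<Rightarrow> 'e set" where
  "overlap c d = snd c ` (fst c \<inter> fst d)"

definition coord_change :: "('a, 'e) chart \<Rightarrow> ('a, 'e) chart \<Rightarrow> 'e \<Rightarrow> 'e" where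
  "coord_change c d = (\<lambda>x. snd d (chart_inv c x))"

definition compatible ::
  "('a, 'e::euclidean_space) chart \<Rightarrow> ('a, 'e) chart \<Rightarrow> bool" where
  "compatible c d \<longleftrightarrow>
     smooth_in (overlap c d) (coord_change c d) \<and> smooth_in (overlap d c) (coord_change d c)"

definition smooth_atlas ::
  "'a::metric_space set \<Rightarrow> ('a, 'e::euclidean_space) chart set \<Rightarrow> bool" where
  "smooth_atlas M A \<longleftrightarrow>
     (\<forall>c\<in>A. is_chart M c) \<and> M = (\<Union>c\<in>A. fst c) \<and> (\<forall>c\<in>A. \<forall>d\<in>A. compatible c d)"

text \<open>\<open>x\<close> is a boundary point in the coordinates of \<open>c\<close> and \<open>\<nu>\<close> is an inward normal there; \<open>\<nu>\<close> is
  then unique up to a positive factor, and \<open>{v. v \<bullet> \<nu> = 0}\<close> is the tangent space of the boundary.\<close>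

definition inward_normal :: "('a, 'e::euclidean_space) chart \<Rightarrow> 'e \<Rightarrow> 'e \<Rightarrow> bool" where
  "inward_normal c x \<nu> \<longleftrightarrow>
     \<nu> \<noteq> 0 \<and> openin (top_of_set (half_space \<nu>)) (img c) \<and> x \<in> img c \<and> x \<bullet> \<nu> = 0"

definition mfd_boundary :: "('a, 'e::euclidean_space) chart set \<Rightarrow> 'a set" where
  "mfd_boundary A = {p. \<exists>c\<in>A. p \<in> fst c \<and> (\<exists>\<nu>. inward_normal c (snd c p) \<nu>)}"

section \<open>Forms, vector fields and flows\<close>

text \<open>Forms and vector fields are given by their coordinate representations: \<open>\<alpha> c x v\<close> is the value
  of the form \<open>\<alpha>\<close> at the point with coordinates \<open>x\<close> in the chart \<open>c\<close> on the tangent vector with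
  components \<open>v\<close>. Derivatives are taken within chart images (or overlaps), so that they make sense
  at boundary points.\<close>

type_synonym ('a, 'e) one_form = "('a, 'e) chart \<Rightarrow> 'e \<Rightarrow> 'e \<Rightarrow> real"

definition smooth_one_form ::
  "('a, 'e::euclidean_space) chart set \<Rightarrow> ('a, 'e) one_form \<Rightarrow> bool" where
  "smooth_one_form A \<alpha> \<longleftrightarrow>
     (\<forall>c\<in>A. (\<forall>x\<in>img c. linear (\<alpha> c x)) \<and> (\<forall>v. smooth_in (img c) (\<lambda>x. \<alpha> c x v))) \<and>
     (\<forall>c\<in>A. \<forall>d\<in>A. \<forall>x\<in>overlap c d. \<forall>v.
        \<alpha> c x v
          = \<alpha> d (coord_change c d x)
              (frechet_derivative (coord_change c d) (at x within overlap c d) v))"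

definition ext_deriv ::
  "('a, 'e::euclidean_space) one_form \<Rightarrow> ('a, 'e) chart \<Rightarrow> 'e \<Rightarrow> 'e \<Rightarrow> 'e \<Rightarrow> real" where
  "ext_deriv \<alpha> c x u v =
     frechet_derivative (\<lambda>y. \<alpha> c y v) (at x within img c) u
     - frechet_derivative (\<lambda>y. \<alpha> c y u) (at x within img c) v"

text \<open>The vector \<open>u\<close> with \<open>d\<alpha>(u, \<cdot>) = \<theta>\<close>.\<close>

definition dual_vector ::
  "('a, 'e::euclidean_space) one_form \<Rightarrow> ('a, 'e) chart \<Rightarrow> 'e \<Rightarrow> ('e \<Rightarrow> real) \<Rightarrow> 'e" where
  "dual_vector \<alpha> c x \<theta> = (THE u. \<forall>v. ext_deriv \<alpha> c x u v = \<theta> v)"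

definition liouville_field ::
  "('a, 'e::euclidean_space) one_form \<Rightarrow> ('a, 'e) chart \<Rightarrow> 'e \<Rightarrow> 'e" where
  "liouville_field \<alpha> c x = dual_vector \<alpha> c x (\<alpha> c x)"

text \<open>The Reeb vector field of the restriction of \<open>\<alpha>\<close> to the boundary; the exterior derivative of
  this restriction is the restriction of \<open>d\<alpha>\<close>.\<close>

definition reeb_field ::
  "('a, 'e::euclidean_space) one_form \<Rightarrow> ('a, 'e) chart \<Rightarrow> 'e \<Rightarrow> 'e" where
  "reeb_field \<alpha> c x =
     (THE r. \<exists>\<nu>. inward_normal c x \<nu> \<and> r \<bullet> \<nu> = 0 \<and> \<alpha> c x r = 1 \<and>
        (\<forall>v. v \<bullet> \<nu> = 0 \<longrightarrow> ext_deriv \<alpha> c x r v = 0))"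

definition hamiltonian_field ::
  "('a, 'e::euclidean_space) one_form \<Rightarrow> (real \<Rightarrow> 'a \<Rightarrow> real) \<Rightarrow> real \<Rightarrow> ('a, 'e) chart \<Rightarrow> 'e \<Rightarrow> 'e"
  where
  "hamiltonian_field \<alpha> H t c x =
     dual_vector \<alpha> c x (frechet_derivative (\<lambda>y. H t (chart_inv c y)) (at x within img c))"

definition integral_curve ::
  "('a::metric_space, 'e::euclidean_space) chart set \<Rightarrow> 'a set \<Rightarrow>
   (real \<Rightarrow> ('a, 'e) chart \<Rightarrow> 'e \<Rightarrow> 'e) \<Rightarrow> (real \<Rightarrow> 'a) \<Rightarrow> bool" where
  "integral_curve A S X \<gamma> \<longleftrightarrow>
     range \<gamma> \<subseteq> S \<and> continuous_on UNIV \<gamma> \<and>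
     (\<forall>t. \<forall>c\<in>A. \<gamma> t \<in> fst c \<longrightarrow>
        ((\<lambda>s. snd c (\<gamma> s)) has_vector_derivative X t c (snd c (\<gamma> t))) (at t))"

definition time_one_map ::
  "('a::metric_space, 'e::euclidean_space) chart set \<Rightarrow> 'a set \<Rightarrow>
   (real \<Rightarrow> ('a, 'e) chart \<Rightarrow> 'e \<Rightarrow> 'e) \<Rightarrow> 'a \<Rightarrow> 'a" where
  "time_one_map A S X p = (THE q. \<exists>\<gamma>. integral_curve A S X \<gamma> \<and> \<gamma> 0 = p \<and> \<gamma> 1 = q)"

definition reeb_time_one ::
  "('a::metric_space, 'e::euclidean_space) chart set \<Rightarrow> ('a, 'e) one_form \<Rightarrow> 'a \<Rightarrow> 'a" where
  "reeb_time_one A \<alpha> = time_one_map A (mfd_boundary A) (\<lambda>t. reeb_field \<alpha>)"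

definition hamiltonian_time_one ::
  "'a::metric_space set \<Rightarrow> ('a, 'e::euclidean_space) chart set \<Rightarrow> ('a, 'e) one_form \<Rightarrow>
   (real \<Rightarrow> 'a \<Rightarrow> real) \<Rightarrow> 'a \<Rightarrow> 'a" where
  "hamiltonian_time_one W A \<alpha> H = time_one_map A W (hamiltonian_field \<alpha> H)"

section \<open>Liouville domains and admissible Hamiltonians\<close>

definition liouville_domain ::
  "'a::metric_space set \<Rightarrow> ('a, 'e::euclidean_space) chart set \<Rightarrow> ('a, 'e) one_form \<Rightarrow> bool" where
  "liouville_domain W A \<alpha> \<longleftrightarrow>
     compact W \<and> smooth_atlas W A \<and> smooth_one_form A \<alpha> \<and>
     (\<forall>c\<in>A. \<forall>x\<in>img c. \<forall>u. (\<forall>v. ext_deriv \<alpha> c x u v = 0) \<longrightarrow> u = 0) \<and>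
     (\<forall>c\<in>A. \<forall>x \<nu>. inward_normal c x \<nu> \<longrightarrow> liouville_field \<alpha> c x \<bullet> \<nu> < 0)"

text \<open>Functions on \<open>S\<^sup>1 \<times> W\<close> are functions on \<open>\<real> \<times> W\<close> that are 1-periodic in the first argument.\<close>

definition admissible_hamiltonians ::
  "'a::metric_space set \<Rightarrow> ('a, 'e::euclidean_space) chart set \<Rightarrow> ('a, 'e) one_form \<Rightarrow>
   (real \<Rightarrow> 'a \<Rightarrow> real) set" where
  "admissible_hamiltonians W A \<alpha> = {H.
     (\<forall>t. \<forall>w\<in>W. H (t + 1) w = H t w) \<and>
     (\<forall>c\<in>A. smooth_in (UNIV \<times> img c) (\<lambda>(t, x). H t (chart_inv c x))) \<and>
     (\<exists>N. openin (top_of_set W) N \<and> mfd_boundary A \<subseteq> N \<and> (\<forall>w\<in>N. \<forall>s t. H s w = H t w)) \<and>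
     (\<forall>t. \<forall>w\<in>mfd_boundary A. H t w = 0) \<and>
     (\<forall>t. \<forall>c\<in>A. \<forall>x\<in>img c.
        0 < \<alpha> c x (hamiltonian_field \<alpha> H t c x) + H t (chart_inv c x))}"

section \<open>The tube\<close>

definition prod_chart ::
  "('a, 'e) chart \<Rightarrow> ('a \<times> complex, 'e \<times> complex) chart" where
  "prod_chart c = (fst c \<times> UNIV, \<lambda>(w, z). (snd c w, z))"

lemma inj_prod_chart: "inj prod_chart"
proof (rule injI)
  fix c d :: "('a, 'e) chart"
  assume eq: "prod_chart c = prod_chart d"
  have "fst c = fst d"
    using eq by (auto simp: prod_chart_def times_eq_iff)
  moreover have "snd c w = snd d w" for w
  proof -
    have "snd (prod_chart c) (w, 0) = snd (prod_chart d) (w, 0)"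
      by (simp only: eq)
    then show ?thesis
      by (simp add: prod_chart_def)
  qed
  ultimately show "c = d"
    by (simp add: prod_eq_iff fun_eq_iff)
qed

text \<open>The 1-form \<open>\<alpha> + \<pi> r\<^sup>2 dt\<close> on \<open>W \<times> \<complex>\<close>: with \<open>z = x + iy = r e\<^bsup>2\<pi>it\<^esup>\<close> one has
  \<open>\<pi> r\<^sup>2 dt = (x dy - y dx) / 2\<close>.\<close>

definition prod_form ::
  "('a, 'e) one_form \<Rightarrow> ('a \<times> complex, 'e \<times> complex) one_form" where
  "prod_form \<alpha> d = (\<lambda>(x, z) (u, \<zeta>).
     \<alpha> (inv prod_chart d) x u + (Re z * Im \<zeta> - Im z * Re \<zeta>) / 2)"

text \<open>The smooth structure and the restriction of a form on a codimension 0 submanifold with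
  boundary \<open>S\<close> of a manifold with atlas \<open>B\<close>.\<close>

definition sub_atlas ::
  "('a::metric_space, 'e::euclidean_space) chart set \<Rightarrow> 'a set \<Rightarrow> ('a, 'e) chart set" where
  "sub_atlas B S = {d. is_chart S d \<and> (\<forall>c\<in>B. compatible c d)}"

definition sub_form ::
  "('a, 'e::euclidean_space) chart set \<Rightarrow> ('a, 'e) one_form \<Rightarrow> ('a, 'e) one_form" where
  "sub_form B \<beta> d x v =
     (let c = (SOME c. c \<in> B \<and> chart_inv d x \<in> fst c)
      in \<beta> c (coord_change d c x)
           (frechet_derivative (coord_change d c) (at x within overlap d c) v))"

definition tube :: "'a set \<Rightarrow> (real \<Rightarrow> 'a \<Rightarrow> real) \<Rightarrow> ('a \<times> complex) set" where
  "tube W H = {(w, z). w \<in> W \<and> (\<exists>r t. 0 \<le> r \<and> z = of_real r * cis (2 * pi * t) \<and>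
                                     pi * (cmod z)\<^sup>2 \<le> H t w)}"

definition tube_atlas ::
  "'a::metric_space set \<Rightarrow> ('a, 'e::euclidean_space) chart set \<Rightarrow> (real \<Rightarrow> 'a \<Rightarrow> real) \<Rightarrow>
   ('a \<times> complex, 'e \<times> complex) chart set" where
  "tube_atlas W A H = sub_atlas (prod_chart ` A) (tube W H)"

definition tube_form ::
  "('a, 'e::euclidean_space) chart set \<Rightarrow> ('a, 'e) one_form \<Rightarrow>
   ('a \<times> complex, 'e \<times> complex) one_form" where
  "tube_form A \<alpha> = sub_form (prod_chart ` A) (prod_form \<alpha>)"

section \<open>Topological entropy\<close>

text \<open>Bowen's definition by \<open>(n, \<epsilon>)\<close>-separated sets; for continuous self-maps of a compact \<open>X\<close> the
  value does not depend on the metric inducing the topology.\<close>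

definition separated ::
  "('a::metric_space \<Rightarrow> 'a) \<Rightarrow> nat \<Rightarrow> real \<Rightarrow> 'a set \<Rightarrow> bool" where
  "separated f n \<epsilon> E \<longleftrightarrow>
     (\<forall>x\<in>E. \<forall>y\<in>E. x \<noteq> y \<longrightarrow> (\<exists>k<n. \<epsilon> < dist ((f ^^ k) x) ((f ^^ k) y)))"

definition h_top :: "'a::metric_space set \<Rightarrow> ('a \<Rightarrow> 'a) \<Rightarrow> ereal" where
  "h_top X f =
     (SUP \<epsilon>\<in>{0<..}. limsup (\<lambda>n.
        SUP E\<in>{E. finite E \<and> E \<subseteq> X \<and> separated f n \<epsilon> E}. ereal (ln (real (card E)) / real n)))"

end

theory Submission
  imports Defs
begin

text \<open>On \<open>\<partial>W\<close> the Hamiltonian vector field is \<open>X\<^sub>H = \<lambda>(X\<^sub>H) R\<close> with \<open>R\<close> the Reeb field and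
  \<open>\<lambda>(X\<^sub>H) = \<tau> > 0\<close>, so the Hamiltonian flow on \<open>\<partial>W\<close> is a time change of the Reeb flow, and time
  changes preserve positivity of entropy: two orbits of the time-changed flow that stay close correspond
  to orbits of the original flow up to a slowly drifting time shift, and there are only
  \<open>exp(\<delta> n)\<close> many shifts to distinguish. Along the binding \<open>\<partial>W \<times> {0}\<close> the boundary of the tube is
  tangent to \<open>T\<partial>W \<times> \<complex>\<close>, hence the Reeb field there is \<open>(R, 0)\<close> and the binding is an invariant copy of
  the Reeb flow on \<open>\<partial>W\<close>. Both entropies therefore dominate a positive one. Integral curves are unique by
  Gronwall's inequality; points without a complete Reeb orbit are all sent to one junk value by \<open>THE\<close>
  and contribute no entropy.\<close>

section \<open>Functions of class \<open>C\<^sup>k\<close>\<close>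

text \<open>Both claims rest on one sign. On the boundary H vanishes, so dH is \<open>k\<close>
  times the inward conormal; pairing with the Liouville field Y gives k (Y . \<nu>) = d\<lambda>(X,
  Y) = - \<lambda>(X) < 0, and outwardness of Y forces k > 0. This makes X tangent to the boundary,
  and it makes a local extension \<open>g\<close> of H increase strictly along the inward normal, so
  that \<pi> |z|^2 = g is a smooth hypersurface at the binding. The atlas of the tube is defined as
  the set of all compatible charts; that one of them contains a given binding point has to be
  proved, and straightening this hypersurface does it.

  Vector fields are defined by \<open>THE\<close> as solutions of linear equations in a chart. They
  are shown to be locally Lipschitz, the regularity that Gronwall asks for. Derivatives at the
  boundary are taken within half-space pieces, where they are unique because every direction or its
  opposite leads into the piece.

  In the entropy estimate the sampling length is chosen against the growth rate, so that the shifts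
  account for a factor of at most exp(c n / 2) out of exp(c n).\<close>

lemma Ck_on_subset: "Ck_on k U f \<Longrightarrow> V \<subseteq> U \<Longrightarrow> Ck_on k V f"
  by (induction k arbitrary: f) (auto intro: continuous_on_subset)

lemma Ck_on_cong:
  assumes "open U" "\<And>x. x \<in> U \<Longrightarrow> f x = g x" "Ck_on k U f"
  shows "Ck_on k U g"
  using assms(2,3)
proof (induction k arbitrary: f g)
  case 0
  then show ?case
    by (metis Ck_on.simps(1) continuous_on_cong)
next
  case (Suc k)
  have d: "(g has_derivative frechet_derivative f (at x)) (at x)" if "x \<in> U" for x
    using Suc.prems that assms(1)
    by (auto simp: frechet_derivative_works intro: has_derivative_transform_within_open)
  then have e: "frechet_derivative g (at x) = frechet_derivative f (at x)" if "x \<in> U" for x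
    using that by (metis frechet_derivative_at)
  show ?case
    using d e Suc by (auto simp: differentiable_def intro: Suc.IH[of "\<lambda>x. frechet_derivative f (at x) _"])
qed

text \<open>The recursion in \<open>Ck_on\<close> speaks of \<open>frechet_derivative\<close>; this
  rule lets an explicit derivative take its place. The closure properties below follow from it by
  induction on \<open>k\<close>, with the usual differentiation rules supplying
  \<open>F\<close>.\<close>

lemma Ck_on_SucI:
  assumes "open U" "\<And>x. x \<in> U \<Longrightarrow> (f has_derivative F x) (at x)" "\<And>v. Ck_on k U (\<lambda>x. F x v)"
  shows "Ck_on (Suc k) U f"
proof -
  have "F x = frechet_derivative f (at x)" if "x \<in> U" for x
    using assms(2)[OF that] by (rule frechet_derivative_at)
  then have "Ck_on k U (\<lambda>x. frechet_derivative f (at x) v)" for v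
    by (intro Ck_on_cong[OF assms(1) _ assms(3)]) auto
  then show ?thesis
    using assms(2) by (auto simp: differentiable_def)
qed

lemma Ck_on_continuous_on: "Ck_on k U f \<Longrightarrow> continuous_on U f"
  by (cases k) (simp_all add: continuous_at_imp_continuous_on differentiable_imp_continuous_within)

lemma Ck_on_SucD: "Ck_on (Suc k) U f \<Longrightarrow> Ck_on k U f"
proof (induction k arbitrary: f)
  case 0
  then show ?case
    by (metis Ck_on.simps(1) Ck_on_continuous_on)
next
  case (Suc k)
  then show ?case
    by (metis Ck_on.simps(2))
qed

lemma Ck_on_Suc_has_derivative:
  "Ck_on (Suc k) U f \<Longrightarrow> x \<in> U \<Longrightarrow> (f has_derivative frechet_derivative f (at x)) (at x)"
  by (metis Ck_on.simps(2) frechet_derivative_works)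

lemma Ck_on_const: "open U \<Longrightarrow> Ck_on k U (\<lambda>x. c)"
  by (induction k arbitrary: c) (auto intro!: Ck_on_SucI[where F = "\<lambda>x v. 0"] simp del: Ck_on.simps(2))

lemma Ck_on_add:
  "open U \<Longrightarrow> Ck_on k U f \<Longrightarrow> Ck_on k U g \<Longrightarrow> Ck_on k U (\<lambda>x. f x + g x)"
proof (induction k arbitrary: f g)
  case 0
  then show ?case
    by (auto intro: continuous_on_add)
next
  case (Suc k)
  show ?case
    by (rule Ck_on_SucI[OF Suc.prems(1) has_derivative_add[OF
          Ck_on_Suc_has_derivative[OF Suc.prems(2)] Ck_on_Suc_has_derivative[OF Suc.prems(3)]]])
      (use Suc.prems in \<open>auto intro: Suc.IH\<close>)
qed

lemma Ck_on_sum: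
  "open U \<Longrightarrow> (\<And>i. i \<in> I \<Longrightarrow> Ck_on k U (f i)) \<Longrightarrow> Ck_on k U (\<lambda>x. \<Sum>i\<in>I. f i x)"
  by (induction I rule: infinite_finite_induct) (auto intro: Ck_on_add Ck_on_const)

lemma Ck_on_bounded_linear:
  "open U \<Longrightarrow> bounded_linear L \<Longrightarrow> Ck_on k U f \<Longrightarrow> Ck_on k U (\<lambda>x. L (f x))"
proof (induction k arbitrary: f)
  case 0
  then show ?case
    by (auto intro: bounded_linear.continuous_on)
next
  case (Suc k)
  show ?case
    by (rule Ck_on_SucI[OF Suc.prems(1) bounded_linear.has_derivative[OF Suc.prems(2)
          Ck_on_Suc_has_derivative[OF Suc.prems(3)]]])
      (use Suc.prems in \<open>auto intro: Suc.IH\<close>)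
qed

lemma Ck_on_bounded_bilinear:
  "open U \<Longrightarrow> bounded_bilinear B \<Longrightarrow> Ck_on k U f \<Longrightarrow> Ck_on k U g \<Longrightarrow> Ck_on k U (\<lambda>x. B (f x) (g x))"
proof (induction k arbitrary: f g)
  case 0
  then show ?case
    by (auto intro: bounded_bilinear.continuous_on)
next
  case (Suc k)
  show ?case
    by (rule Ck_on_SucI[OF Suc.prems(1) bounded_bilinear.FDERIV[OF Suc.prems(2)
          Ck_on_Suc_has_derivative[OF Suc.prems(3)] Ck_on_Suc_has_derivative[OF Suc.prems(4)]]])
      (use Suc.prems Ck_on_SucD[OF Suc.prems(3)] Ck_on_SucD[OF Suc.prems(4)] in \<open>auto intro!: Ck_on_add
          Suc.IH\<close>)
qed

text \<open>\<open>Ck_on\<close> controls a derivative at fixed vectors only, and smoothness of a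
  form is stated in the same way. When the argument vector varies with the point, as in the chain
  rule or a pullback, it is expanded in the basis so that only fixed vectors remain.\<close>

lemma linear_expand_basis:
  fixes x :: "'a::euclidean_space"
  assumes "linear L"
  shows "L x = (\<Sum>b\<in>Basis. (x \<bullet> b) *\<^sub>R L b)"
  using linear_sum[OF assms, of "\<lambda>b. (x \<bullet> b) *\<^sub>R b" Basis]
  by (simp add: euclidean_representation linear_scale[OF assms])

lemma Ck_on_compose:
  fixes f :: "'a::euclidean_space \<Rightarrow> 'b::euclidean_space"
  assumes "open U" "open V"
  shows "Ck_on k U f \<Longrightarrow> Ck_on k V g \<Longrightarrow> f ` U \<subseteq> V \<Longrightarrow> Ck_on k U (\<lambda>x. g (f x))"
proof (induction k arbitrary: g)
  case 0
  then show ?case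
    by (auto intro: continuous_on_compose2)
next
  case (Suc k)
  have d: "((\<lambda>x. g (f x)) has_derivative
      (\<lambda>v. \<Sum>b\<in>Basis. (frechet_derivative f (at x) v \<bullet> b) *\<^sub>R frechet_derivative g (at (f x)) b)) (at x)"
    if "x \<in> U" for x
  proof -
    have g: "(g has_derivative frechet_derivative g (at (f x))) (at (f x))"
      using Suc.prems that by (intro Ck_on_Suc_has_derivative) auto
    have l: "linear (frechet_derivative g (at (f x)))"
      using g has_derivative_linear by blast
    from has_derivative_compose[OF Ck_on_Suc_has_derivative[OF Suc.prems(1) that] g]
    show ?thesis
      by (subst (asm) linear_expand_basis[OF l])
  qed
  have f: "Ck_on k U f"
    using Ck_on_SucD Suc.prems(1) .
  show ?case
  proof (rule Ck_on_SucI[OF assms(1) d])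
    fix v
    show "Ck_on k U (\<lambda>x. \<Sum>b\<in>Basis. (frechet_derivative f (at x) v \<bullet> b) *\<^sub>R frechet_derivative g (at (f x)) b)"
      using Suc.prems f
      by (intro Ck_on_sum assms Ck_on_bounded_bilinear[OF _ bounded_bilinear_scaleR]
          Ck_on_bounded_linear[OF _ bounded_linear_inner_left] Suc.IH) auto
  qed auto
qed

lemma Ck_on_inverse:
  fixes f :: "'a::euclidean_space \<Rightarrow> real"
  assumes "open U" "\<And>x. x \<in> U \<Longrightarrow> f x \<noteq> 0"
  shows "Ck_on k U f \<Longrightarrow> Ck_on k U (\<lambda>x. inverse (f x))"
proof (induction k)
  case 0
  then show ?case
    using assms by (auto intro!: continuous_on_inverse)
next
  case (Suc k)
  have f: "Ck_on k U f"
    using Ck_on_SucD Suc.prems .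
  note mult = Ck_on_bounded_bilinear[OF assms(1) bounded_bilinear_mult]
  show ?case
    by (rule Ck_on_SucI[OF assms(1) Deriv.has_derivative_inverse[OF assms(2) Ck_on_Suc_has_derivative[OF
        Suc.prems]]])
      (use f Suc in \<open>auto intro!: mult Ck_on_bounded_linear[OF assms(1) bounded_linear_minus]\<close>)
qed

lemma Ck_on_Pair:
  "open U \<Longrightarrow> Ck_on k U f \<Longrightarrow> Ck_on k U g \<Longrightarrow> Ck_on k U (\<lambda>x. (f x, g x))"
  using Ck_on_add[of U k "\<lambda>x. (f x, 0)" "\<lambda>x. (0, g x)"]
    Ck_on_bounded_linear[of U "\<lambda>y. (y, 0)" k f] Ck_on_bounded_linear[of U "\<lambda>y. (0, y)" k g]
  by (simp add: bounded_linear_Pair bounded_linear_ident bounded_linear_zero)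

lemma Ck_on_linear: 
  assumes "open U" "bounded_linear L" shows "Ck_on k U L"
proof (cases k)
  case 0
  then show ?thesis
    using assms by (simp add: linear_continuous_on)
next
  case (Suc j)
  show ?thesis
    unfolding Suc
    by (rule Ck_on_SucI[OF assms(1) bounded_linear_imp_has_derivative[OF assms(2)]])
      (rule Ck_on_const[OF assms(1)])
qed

text \<open>The mean value theorem is applied twice: in direction \<open>u\<close> to the increment
  along \<open>v\<close>, and along \<open>v\<close> to the derivative in direction
  \<open>u\<close>. The point is that the left side is symmetric in \<open>u\<close> and
  \<open>v\<close>.\<close>

lemma second_difference_mvt:
  fixes f :: "'a::euclidean_space \<Rightarrow> real"
  assumes U: "ball x e \<subseteq> U" and f: "Ck_on (Suc (Suc 0)) U f"
    and h: "0 < h" "h * (norm u + norm v) < e"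
  shows "\<exists>y\<in>cball x (h * (norm u + norm v)).
    f (x + h *\<^sub>R u + h *\<^sub>R v) - f (x + h *\<^sub>R u) - f (x + h *\<^sub>R v) + f x
      = h\<^sup>2 * frechet_derivative (\<lambda>z. frechet_derivative f (at z) u) (at y) v"
proof -
  have mem: "x + s *\<^sub>R u + t *\<^sub>R v \<in> cball x (h * (norm u + norm v))" if "0 \<le> s" "s \<le> h" "0 \<le> t" "t \<le> h" for s t
  proof -
    have "norm (s *\<^sub>R u + t *\<^sub>R v) \<le> s * norm u + t * norm v"
      using norm_triangle_ineq[of "s *\<^sub>R u" "t *\<^sub>R v"] that by simp
    also have "\<dots> \<le> h * (norm u + norm v)"
      using that by (auto simp: distrib_left intro!: add_mono mult_right_mono)
    finally show ?thesis
      using norm_minus_cancel[of "s *\<^sub>R u + t *\<^sub>R v"] by (simp add: dist_norm)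
  qed
  then have memU: "x + s *\<^sub>R u + t *\<^sub>R v \<in> U" if "0 \<le> s" "s \<le> h" "0 \<le> t" "t \<le> h" for s t
    using that h U by fastforce
  define D where "D z = frechet_derivative f (at z)" for z
  have D: "(f has_derivative D z) (at z)" if "z \<in> U" for z
    unfolding D_def using f that by (intro Ck_on_Suc_has_derivative)
  have D2: "((\<lambda>z. D z u) has_derivative frechet_derivative (\<lambda>z. D z u) (at z)) (at z)" if "z \<in> U" for z
    using f that by (auto simp: D_def frechet_derivative_works)
  have "\<exists>s. 0 < s \<and> s < h \<and>
     (f (x + h *\<^sub>R u + h *\<^sub>R v) - f (x + h *\<^sub>R u + 0 *\<^sub>R v)) - (f (x + 0 *\<^sub>R u + h *\<^sub>R v) - f (x + 0 *\<^sub>R u + 0 *\<^sub>R v))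
      = (h - 0) * (D (x + s *\<^sub>R u + h *\<^sub>R v) u - D (x + s *\<^sub>R u + 0 *\<^sub>R v) u)"
  proof (intro MVT2 h)
    fix s assume s: "0 \<le> s" "s \<le> h"
    have "((\<lambda>s. f (x + s *\<^sub>R u + t *\<^sub>R v)) has_real_derivative D (x + s *\<^sub>R u + t *\<^sub>R v) u) (at s)"
      if t: "0 \<le> t" "t \<le> h" for t
    proof -
      interpret bounded_linear "D (x + s *\<^sub>R u + t *\<^sub>R v)"
        using D[OF memU[OF s t]] by (rule has_derivative_bounded_linear)
      have "((\<lambda>s. x + s *\<^sub>R u + t *\<^sub>R v) has_derivative (\<lambda>r. r *\<^sub>R u)) (at s)"
        by (auto intro!: derivative_eq_intros)
      from has_derivative_compose[OF this D[OF memU[OF s t]]] show ?thesis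
        by (simp add: has_field_derivative_def scaleR mult_commute_abs)
    qed
    from this[of h] this[of 0] h show "((\<lambda>s. f (x + s *\<^sub>R u + h *\<^sub>R v) - f (x + s *\<^sub>R u + 0 *\<^sub>R v))
        has_real_derivative
      D (x + s *\<^sub>R u + h *\<^sub>R v) u - D (x + s *\<^sub>R u + 0 *\<^sub>R v) u) (at s)"
      by (intro DERIV_diff) auto
  qed
  then obtain s where s: "0 < s" "s < h" and s1:
    "f (x + h *\<^sub>R u + h *\<^sub>R v) - f (x + h *\<^sub>R u) - f (x + h *\<^sub>R v) + f x
      = h * (D (x + s *\<^sub>R u + h *\<^sub>R v) u - D (x + s *\<^sub>R u + 0 *\<^sub>R v) u)"
    by auto
  have "\<exists>t. 0 < t \<and> t < h \<and>
     D (x + s *\<^sub>R u + h *\<^sub>R v) u - D (x + s *\<^sub>R u + 0 *\<^sub>R v) u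
      = (h - 0) * frechet_derivative (\<lambda>z. D z u) (at (x + s *\<^sub>R u + t *\<^sub>R v)) v"
  proof (intro MVT2 h)
    fix t assume t: "0 \<le> t" "t \<le> h"
    have m: "x + s *\<^sub>R u + t *\<^sub>R v \<in> U"
      using memU s t by auto
    interpret bounded_linear "frechet_derivative (\<lambda>z. D z u) (at (x + s *\<^sub>R u + t *\<^sub>R v))"
      using D2[OF m] by (rule has_derivative_bounded_linear)
    have "((\<lambda>t. x + s *\<^sub>R u + t *\<^sub>R v) has_derivative (\<lambda>r. r *\<^sub>R v)) (at t)"
      by (auto intro!: derivative_eq_intros)
    from has_derivative_compose[OF this D2[OF m]]
    show "((\<lambda>t. D (x + s *\<^sub>R u + t *\<^sub>R v) u) has_real_derivative
       frechet_derivative (\<lambda>z. D z u) (at (x + s *\<^sub>R u + t *\<^sub>R v)) v) (at t)"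
      by (simp add: has_field_derivative_def scaleR mult_commute_abs)
  qed
  then obtain t where "0 < t" "t < h" 
    "D (x + s *\<^sub>R u + h *\<^sub>R v) u - D (x + s *\<^sub>R u + 0 *\<^sub>R v) u
      = h * frechet_derivative (\<lambda>z. D z u) (at (x + s *\<^sub>R u + t *\<^sub>R v)) v"
    by auto
  with s1 s show ?thesis
    by (intro bexI[of _ "x + s *\<^sub>R u + t *\<^sub>R v"] mem) (auto simp: power2_eq_square D_def)
qed

text \<open>Schwarz's theorem: both mixed derivatives, taken at points near \<open>x\<close>, equal
  the same second difference quotient, and both are continuous at \<open>x\<close>.\<close>

lemma second_derivative_symmetric_real:
  fixes f :: "'a::euclidean_space \<Rightarrow> real"
  assumes U: "open U" "x \<in> U" and f: "Ck_on (Suc (Suc 0)) U f"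
  shows "frechet_derivative (\<lambda>z. frechet_derivative f (at z) u) (at x) v
       = frechet_derivative (\<lambda>z. frechet_derivative f (at z) v) (at x) u"
proof -
  define P where "P u v y = frechet_derivative (\<lambda>z. frechet_derivative f (at z) u) (at y) v" for u v y
  obtain e where e: "e > 0" "ball x e \<subseteq> U"
    using U open_contains_ball by blast
  have cont: "isCont (P u v) x" for u v
    using f U unfolding P_def by (simp add: continuous_on_eq_continuous_at)
  have close: "\<bar>P u v x - P v u x\<bar> \<le> 2 * r" if r: "r > 0" for r
  proof -
    have "\<exists>d>0. \<forall>y. dist y x < d \<longrightarrow> \<bar>P a b y - P a b x\<bar> < r" for a b
      using cont[of a b] r by (auto simp: continuous_at_eps_delta dist_real_def)
    then obtain d1 d2 where d: "d1 > 0" "d2 > 0"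
      "\<And>y. dist y x < d1 \<Longrightarrow> \<bar>P u v y - P u v x\<bar> < r" "\<And>y. dist y x < d2 \<Longrightarrow> \<bar>P v u y - P v u x\<bar> < r"
      by metis
    define d where "d = min e (min d1 d2)"
    \<comment> \<open>The summand 1 keeps the denominator positive when \<open>u\<close> and
      \<open>v\<close> are both 0.\<close>
    define h where "h = d / (2 * (norm u + norm v + 1))"
    have n: "norm u + norm v + 1 > 0"
      by (simp add: add_nonneg_pos)
    have h: "h > 0" "h * (norm u + norm v) < d"
    proof -
      show "h > 0" using e d n by (simp add: h_def d_def)
      then have "h * (norm u + norm v) < h * (2 * (norm u + norm v + 1))"
        using n by (intro mult_strict_left_mono) auto
      also have "\<dots> = d" using n by (simp add: h_def)
      finally show "h * (norm u + norm v) < d" .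
    qed
    obtain y where y: "y \<in> cball x (h * (norm u + norm v))" and y': 
      "f (x + h *\<^sub>R u + h *\<^sub>R v) - f (x + h *\<^sub>R u) - f (x + h *\<^sub>R v) + f x = h\<^sup>2 * P u v y"
      using second_difference_mvt[OF e(2) f h(1), of u v] h(2) by (auto simp: P_def d_def)
    obtain z where z: "z \<in> cball x (h * (norm v + norm u))" and z': 
      "f (x + h *\<^sub>R v + h *\<^sub>R u) - f (x + h *\<^sub>R v) - f (x + h *\<^sub>R u) + f x = h\<^sup>2 * P v u z"
      using second_difference_mvt[OF e(2) f h(1), of v u] h(2) by (auto simp: P_def d_def add.commute)
    have "x + h *\<^sub>R v + h *\<^sub>R u = x + h *\<^sub>R u + h *\<^sub>R v"
      by simp
    then have "h\<^sup>2 * P u v y = h\<^sup>2 * P v u z"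
      using y' z' by (simp only:)
    then have "P u v y = P v u z"
      using h by simp
    moreover have "\<bar>P u v y - P u v x\<bar> < r" "\<bar>P v u z - P v u x\<bar> < r"
      using d y z h by (auto simp: d_def dist_commute add.commute)
    ultimately show ?thesis
      by linarith
  qed
  have "\<bar>P u v x - P v u x\<bar> \<le> 0"
  proof (rule field_le_epsilon)
    fix e :: real assume "e > 0"
    then show "\<bar>P u v x - P v u x\<bar> \<le> 0 + e"
      using close[of "e / 2"] by simp
  qed
  then show ?thesis
    by (simp add: P_def)
qed

lemma second_derivative_symmetric:
  fixes f :: "'a::euclidean_space \<Rightarrow> 'b::euclidean_space"
  assumes U: "open U" "x \<in> U" and f: "Ck_on (Suc (Suc 0)) U f"
  shows "frechet_derivative (\<lambda>z. frechet_derivative f (at z) u) (at x) v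
       = frechet_derivative (\<lambda>z. frechet_derivative f (at z) v) (at x) u"
proof (rule euclidean_eqI)
  fix b :: 'b assume "b \<in> Basis"
  have d1: "frechet_derivative (\<lambda>z. f z \<bullet> b) (at z) = (\<lambda>w. frechet_derivative f (at z) w \<bullet> b)"
    if "z \<in> U" for z
    by (rule sym, rule frechet_derivative_at)
      (use f that in \<open>auto intro!: derivative_eq_intros simp: frechet_derivative_works\<close>)
  have d2: "frechet_derivative (\<lambda>z. frechet_derivative (\<lambda>z. f z \<bullet> b) (at z) w) (at x)
      = (\<lambda>v. frechet_derivative (\<lambda>z. frechet_derivative f (at z) w) (at x) v \<bullet> b)" for w
  proof (rule sym, rule frechet_derivative_at)
    have "((\<lambda>z. frechet_derivative f (at z) w \<bullet> b) has_derivative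
       (\<lambda>v. frechet_derivative (\<lambda>z. frechet_derivative f (at z) w) (at x) v \<bullet> b)) (at x)"
      using f U by (auto intro!: derivative_eq_intros simp: frechet_derivative_works)
    then show "((\<lambda>z. frechet_derivative (\<lambda>z. f z \<bullet> b) (at z) w) has_derivative
       (\<lambda>v. frechet_derivative (\<lambda>z. frechet_derivative f (at z) w) (at x) v \<bullet> b)) (at x)"
      by (rule has_derivative_transform_within_open[OF _ U]) (simp add: d1)
  qed
  have "Ck_on (Suc (Suc 0)) U (\<lambda>z. f z \<bullet> b)"
    by (rule Ck_on_bounded_linear[OF U(1) bounded_linear_inner_left f])
  from second_derivative_symmetric_real[OF U this, of u v]
  show "frechet_derivative (\<lambda>z. frechet_derivative f (at z) u) (at x) v \<bullet> b
       = frechet_derivative (\<lambda>z. frechet_derivative f (at z) v) (at x) u \<bullet> b"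
    by (simp add: d2)
qed

section \<open>Relatively open subsets of half-spaces\<close>

text \<open>Chart images and their overlaps are of this kind, open sets included
  (\<open>\<nu> = 0\<close>). The normal is hidden so that the notion passes to relatively open
  subsets; it is still strong enough to make derivatives within the set unique.\<close>

definition hs_open :: "'e::euclidean_space set \<Rightarrow> bool" where
  "hs_open T \<longleftrightarrow> (\<exists>\<nu>. openin (top_of_set (half_space \<nu>)) T)"

lemma hs_open_openin:
  assumes "hs_open T" "openin (top_of_set T) S"
  shows "hs_open S"
  using assms openin_trans unfolding hs_open_def by blast

text \<open>Whichever of \<open>v\<close> and \<open>- v\<close> points into the half-space gives a
  segment that stays in \<open>T\<close>; at a boundary point only one of the two may do so.\<close>

lemma hs_open_direction:
  assumes "hs_open T" "x \<in> T"
  shows "\<exists>e>0. (\<forall>s. 0 \<le> s \<and> s < e \<longrightarrow> x + s *\<^sub>R v \<in> T) \<or> (\<forall>s. 0 \<le> s \<and> s < e \<longrightarrow> x - s *\<^sub>R v \<in> T)"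
proof -
  obtain \<nu> e where e: "e > 0" "ball x e \<inter> half_space \<nu> \<subseteq> T" "T \<subseteq> half_space \<nu>"
    using assms unfolding hs_open_def openin_contains_ball by blast
  define r where "r = e / (norm v + 1)"
  have n: "norm v + 1 > 0"
    by (simp add: add_nonneg_pos)
  then have r: "r > 0"
    using e by (simp add: r_def)
  have *: "x + s *\<^sub>R v \<in> ball x e" "x - s *\<^sub>R v \<in> ball x e" if "0 \<le> s" "s < r" for s
  proof -
    have "s * norm v \<le> s * (norm v + 1)"
      using that by (simp add: mult_left_mono)
    also have "\<dots> < e"
      using that n by (simp add: r_def pos_less_divide_eq)
    finally have "s * norm v < e" .
    then show "x + s *\<^sub>R v \<in> ball x e" "x - s *\<^sub>R v \<in> ball x e"
      using that by (simp_all add: dist_norm)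
  qed
  have x: "0 \<le> x \<bullet> \<nu>"
    using assms e by (auto simp: half_space_def)
  show ?thesis
  proof (cases "0 \<le> v \<bullet> \<nu>")
    case True
    then have "x + s *\<^sub>R v \<in> T" if "0 \<le> s" "s < r" for s
      using * that x e(2) by (auto simp: half_space_def inner_add_left)
    then show ?thesis using r by blast
  next
    case False
    then have "x - s *\<^sub>R v \<in> T" if "0 \<le> s" "s < r" for s
      using * that x e(2) mult_nonneg_nonpos[of s "v \<bullet> \<nu>"] by (auto simp: half_space_def inner_diff_left)
    then show ?thesis using r by blast
  qed
qed

text \<open>\<open>frechet_derivative\<close> picks some derivative. One-sided approach along each
  basis vector already determines a derivative within \<open>T\<close>, so at boundary points too
  any derivative found by the rules is the one picked.\<close>

lemma hs_open_frechet_derivative: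
  assumes "hs_open T" "x \<in> T" "(f has_derivative F) (at x within T)"
  shows "frechet_derivative f (at x within T) = F"
proof (rule frechet_derivative_unique_within[OF _ assms(3)])
  show "(f has_derivative frechet_derivative f (at x within T)) (at x within T)"
    using assms(3) differentiable_def frechet_derivative_works by blast
  fix i :: 'a and e :: real assume "i \<in> Basis" "e > 0"
  obtain r where r: "r > 0" and r': "(\<forall>s. 0 \<le> s \<and> s < r \<longrightarrow> x + s *\<^sub>R i \<in> T) \<or> (\<forall>s. 0 \<le> s \<and> s < r \<longrightarrow> x - s *\<^sub>R
      i \<in> T)"
    using hs_open_direction[OF assms(1,2)] by blast
  define s where "s = min r e / 2"
  have s: "0 < s" "s < r" "s < e"
    using r \<open>e > 0\<close> by (auto simp: s_def)
  show "\<exists>d. 0 < \<bar>d\<bar> \<and> \<bar>d\<bar> < e \<and> x + d *\<^sub>R i \<in> T"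
    using r'
  proof
    assume "\<forall>s. 0 \<le> s \<and> s < r \<longrightarrow> x + s *\<^sub>R i \<in> T"
    then show ?thesis using s by (intro exI[of _ s]) auto
  next
    assume "\<forall>s. 0 \<le> s \<and> s < r \<longrightarrow> x - s *\<^sub>R i \<in> T"
    then show ?thesis using s by (intro exI[of _ "- s"]) auto
  qed
qed

text \<open>Used to exchange derivatives within an overlap for derivatives within the whole chart
  image.\<close>

lemma at_within_openin:
  assumes "openin (top_of_set S) T" "x \<in> T"
  shows "at x within T = at x within S"
proof -
  obtain U where "open U" "T = S \<inter> U"
    using assms by (auto simp: openin_open)
  then show ?thesis
    using assms by (intro at_within_nhd[of x U]) auto
qed

section \<open>Smooth maps on arbitrary subsets\<close>

lemma smooth_inE:
  assumes "smooth_in S f" "x \<in> S"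
  obtains U g where "open U" "x \<in> U" "\<And>k. Ck_on k U g" "\<And>y. y \<in> S \<Longrightarrow> y \<in> U \<Longrightarrow> g y = f y"
  using assms unfolding smooth_in_def by (metis IntI)

lemma smooth_inI:
  assumes "\<And>x. x \<in> S \<Longrightarrow> \<exists>U g. open U \<and> x \<in> U \<and> (\<forall>k. Ck_on k U g) \<and> (\<forall>y\<in>S \<inter> U. g y = f y)"
  shows "smooth_in S f"
  using assms unfolding smooth_in_def by blast

lemma smooth_in_local:
  assumes "\<And>x. x \<in> S \<Longrightarrow> \<exists>V. open V \<and> x \<in> V \<and> smooth_in (S \<inter> V) f"
  shows "smooth_in S f"
proof (rule smooth_inI)
  fix x assume x: "x \<in> S"
  then obtain V where V: "open V" "x \<in> V" "smooth_in (S \<inter> V) f"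
    using assms by blast
  obtain U g where U: "open U" "x \<in> U" "\<And>k. Ck_on k U g" "\<And>y. y \<in> S \<inter> V \<Longrightarrow> y \<in> U \<Longrightarrow> g y = f y"
    using V x by (elim smooth_inE[where x = x]) auto
  then show "\<exists>U g. open U \<and> x \<in> U \<and> (\<forall>k. Ck_on k U g) \<and> (\<forall>y\<in>S \<inter> U. g y = f y)"
    using V by (intro exI[of _ "U \<inter> V"] exI[of _ g]) (auto intro: Ck_on_subset)
qed

lemma smooth_in_cong:
  assumes "smooth_in S f" "\<And>x. x \<in> S \<Longrightarrow> f x = g x"
  shows "smooth_in S g"
proof (rule smooth_inI)
  fix x assume "x \<in> S"
  then obtain U h where "open U" "x \<in> U" "\<And>k. Ck_on k U h" "\<And>y. y \<in> S \<Longrightarrow> y \<in> U \<Longrightarrow> h y = f y"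
    using smooth_inE[OF assms(1)] by blast
  then show "\<exists>U h. open U \<and> x \<in> U \<and> (\<forall>k. Ck_on k U h) \<and> (\<forall>y\<in>S \<inter> U. h y = g y)"
    using assms(2) by (intro exI[of _ U] exI[of _ h]) auto
qed

lemma smooth_in_subset:
  assumes "smooth_in S f" "T \<subseteq> S"
  shows "smooth_in T f"
proof (rule smooth_inI)
  fix x assume "x \<in> T"
  then obtain U h where "open U" "x \<in> U" "\<And>k. Ck_on k U h" "\<And>y. y \<in> S \<Longrightarrow> y \<in> U \<Longrightarrow> h y = f y"
    using smooth_inE[OF assms(1)] assms(2) by blast
  then show "\<exists>U h. open U \<and> x \<in> U \<and> (\<forall>k. Ck_on k U h) \<and> (\<forall>y\<in>T \<inter> U. h y = f y)"
    using assms(2) by (intro exI[of _ U] exI[of _ h]) auto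
qed

lemma smooth_in_Ck_on: "open U \<Longrightarrow> (\<And>k. Ck_on k U f) \<Longrightarrow> smooth_in U f"
  unfolding smooth_in_def by blast

lemma smooth_in_const: "smooth_in S (\<lambda>x. c)"
  unfolding smooth_in_def using Ck_on_const open_UNIV by blast

lemma smooth_in_linear: "bounded_linear L \<Longrightarrow> smooth_in S L"
  unfolding smooth_in_def using Ck_on_linear open_UNIV by blast

lemma smooth_in_compose:
  fixes f :: "'a::euclidean_space \<Rightarrow> 'b::euclidean_space"
  assumes "smooth_in S f" "smooth_in T g" "f ` S \<subseteq> T"
  shows "smooth_in S (\<lambda>x. g (f x))"
proof (rule smooth_inI)
  fix x assume x: "x \<in> S"
  then obtain U f' where U: "open U" "x \<in> U" "\<And>k. Ck_on k U f'" "\<And>y. y \<in> S \<Longrightarrow> y \<in> U \<Longrightarrow> f' y = f y"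
    using smooth_inE[OF assms(1) x] by blast
  have "f x \<in> T" using assms x by auto
  then obtain V g' where V: "open V" "f x \<in> V" "\<And>k. Ck_on k V g'" "\<And>y. y \<in> T \<Longrightarrow> y \<in> V \<Longrightarrow> g' y = g y"
    using smooth_inE[OF assms(2) \<open>f x \<in> T\<close>] by blast
  define U' where "U' = U \<inter> f' -` V"
  have U': "open U'"
    unfolding U'_def using U V Ck_on_continuous_on[OF U(3)[of 0]] by (intro continuous_open_preimage) auto
  have "Ck_on k U' (\<lambda>x. g' (f' x))" for k
    using U' V(1) Ck_on_subset[OF U(3)] V(3) by (rule Ck_on_compose) (auto simp: U'_def)
  then show "\<exists>U h. open U \<and> x \<in> U \<and> (\<forall>k. Ck_on k U h) \<and> (\<forall>y\<in>S \<inter> U. h y = g (f y))"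
    using U U' V assms x by (intro exI[of _ U'] exI[of _ "\<lambda>x. g' (f' x)"]) (auto simp: U'_def)
qed

lemma smooth_in_bounded_linear:
  assumes "bounded_linear L" "smooth_in S f"
  shows "smooth_in S (\<lambda>x. L (f x))"
proof (rule smooth_inI)
  fix x assume "x \<in> S"
  then obtain U g where U: "open U" "x \<in> U" "\<And>k. Ck_on k U g" "\<And>y. y \<in> S \<Longrightarrow> y \<in> U \<Longrightarrow> g y = f y"
    using smooth_inE[OF assms(2)] by blast
  then show "\<exists>U h. open U \<and> x \<in> U \<and> (\<forall>k. Ck_on k U h) \<and> (\<forall>y\<in>S \<inter> U. h y = L (f y))"
    using assms by (intro exI[of _ U] exI[of _ "\<lambda>x. L (g x)"]) (auto intro: Ck_on_bounded_linear)
qed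

lemma smooth_in_bounded_bilinear:
  assumes "bounded_bilinear B" "smooth_in S f" "smooth_in S g"
  shows "smooth_in S (\<lambda>x. B (f x) (g x))"
proof (rule smooth_inI)
  fix x assume x: "x \<in> S"
  then obtain U f' where U: "open U" "x \<in> U" "\<And>k. Ck_on k U f'" "\<And>y. y \<in> S \<Longrightarrow> y \<in> U \<Longrightarrow> f' y = f y"
    using smooth_inE[OF assms(2) x] by blast
  obtain V g' where V: "open V" "x \<in> V" "\<And>k. Ck_on k V g'" "\<And>y. y \<in> S \<Longrightarrow> y \<in> V \<Longrightarrow> g' y = g y"
    using smooth_inE[OF assms(3) x] by blast
  have "Ck_on k (U \<inter> V) (\<lambda>x. B (f' x) (g' x))" for k
    using U(1) V(1) assms(1) by (intro Ck_on_bounded_bilinear[OF _ assms(1)] Ck_on_subset[OF U(3)]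
        Ck_on_subset[OF V(3)]) auto
  then show "\<exists>U h. open U \<and> x \<in> U \<and> (\<forall>k. Ck_on k U h) \<and> (\<forall>y\<in>S \<inter> U. h y = B (f y) (g y))"
    using U V by (intro exI[of _ "U \<inter> V"] exI[of _ "\<lambda>x. B (f' x) (g' x)"]) auto
qed

lemma smooth_in_Pair:
  assumes "smooth_in S f" "smooth_in S g"
  shows "smooth_in S (\<lambda>x. (f x, g x))"
proof (rule smooth_inI)
  fix x assume x: "x \<in> S"
  then obtain U f' where U: "open U" "x \<in> U" "\<And>k. Ck_on k U f'" "\<And>y. y \<in> S \<Longrightarrow> y \<in> U \<Longrightarrow> f' y = f y"
    using smooth_inE[OF assms(1) x] by blast
  obtain V g' where V: "open V" "x \<in> V" "\<And>k. Ck_on k V g'" "\<And>y. y \<in> S \<Longrightarrow> y \<in> V \<Longrightarrow> g' y = g y"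
    using smooth_inE[OF assms(2) x] by blast
  have "Ck_on k (U \<inter> V) (\<lambda>x. (f' x, g' x))" for k
    using U(1) V(1) by (intro Ck_on_Pair Ck_on_subset[OF U(3)] Ck_on_subset[OF V(3)]) auto
  then show "\<exists>U h. open U \<and> x \<in> U \<and> (\<forall>k. Ck_on k U h) \<and> (\<forall>y\<in>S \<inter> U. h y = (f y, g y))"
    using U V by (intro exI[of _ "U \<inter> V"] exI[of _ "\<lambda>x. (f' x, g' x)"]) auto
qed

lemma smooth_in_add:
  assumes "smooth_in S f" "smooth_in S g"
  shows "smooth_in S (\<lambda>x. f x + g x)"
  using smooth_in_bounded_linear[OF bounded_linear_add[OF bounded_linear_fst bounded_linear_snd]
      smooth_in_Pair[OF assms]] by simp

lemma smooth_in_sum: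
  "(\<And>i. i \<in> I \<Longrightarrow> smooth_in S (f i)) \<Longrightarrow> smooth_in S (\<lambda>x. \<Sum>i\<in>I. f i x)"
  by (induction I rule: infinite_finite_induct) (auto intro: smooth_in_add smooth_in_const)

lemma smooth_in_diff:
  "smooth_in S f \<Longrightarrow> smooth_in S g \<Longrightarrow> smooth_in S (\<lambda>x. f x - g x)"
  using smooth_in_add[of S f "\<lambda>x. - g x"] smooth_in_bounded_linear[OF bounded_linear_minus[OF
      bounded_linear_ident], of S g]
  by simp

lemma smooth_in_mult:
  fixes f g :: "'a::euclidean_space \<Rightarrow> real"
  shows "smooth_in S f \<Longrightarrow> smooth_in S g \<Longrightarrow> smooth_in S (\<lambda>x. f x * g x)"
  by (rule smooth_in_bounded_bilinear[OF bounded_bilinear_mult])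

lemma has_derivative_within_extension:
  assumes "open U" "x \<in> U" "x \<in> S" "(g has_derivative D) (at x)" "\<And>y. y \<in> S \<Longrightarrow> y \<in> U \<Longrightarrow> g y = f y"
  shows "(f has_derivative D) (at x within S)"
proof (rule has_derivative_transform_eventually[OF has_derivative_at_withinI[OF assms(4)]])
  show "\<forall>\<^sub>F y in at x within S. g y = f y"
    unfolding eventually_at_topological using assms by blast
qed (use assms in auto)

lemma smooth_in_has_derivative:
  assumes "smooth_in S f" "x \<in> S"
  shows "(f has_derivative frechet_derivative f (at x within S)) (at x within S)"
proof -
  obtain U g where U: "open U" "x \<in> U" "\<And>k. Ck_on k U g" "\<And>y. y \<in> S \<Longrightarrow> y \<in> U \<Longrightarrow> g y = f y"
    using smooth_inE[OF assms] by blast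
  then have "(f has_derivative frechet_derivative g (at x)) (at x within S)"
    using has_derivative_within_extension[OF U(1,2) assms(2) Ck_on_Suc_has_derivative[OF U(3) U(2)] U(4)]
        by blast
  then show ?thesis
    using differentiable_def frechet_derivative_works by blast
qed

lemma frechet_derivative_extension:
  assumes "hs_open T" "x \<in> T" "open U" "x \<in> U" "Ck_on (Suc k) U g" "\<And>y. y \<in> T \<Longrightarrow> y \<in> U \<Longrightarrow> g y = f y"
  shows "frechet_derivative f (at x within T) = frechet_derivative g (at x)"
  by (rule hs_open_frechet_derivative[OF assms(1,2)
        has_derivative_within_extension[OF assms(3,4,2) Ck_on_Suc_has_derivative[OF assms(5,4)] assms(6)]])

text \<open>Near each point the derivative within \<open>T\<close> agrees with the full derivative
  of a smooth extension, whichever extension is chosen, and that full derivative is again a smooth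
  extension.\<close>

lemma smooth_in_frechet_derivative:
  assumes "hs_open T" "smooth_in T f"
  shows "smooth_in T (\<lambda>x. frechet_derivative f (at x within T) v)"
proof (rule smooth_inI)
  fix x assume "x \<in> T"
  then obtain U g where U: "open U" "x \<in> U" "\<And>k. Ck_on k U g" "\<And>y. y \<in> T \<Longrightarrow> y \<in> U \<Longrightarrow> g y = f y"
    using smooth_inE[OF assms(2)] by blast
  have "frechet_derivative g (at y) v = frechet_derivative f (at y within T) v" if "y \<in> T" "y \<in> U" for y
    using frechet_derivative_extension[OF assms(1) that(1) U(1) that(2) U(3)] U(4) by simp
  moreover have "Ck_on k U (\<lambda>x. frechet_derivative g (at x) v)" for k
    using U(3)[of "Suc k"] by simp
  ultimately show "\<exists>U h. open U \<and> x \<in> U \<and> (\<forall>k. Ck_on k U h)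
      \<and> (\<forall>y\<in>T \<inter> U. h y = frechet_derivative f (at y within T) v)"
    using U by (intro exI[of _ U] exI[of _ "\<lambda>x. frechet_derivative g (at x) v"]) auto
qed

text \<open>The estimate is made for a smooth extension on a ball, which is convex, so
  \<open>S\<close> itself may be an arbitrary set. The sum of bounds on the partial derivatives
  serves as Lipschitz constant.\<close>

lemma smooth_in_lipschitz:
  fixes f :: "'a::euclidean_space \<Rightarrow> 'b::real_normed_vector"
  assumes "smooth_in S f" "x \<in> S"
  shows "\<exists>e>0. \<exists>L\<ge>0. \<forall>y\<in>S \<inter> ball x e. \<forall>z\<in>S \<inter> ball x e. norm (f y - f z) \<le> L * norm (y - z)"
proof -
  obtain U g where U: "open U" "x \<in> U" "\<And>k. Ck_on k U g" "\<And>y. y \<in> S \<Longrightarrow> y \<in> U \<Longrightarrow> g y = f y"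
    using smooth_inE[OF assms] by blast
  obtain e where e: "e > 0" "cball x e \<subseteq> U"
    using U open_contains_cball by blast
  have g1: "Ck_on (Suc 0) U g" by (rule U(3))
  have "bounded ((\<lambda>y. frechet_derivative g (at y) b) ` cball x e)" for b
    using g1 e by (intro compact_imp_bounded compact_continuous_image) (auto intro:
        continuous_on_subset[of U])
  then obtain B where B: "\<And>b y. y \<in> cball x e \<Longrightarrow> norm (frechet_derivative g (at y) b) \<le> B b"
    unfolding bounded_iff by (metis imageI)
  have der: "(g has_derivative frechet_derivative g (at y)) (at y)" if "y \<in> U" for y
    using Ck_on_Suc_has_derivative[OF g1 that] .
  have "norm (frechet_derivative g (at y) v) \<le> (\<Sum>b\<in>Basis. B b) * norm v" if y: "y \<in> cball x e" for y v
  proof -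
    have "linear (frechet_derivative g (at y))"
      using der y e has_derivative_linear by blast
    then have "norm (frechet_derivative g (at y) v) = norm (\<Sum>b\<in>Basis. (v \<bullet> b) *\<^sub>R frechet_derivative g (at
        y) b)"
      using linear_expand_basis by metis
    also have "\<dots> \<le> (\<Sum>b\<in>Basis. \<bar>v \<bullet> b\<bar> * norm (frechet_derivative g (at y) b))"
      by (rule order_trans[OF norm_sum]) simp
    also have "\<dots> \<le> (\<Sum>b\<in>Basis. norm v * B b)"
      using B[OF y] by (intro sum_mono mult_mono Basis_le_norm) auto
    finally show ?thesis
      by (simp add: sum_distrib_left mult.commute)
  qed
  then have onorm: "onorm (frechet_derivative g (at y)) \<le> (\<Sum>b\<in>Basis. B b)" if "y \<in> cball x e" for y
    using that by (intro onorm_le) auto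
  have "norm (f y - f z) \<le> (\<Sum>b\<in>Basis. B b) * norm (y - z)" if "y \<in> S \<inter> ball x e" "z \<in> S \<inter> ball x e" for y z
  proof -
    have "norm (g y - g z) \<le> (\<Sum>b\<in>Basis. B b) * norm (y - z)"
    proof (rule differentiable_bound[of "cball x e"])
      show "(g has_derivative frechet_derivative g (at w)) (at w within cball x e)" if "w \<in> cball x e" for w
        using der that e by (meson has_derivative_at_withinI subsetD)
    qed (use that onorm in auto)
    moreover have "y \<in> U" "z \<in> U"
      using that e(2) by (auto simp: subset_iff)
    ultimately show ?thesis
      using U(4) that by simp
  qed
  moreover have "B b \<ge> 0" for b
    using B[of x b] e norm_ge_zero order_trans by (metis centre_in_cball less_imp_le)
  ultimately show ?thesis
    using e sum_nonneg[of Basis B] by blast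
qed

section \<open>Naturality of the exterior derivative\<close>

text \<open>The exterior derivative of a 1-form in coordinates, separated from charts so that it can
  also be taken on overlaps and pulled back along coordinate changes.\<close>

definition d1_form :: "('e::euclidean_space \<Rightarrow> 'e \<Rightarrow> real) \<Rightarrow> 'e set \<Rightarrow> 'e \<Rightarrow> 'e \<Rightarrow> 'e \<Rightarrow> real" where
  "d1_form \<beta> T x u v =
     frechet_derivative (\<lambda>y. \<beta> y v) (at x within T) u - frechet_derivative (\<lambda>y. \<beta> y u) (at x within T) v"

lemma ext_deriv_d1_form: "ext_deriv \<alpha> c = d1_form (\<alpha> c) (img c)"
  by (simp add: fun_eq_iff ext_deriv_def d1_form_def)

lemma d1_form_openin:
  assumes "openin (top_of_set S) T" "x \<in> T"
  shows "d1_form \<beta> T x = d1_form \<beta> S x"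
  by (simp add: fun_eq_iff d1_form_def at_within_openin[OF assms])

definition smooth_form_in :: "('e::euclidean_space \<Rightarrow> 'e \<Rightarrow> real) \<Rightarrow> 'e set \<Rightarrow> bool" where
  "smooth_form_in \<beta> T \<longleftrightarrow> (\<forall>x\<in>T. linear (\<beta> x)) \<and> (\<forall>v. smooth_in T (\<lambda>x. \<beta> x v))"

lemma d1_form_antisym: "d1_form \<beta> T x u v = - d1_form \<beta> T x v u"
  by (simp add: d1_form_def)

lemma linear_d1_form_left:
  assumes "smooth_form_in \<beta> T" "hs_open T" "x \<in> T"
  shows "linear (\<lambda>u. d1_form \<beta> T x u v)"
proof -
  have d: "((\<lambda>y. \<beta> y w) has_derivative frechet_derivative (\<lambda>y. \<beta> y w) (at x within T)) (at x within T)" for w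
    using assms smooth_in_has_derivative unfolding smooth_form_in_def by blast
  have "linear (\<lambda>u. frechet_derivative (\<lambda>y. \<beta> y v) (at x within T) u)"
    using d has_derivative_linear by blast
  moreover have "linear (\<lambda>u. frechet_derivative (\<lambda>y. \<beta> y u) (at x within T) v)"
  proof (rule linearI)
    fix a b
    have "((\<lambda>y. \<beta> y (a + b)) has_derivative
      (\<lambda>v. frechet_derivative (\<lambda>y. \<beta> y a) (at x within T) v + frechet_derivative (\<lambda>y. \<beta> y b) (at x within
          T) v)) (at x within T)"
      using assms by (intro has_derivative_transform[OF assms(3) _ has_derivative_add[OF d d]])
        (auto simp: smooth_form_in_def linear_add)
    then show "frechet_derivative (\<lambda>y. \<beta> y (a + b)) (at x within T) v
        = frechet_derivative (\<lambda>y. \<beta> y a) (at x within T) v + frechet_derivative (\<lambda>y. \<beta> y b) (at x within T) v"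
      by (simp add: hs_open_frechet_derivative[OF assms(2,3)])
  next
    fix r b
    have "((\<lambda>y. \<beta> y (r *\<^sub>R b)) has_derivative
      (\<lambda>v. r *\<^sub>R frechet_derivative (\<lambda>y. \<beta> y b) (at x within T) v)) (at x within T)"
      using assms by (intro has_derivative_transform[OF assms(3) _ has_derivative_scaleR_right[OF d]])
        (auto simp: smooth_form_in_def linear_scale)
    then show "frechet_derivative (\<lambda>y. \<beta> y (r *\<^sub>R b)) (at x within T) v
        = r *\<^sub>R frechet_derivative (\<lambda>y. \<beta> y b) (at x within T) v"
      by (simp add: hs_open_frechet_derivative[OF assms(2,3)])
  qed
  ultimately show ?thesis
    unfolding d1_form_def by (rule linear_compose_sub)
qed

lemma linear_d1_form_right:
  assumes "smooth_form_in \<beta> T" "hs_open T" "x \<in> T"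
  shows "linear (d1_form \<beta> T x u)"
proof -
  have "d1_form \<beta> T x u = (\<lambda>v. - d1_form \<beta> T x v u)"
    by (rule ext) (rule d1_form_antisym)
  then show ?thesis
    using linear_compose_neg[OF linear_d1_form_left[OF assms, of u]] by simp
qed

lemma smooth_in_d1_form:
  assumes "smooth_form_in \<beta> T" "hs_open T"
  shows "smooth_in T (\<lambda>x. d1_form \<beta> T x u v)"
  unfolding d1_form_def using assms
  by (intro smooth_in_diff smooth_in_frechet_derivative) (auto simp: smooth_form_in_def)

lemma smooth_form_in_pullback:
  fixes h :: "'e::euclidean_space \<Rightarrow> 'f::euclidean_space"
  assumes T: "hs_open T" and h: "smooth_in T h" "h ` T \<subseteq> S" and \<gamma>: "smooth_form_in \<gamma> S"
    and \<beta>: "\<And>y v. y \<in> T \<Longrightarrow> \<beta> y v = \<gamma> (h y) (frechet_derivative h (at y within T) v)"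
  shows "smooth_form_in \<beta> T"
  unfolding smooth_form_in_def
proof (intro conjI ballI allI)
  fix y assume y: "y \<in> T"
  have "linear (\<gamma> (h y) \<circ> frechet_derivative h (at y within T))"
    using \<gamma> h y has_derivative_linear[OF smooth_in_has_derivative[OF h(1) y]]
    by (intro linear_compose) (auto simp: smooth_form_in_def)
  moreover have "\<beta> y = \<gamma> (h y) \<circ> frechet_derivative h (at y within T)"
    by (rule ext) (simp add: \<beta>[OF y])
  ultimately show "linear (\<beta> y)"
    by simp
next
  fix v
  have "smooth_in T (\<lambda>y. \<Sum>b\<in>Basis. (frechet_derivative h (at y within T) v \<bullet> b) * \<gamma> (h y) b)"
    using \<gamma> h T
    by (intro smooth_in_sum smooth_in_mult smooth_in_bounded_linear[OF bounded_linear_inner_left]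
        smooth_in_frechet_derivative smooth_in_compose[of T h S "\<lambda>z. \<gamma> z _"]) (auto simp: smooth_form_in_def)
  then show "smooth_in T (\<lambda>y. \<beta> y v)"
  proof (rule smooth_in_cong)
    fix y assume y: "y \<in> T"
    have "linear (\<gamma> (h y))"
      using \<gamma> h y by (auto simp: smooth_form_in_def)
    from linear_expand_basis[OF this]
    show "(\<Sum>b\<in>Basis. (frechet_derivative h (at y within T) v \<bullet> b) * \<gamma> (h y) b) = \<beta> y v"
      using \<beta>[OF y] by (metis (no_types, lifting) real_scaleR_def sum.cong)
  qed
qed

text \<open>By the product rule, the derivative of the pullback is the pulled back derivative plus a
  term containing the second derivative of \<open>h\<close>. That term is symmetric in
  \<open>u\<close> and \<open>v\<close> and cancels in the antisymmetrization.\<close>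

lemma d1_form_pullback:
  fixes h :: "'e::euclidean_space \<Rightarrow> 'f::euclidean_space"
  assumes T: "hs_open T" and S: "hs_open S" and h: "smooth_in T h" "h ` T \<subseteq> S" and \<gamma>: "smooth_form_in \<gamma> S"
    and \<beta>: "\<And>y v. y \<in> T \<Longrightarrow> \<beta> y v = \<gamma> (h y) (frechet_derivative h (at y within T) v)"
    and y: "y \<in> T"
  shows "d1_form \<beta> T y u v
    = d1_form \<gamma> S (h y) (frechet_derivative h (at y within T) u) (frechet_derivative h (at y within T) v)"
proof -
  define D where "D z = frechet_derivative h (at z within T)" for z
  obtain U h' where U: "open U" "y \<in> U" "\<And>k. Ck_on k U h'" "\<And>z. z \<in> T \<Longrightarrow> z \<in> U \<Longrightarrow> h' z = h z"
    using smooth_inE[OF h(1) y] by blast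
  have D: "D z = frechet_derivative h' (at z)" if "z \<in> T" "z \<in> U" for z
    unfolding D_def using frechet_derivative_extension[OF T that(1) U(1) that(2) U(3)] U(4) by simp
  have hy: "h y \<in> S" using h y by auto
  define D2 where "D2 v u = frechet_derivative (\<lambda>z. frechet_derivative h' (at z) v) (at y) u" for v u
  define G where "G w = frechet_derivative (\<lambda>z. \<gamma> z w) (at (h y) within S)" for w
  have Dder: "((\<lambda>z. D z v) has_derivative D2 v) (at y within T)" for v
  proof (rule has_derivative_within_extension[of U])
    show "((\<lambda>z. frechet_derivative h' (at z) v) has_derivative D2 v) (at y)"
      using U(2) U(3)[of "Suc (Suc 0)"] unfolding D2_def by (auto simp: frechet_derivative_works)
  qed (use U y D in auto)
  have hder: "(h has_derivative D y) (at y within T)"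
    unfolding D_def using h y by (intro smooth_in_has_derivative)
  have Gder: "((\<lambda>z. \<gamma> z w) has_derivative G w) (at (h y) within S)" for w
    using \<gamma> hy smooth_in_has_derivative unfolding G_def smooth_form_in_def by blast
  have \<gamma>lin: "linear (\<gamma> z)" if "z \<in> S" for z
    using \<gamma> that by (auto simp: smooth_form_in_def)
  have \<gamma>ex: "\<gamma> z w = (\<Sum>b\<in>Basis. (w \<bullet> b) * \<gamma> z b)" if "z \<in> S" for z w
    using linear_expand_basis[OF \<gamma>lin[OF that], of w] by simp
  \<comment> \<open>Uniqueness of derivatives turns linearity of \<open>\<gamma> z w\<close> in
    \<open>w\<close> into linearity of its derivative in \<open>w\<close>.\<close>
  have Gex: "G w = (\<lambda>a. \<Sum>b\<in>Basis. (w \<bullet> b) * G b a)" for w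
    unfolding G_def[of w]
  proof (rule hs_open_frechet_derivative[OF S hy])
    show "((\<lambda>z. \<gamma> z w) has_derivative (\<lambda>a. \<Sum>b\<in>Basis. (w \<bullet> b) * G b a)) (at (h y) within S)"
      by (rule has_derivative_transform[where f = "\<lambda>z. \<Sum>b\<in>Basis. (w \<bullet> b) * \<gamma> z b", OF hy \<gamma>ex])
        (auto intro!: derivative_eq_intros Gder)
  qed
  have \<beta>der: "frechet_derivative (\<lambda>y. \<beta> y v) (at y within T)
      = (\<lambda>u. \<gamma> (h y) (D2 v u) + G (D y v) (D y u))" for v
  proof (rule hs_open_frechet_derivative[OF T y])
    have G': "((\<lambda>z. \<gamma> (h z) b) has_derivative (\<lambda>u. G b (D y u))) (at y within T)" for b
      using has_derivative_in_compose[OF hder has_derivative_subset[OF Gder h(2)]] .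
    have "((\<lambda>z. \<Sum>b\<in>Basis. (D z v \<bullet> b) * \<gamma> (h z) b) has_derivative
       (\<lambda>u. \<Sum>b\<in>Basis. (D y v \<bullet> b) * G b (D y u) + (D2 v u \<bullet> b) * \<gamma> (h y) b)) (at y within T)"
      by (intro has_derivative_sum has_derivative_mult G' has_derivative_inner_left Dder)
    moreover have "(\<lambda>u. \<Sum>b\<in>Basis. (D y v \<bullet> b) * G b (D y u) + (D2 v u \<bullet> b) * \<gamma> (h y) b)
        = (\<lambda>u. \<gamma> (h y) (D2 v u) + G (D y v) (D y u))"
      by (simp add: fun_eq_iff sum.distrib \<gamma>ex[OF hy, of "D2 v _"] Gex[of "D y v"])
    ultimately have d: "((\<lambda>z. \<Sum>b\<in>Basis. (D z v \<bullet> b) * \<gamma> (h z) b) has_derivative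
        (\<lambda>u. \<gamma> (h y) (D2 v u) + G (D y v) (D y u))) (at y within T)"
      by simp
    show "((\<lambda>y. \<beta> y v) has_derivative (\<lambda>u. \<gamma> (h y) (D2 v u) + G (D y v) (D y u))) (at y within T)"
    proof (rule has_derivative_transform[OF y _ d])
      fix z assume z: "z \<in> T"
      then have "h z \<in> S" using h(2) by auto
      from \<gamma>ex[OF this] show "\<beta> z v = (\<Sum>b\<in>Basis. (D z v \<bullet> b) * \<gamma> (h z) b)"
        unfolding \<beta>[OF z] D_def .
    qed
  qed
  have "D2 v u = D2 u v"
    unfolding D2_def using second_derivative_symmetric[OF U(1,2) U(3)] .
  then show ?thesis
    unfolding d1_form_def \<beta>der by (simp add: G_def D_def)
qed

section \<open>Smooth dependence of solutions of linear equations\<close>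

text \<open>The equation \<omega>(n, .) = \<theta> is treated as a linear system with matrix
  \<open>M y\<close>. Injectivity at \<open>x\<close> gives a lower bound \<open>m\<close> for
  \<open>M x\<close>; it persists as \<open>m / 2\<close> nearby and bounds both the solution and
  its variation. Lipschitz dependence is what is recorded, being what Gronwall's inequality
  uses.\<close>

lemma dual_solution_lipschitz:
  fixes \<omega> :: "'e::euclidean_space \<Rightarrow> 'e \<Rightarrow> 'e \<Rightarrow> real"
  assumes x: "x \<in> T"
    and lin: "\<And>y v. y \<in> T \<Longrightarrow> linear (\<omega> y v)" "\<And>y v. y \<in> T \<Longrightarrow> linear (\<lambda>u. \<omega> y u v)"
    and smooth: "\<And>u v. smooth_in T (\<lambda>y. \<omega> y u v)"
    and nondeg: "\<And>u. (\<And>v. \<omega> x u v = 0) \<Longrightarrow> u = 0"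
    and \<theta>: "smooth_form_in \<theta> T"
  shows "\<exists>e>0. \<exists>n L. (\<forall>y\<in>T \<inter> ball x e. (\<forall>v. \<omega> y (n y) v = \<theta> y v) \<and> (\<forall>u. (\<forall>v. \<omega> y u v = 0) \<longrightarrow> u = 0))
    \<and> (\<forall>y\<in>T \<inter> ball x e. \<forall>z\<in>T \<inter> ball x e. norm (n y - n z) \<le> L * norm (y - z))"
proof -
  define M where "M y u = (\<Sum>b\<in>Basis. \<omega> y u b *\<^sub>R b)" for y u
  define t where "t y = (\<Sum>b\<in>Basis. \<theta> y b *\<^sub>R b)" for y
  have Mlin: "linear (M y)" if "y \<in> T" for y
    unfolding M_def
    by (intro linear_compose_sum ballI linearI)
      (simp_all add: linear_add[OF lin(2)[OF that]] linear_scale[OF lin(2)[OF that]] scaleR_left_distrib)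
  have Mb: "M y u \<bullet> b = \<omega> y u b" "t y \<bullet> b = \<theta> y b" if "b \<in> Basis" for y u b
    using that by (simp_all add: M_def t_def inner_sum_left inner_Basis if_distrib[of "\<lambda>x. _ * x"] cong:
        if_cong)
  have Mv: "\<omega> y u v = \<theta>' v" if y: "y \<in> T" and b: "\<And>b. b \<in> Basis \<Longrightarrow> \<omega> y u b = \<theta>' b" and l: "linear \<theta>'" for
      y u v \<theta>'
    using linear_expand_basis[OF lin(1)[OF y], of u v] linear_expand_basis[OF l, of v] b by simp
  have inj_iff: "inj (M y) \<longleftrightarrow> (\<forall>u. (\<forall>v. \<omega> y u v = 0) \<longrightarrow> u = 0)" if y: "y \<in> T" for y
  proof -
    have "M y u = 0 \<longleftrightarrow> (\<forall>v. \<omega> y u v = 0)" for u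
    proof
      assume "M y u = 0"
      then have "\<omega> y u b = 0" if "b \<in> Basis" for b
        using Mb(1)[OF that, of y u] by simp
      then show "\<forall>v. \<omega> y u v = 0"
        using Mv[OF y, of u "\<lambda>_. 0"] linear_zero by blast
    qed (simp add: M_def)
    then show ?thesis
      using linear_injective_0[OF Mlin[OF y]] by simp
  qed
  have "inj (M x)"
    using inj_iff[OF x] nondeg by blast
  then obtain m where m: "m > 0" "\<And>u. m * norm u \<le> norm (M x u)"
    using linear_inj_bounded_below_pos[OF Mlin[OF x]] by blast
  have smM: "smooth_in T (\<lambda>y. M y u)" for u
    unfolding M_def by (intro smooth_in_sum smooth_in_bounded_linear[OF bounded_linear_scaleR_left] smooth)
  have smt: "smooth_in T t"
    unfolding t_def[abs_def] using \<theta>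
    by (intro smooth_in_sum smooth_in_bounded_linear[OF bounded_linear_scaleR_left]) (auto simp:
        smooth_form_in_def)
  obtain e1 L1 where e1: "e1 > 0" "L1 \<ge> 0" 
    "\<And>y z. y \<in> T \<inter> ball x e1 \<Longrightarrow> z \<in> T \<inter> ball x e1 \<Longrightarrow> norm (t y - t z) \<le> L1 * norm (y - z)"
    using smooth_in_lipschitz[OF smt x] by blast
  have "\<forall>b. \<exists>e>0. \<exists>L\<ge>0. \<forall>y\<in>T \<inter> ball x e. \<forall>z\<in>T \<inter> ball x e. norm (M y b - M z b) \<le> L * norm (y - z)"
    using smooth_in_lipschitz[OF smM x] by blast
  then obtain eb Lb where eb: "\<And>b. eb b > 0" "\<And>b. Lb b \<ge> 0"
    "\<And>b y z. y \<in> T \<inter> ball x (eb b) \<Longrightarrow> z \<in> T \<inter> ball x (eb b) \<Longrightarrow> norm (M y b - M z b) \<le> Lb b * norm (y - z)"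
    by metis
  define e2 where "e2 = Min (eb ` (Basis :: 'e set))"
  have e2: "e2 > 0" "\<And>b. b \<in> Basis \<Longrightarrow> e2 \<le> eb b"
    using eb(1) by (auto simp: e2_def)
  define L2 where "L2 = (\<Sum>b\<in>Basis. Lb b)"
  have L2: "L2 \<ge> 0" using eb by (auto simp: L2_def sum_nonneg)
  have lipM: "norm (M y u - M z u) \<le> L2 * norm (y - z) * norm u" if "y \<in> T \<inter> ball x e2" "z \<in> T \<inter> ball x
      e2" for y z u
  proof -
    have "M y u - M z u = (\<Sum>b\<in>Basis. (u \<bullet> b) *\<^sub>R (M y b - M z b))"
      using linear_expand_basis[OF Mlin, of y u] linear_expand_basis[OF Mlin, of z u] that
      by (simp add: scaleR_diff_right sum_subtractf)
    also have "norm \<dots> \<le> (\<Sum>b\<in>Basis. \<bar>u \<bullet> b\<bar> * norm (M y b - M z b))"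
      by (rule order_trans[OF norm_sum]) simp
    also have "\<dots> \<le> (\<Sum>b\<in>Basis. norm u * (Lb b * norm (y - z)))"
      using that e2(2) by (intro sum_mono mult_mono Basis_le_norm eb(3)) force+
    finally show ?thesis
      by (simp add: L2_def sum_distrib_left sum_distrib_right mult_ac)
  qed
  \<comment> \<open>On this radius \<open>M\<close> moves by at most \<open>m / 2\<close>, half of
    the lower bound at \<open>x\<close>.\<close>
  define e where "e = min (min e1 e2) (m / (2 * (L2 + 1)))"
  have e: "e > 0" "e \<le> e1" "e \<le> e2" "L2 * e \<le> m / 2"
  proof -
    show "e > 0" "e \<le> e1" "e \<le> e2" using e1 e2 m L2 by (auto simp: e_def)
    have "L2 * e \<le> (L2 + 1) * (m / (2 * (L2 + 1)))"
      using L2 \<open>e > 0\<close> by (intro mult_mono) (auto simp: e_def)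
    also have "\<dots> = m / 2"
      using L2 by (simp add: divide_simps)
    finally show "L2 * e \<le> m / 2" .
  qed
  have lower: "m / 2 * norm u \<le> norm (M y u)" if y: "y \<in> T \<inter> ball x e" for y u
  proof -
    have "norm (M x u - M y u) \<le> L2 * norm (x - y) * norm u"
      using y x e by (intro lipM) auto
    also have "\<dots> \<le> L2 * e * norm u"
      using y L2 by (intro mult_right_mono mult_left_mono) (auto simp: dist_norm)
    also have "\<dots> \<le> m / 2 * norm u"
      using e by (intro mult_right_mono) auto
    finally show ?thesis
      using m(2)[of u] norm_triangle_sub[of "M x u" "M y u"] by (simp add: field_simps)
  qed
  have injM: "inj (M y)" if y: "y \<in> T \<inter> ball x e" for y
  proof -
    have "u = 0" if "M y u = 0" for u
    proof -
      have "m * norm u \<le> 0"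
        using lower[OF y, of u] that by simp
      then show ?thesis
        using m(1) by (simp add: mult_le_0_iff)
    qed
    then show ?thesis
      using linear_injective_0[OF Mlin, of y] y by blast
  qed
  define n where "n y = (SOME u. M y u = t y)" for y
  have n: "M y (n y) = t y" if y: "y \<in> T \<inter> ball x e" for y
  proof -
    have "surj (M y)"
      using linear_injective_imp_surjective[OF Mlin injM[OF y]] y by blast
    then have "\<exists>u. M y u = t y"
      by (metis surjD)
    then show ?thesis
      unfolding n_def by (rule someI_ex)
  qed
  define C where "C = norm (t x) + L1 * e"
  have nb: "norm (n y) \<le> 2 / m * C" if y: "y \<in> T \<inter> ball x e" for y
  proof -
    have "norm (t y - t x) \<le> L1 * norm (y - x)"
      using y x e by (intro e1(3)) auto
    also have "\<dots> \<le> L1 * e"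
      using y e1(2) by (intro mult_left_mono) (auto simp: dist_norm norm_minus_commute)
    finally have "norm (t y) \<le> C"
      unfolding C_def using norm_triangle_sub[of "t y" "t x"] by simp
    then show ?thesis
      using lower[OF y, of "n y"] n[OF y] m by (simp add: field_simps)
  qed
  have lip: "norm (n y - n z) \<le> 2 / m * (L1 + L2 * (2 / m * C)) * norm (y - z)"
    if y: "y \<in> T \<inter> ball x e" and z: "z \<in> T \<inter> ball x e" for y z
  proof -
    \<comment> \<open>The difference of the two equations, with the change of matrix isolated in the
      second bracket; the lower bound for \<open>M y\<close> turns it into an estimate for
      \<open>n y - n z\<close>.\<close>
    have "M y (n y - n z) = (t y - t z) - (M y (n z) - M z (n z))"
      using n[OF y] n[OF z] linear_diff[OF Mlin, of y] y by simp
    then have "norm (M y (n y - n z)) \<le> norm (t y - t z) + norm (M y (n z) - M z (n z))"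
      by (simp add: norm_triangle_ineq4)
    also have "\<dots> \<le> L1 * norm (y - z) + L2 * norm (y - z) * norm (n z)"
      using y z e by (intro add_mono e1(3) lipM) auto
    also have "\<dots> \<le> L1 * norm (y - z) + L2 * norm (y - z) * (2 / m * C)"
      using nb[OF z] L2 by (intro add_left_mono mult_left_mono) auto
    also have "\<dots> = (L1 + L2 * (2 / m * C)) * norm (y - z)"
      by (simp add: algebra_simps)
    finally have "m / 2 * norm (n y - n z) \<le> (L1 + L2 * (2 / m * C)) * norm (y - z)"
      by (rule order_trans[OF lower[OF y]])
    then have "2 / m * (m / 2 * norm (n y - n z)) \<le> 2 / m * ((L1 + L2 * (2 / m * C)) * norm (y - z))"
      using m by (intro mult_left_mono) auto
    moreover have "2 / m * (m / 2 * norm (n y - n z)) = norm (n y - n z)"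
      using m(1) by simp
    ultimately show ?thesis
      by (simp only: mult.assoc)
  qed
  have sol: "\<omega> y (n y) v = \<theta> y v" if y: "y \<in> T \<inter> ball x e" for y v
  proof (rule Mv)
    show "\<omega> y (n y) b = \<theta> y b" if "b \<in> Basis" for b
      using Mb(1)[OF that, of y "n y"] Mb(2)[OF that, of y] n[OF y] by simp
  qed (use y \<theta> in \<open>auto simp: smooth_form_in_def\<close>)
  show ?thesis
    using e(1) sol lip injM inj_iff by (intro exI[of _ e] conjI exI[of _ n] exI[of _ "2 / m * (L1 + L2 *
        (2 / m * C))"]) auto
qed

section \<open>Integral curves\<close>

lemma is_chart_hs_open: "is_chart M c \<Longrightarrow> hs_open (img c)"
  by (simp add: is_chart_def hs_open_def)

lemma is_chart_subset: "is_chart M c \<Longrightarrow> fst c \<subseteq> M"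
  using openin_imp_subset by (auto simp: is_chart_def)

lemma is_chart_homeomorphism: "is_chart M c \<Longrightarrow> homeomorphism (fst c) (img c) (snd c) (chart_inv c)"
  by (simp add: is_chart_def)

lemma chart_inv_snd: "is_chart M c \<Longrightarrow> p \<in> fst c \<Longrightarrow> chart_inv c (snd c p) = p"
  using is_chart_homeomorphism homeomorphism_apply1 by blast

lemma snd_chart_inv: "x \<in> img c \<Longrightarrow> snd c (chart_inv c x) = x"
  by (simp add: img_def chart_inv_def f_inv_into_f)

lemma chart_inv_in: "x \<in> img c \<Longrightarrow> chart_inv c x \<in> fst c"
  by (simp add: img_def chart_inv_def inv_into_into)

lemma snd_in_img: "p \<in> fst c \<Longrightarrow> snd c p \<in> img c"
  by (simp add: img_def)

lemma openin_chart_ball: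
  assumes "is_chart M c"
  shows "openin (top_of_set M) {q \<in> fst c. dist (snd c q) x < r}"
proof -
  have "continuous_on (fst c) (snd c)"
    using is_chart_homeomorphism[OF assms] by (simp add: homeomorphism_def)
  then have "openin (top_of_set (fst c)) (fst c \<inter> snd c -` ball x r)"
    by (intro continuous_openin_preimage_gen) auto
  moreover have "fst c \<inter> snd c -` ball x r = {q \<in> fst c. dist (snd c q) x < r}"
    by (auto simp: dist_commute)
  ultimately show ?thesis
    using assms openin_trans unfolding is_chart_def by metis
qed

text \<open>Half-spaces are closed, so small closed balls cut the chart image in a compact set even
  around boundary points.\<close>

lemma chart_compact_ball:
  assumes "is_chart M c" "p \<in> fst c" "e > 0"
  obtains r where "0 < r" "r < e" "compact (img c \<inter> cball (snd c p) r)"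
proof -
  obtain \<nu> where \<nu>: "openin (top_of_set (half_space \<nu>)) (img c)"
    using assms by (auto simp: is_chart_def)
  then obtain d where d: "d > 0" "cball (snd c p) d \<inter> half_space \<nu> \<subseteq> img c" "img c \<subseteq> half_space \<nu>"
    using snd_in_img[OF assms(2)] unfolding openin_contains_cball by blast
  define r where "r = min d (e / 2)"
  have "img c \<inter> cball (snd c p) r = cball (snd c p) r \<inter> half_space \<nu>"
    using d by (auto simp: r_def)
  moreover have "half_space \<nu> = {x. 0 \<le> inner \<nu> x}"
    by (simp add: half_space_def inner_commute)
  ultimately have "compact (img c \<inter> cball (snd c p) r)"
    by (simp add: compact_Int_closed closed_halfspace_ge)
  then show ?thesis
    using d assms by (intro that[of r]) (auto simp: r_def)
qed

text \<open>The squared distance times exp(-2 L (s - a)) does not increase. Squaring keeps the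
  function differentiable where the two curves meet.\<close>

lemma gronwall_norm:
  fixes w w' :: "real \<Rightarrow> 'e::euclidean_space"
  assumes "\<And>t. t \<in> {a..b} \<Longrightarrow> (w has_vector_derivative d t) (at t)"
    and "\<And>t. t \<in> {a..b} \<Longrightarrow> (w' has_vector_derivative d' t) (at t)"
    and "\<And>t. t \<in> {a..b} \<Longrightarrow> norm (d t - d' t) \<le> L * norm (w t - w' t)"
    and t: "t \<in> {a..b}"
  shows "norm (w t - w' t) \<le> exp (L * (t - a)) * norm (w a - w' a)"
proof -
  define \<phi> where "\<phi> s = exp (- 2 * L * (s - a)) * ((w s - w' s) \<bullet> (w s - w' s))" for s
  have "\<phi> t \<le> \<phi> a"
  proof (rule DERIV_nonpos_imp_nonincreasing[of a t \<phi>])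
    fix s assume "a \<le> s" "s \<le> t"
    then have s: "s \<in> {a..b}" using t by auto
    have wd: "((\<lambda>s. w s - w' s) has_derivative (\<lambda>h. h *\<^sub>R (d s - d' s))) (at s)"
      using has_vector_derivative_diff[OF assms(1,2)[OF s]] by (simp add: has_vector_derivative_def)
    have "((\<lambda>s. (w s - w' s) \<bullet> (w s - w' s)) has_real_derivative 2 * ((w s - w' s) \<bullet> (d s - d' s))) (at s)"
      unfolding has_field_derivative_def
      by (rule has_derivative_eq_rhs[OF has_derivative_inner[OF wd wd]])
        (auto simp: fun_eq_iff inner_commute mult.commute)
    moreover have "((\<lambda>s. exp (- 2 * L * (s - a))) has_real_derivative exp (- 2 * L * (s - a)) * (- 2 *
        L)) (at s)"
      by (auto intro!: derivative_eq_intros)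
    ultimately have "(\<phi> has_real_derivative exp (- 2 * L * (s - a)) * (- 2 * L) * ((w s - w' s) \<bullet> (w s -
        w' s))
       + 2 * ((w s - w' s) \<bullet> (d s - d' s)) * exp (- 2 * L * (s - a))) (at s)"
      unfolding \<phi>_def by (rule DERIV_mult[rotated])
    moreover have "(w s - w' s) \<bullet> (d s - d' s) \<le> L * ((w s - w' s) \<bullet> (w s - w' s))"
    proof -
      have "(w s - w' s) \<bullet> (d s - d' s) \<le> norm (w s - w' s) * norm (d s - d' s)"
        by (rule norm_cauchy_schwarz)
      also have "\<dots> \<le> norm (w s - w' s) * (L * norm (w s - w' s))"
        using assms(3)[OF s] by (intro mult_left_mono) auto
      finally show ?thesis
        by (simp add: power2_norm_eq_inner[symmetric] power2_eq_square algebra_simps)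
    qed
    then have "exp (- 2 * L * (s - a)) * (2 * ((w s - w' s) \<bullet> (d s - d' s)) - 2 * L * ((w s - w' s) \<bullet> (w
        s - w' s))) \<le> 0"
      by (intro mult_nonneg_nonpos) auto
    then have "exp (- 2 * L * (s - a)) * (- 2 * L) * ((w s - w' s) \<bullet> (w s - w' s))
       + 2 * ((w s - w' s) \<bullet> (d s - d' s)) * exp (- 2 * L * (s - a)) \<le> 0"
      by (simp add: algebra_simps)
    ultimately show "\<exists>y. (\<phi> has_real_derivative y) (at s) \<and> y \<le> 0"
      by blast
  qed (use t in auto)
  then have "exp (- 2 * L * (t - a)) * (norm (w t - w' t))\<^sup>2 \<le> (norm (w a - w' a))\<^sup>2"
    by (simp add: \<phi>_def power2_norm_eq_inner)
  then have "(exp (L * (t - a)))\<^sup>2 * (exp (- 2 * L * (t - a)) * (norm (w t - w' t))\<^sup>2)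
      \<le> (exp (L * (t - a)))\<^sup>2 * (norm (w a - w' a))\<^sup>2"
    by (intro mult_left_mono) auto
  moreover have "(exp (L * (t - a)))\<^sup>2 * exp (- 2 * L * (t - a)) = 1"
    by (simp add: power2_eq_square exp_add[symmetric])
  ultimately have "(norm (w t - w' t))\<^sup>2 \<le> (exp (L * (t - a)) * norm (w a - w' a))\<^sup>2"
    by (simp only: power_mult_distrib mult.assoc[symmetric] mult_1_left)
  then show ?thesis
    by (rule power2_le_imp_le) simp
qed

lemma integral_curve_in: "integral_curve A S X \<gamma> \<Longrightarrow> \<gamma> t \<in> S"
  by (auto simp: integral_curve_def)

text \<open>At speed at most \<open>B\<close> a curve that starts within \<open>r / 2\<close> of
  \<open>x0\<close> moves by at most \<open>r / 4\<close> during time \<open>\<tau>\<close>. The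
  work lies in showing that it has not left the domain of the chart meanwhile, which its coordinates
  alone need not reveal.\<close>

lemma integral_curve_stays:
  fixes c :: "('a::metric_space, 'e::euclidean_space) chart"
  assumes c: "is_chart M c" "c \<in> A" "S \<subseteq> M"
    and r: "0 < r" "compact (img c \<inter> cball x0 r)"
    and B: "B \<ge> 0" "\<And>t y. y \<in> snd c ` (S \<inter> fst c) \<inter> cball x0 r \<Longrightarrow> norm (X t c y) \<le> B"
    and \<tau>: "B * \<tau> \<le> r / 4"
    and \<gamma>: "integral_curve A S X \<gamma>" "\<gamma> a \<in> fst c" "dist (snd c (\<gamma> a)) x0 < r / 2"
    and t: "t \<in> {a..a + \<tau>}"
  shows "\<gamma> t \<in> fst c \<and> dist (snd c (\<gamma> t)) x0 < r"
proof (rule ccontr)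
  define Q where "Q = {q \<in> fst c. dist (snd c q) x0 < r}"
  assume "\<not> ?thesis"
  then have neg: "\<gamma> t \<notin> Q" by (simp add: Q_def)
  obtain U where U: "open U" "Q = M \<inter> U"
    using openin_chart_ball[OF c(1), of x0 r] unfolding Q_def openin_open by blast
  have \<gamma>S: "\<gamma> s \<in> S" for s
    using \<gamma>(1) by (rule integral_curve_in)
  have cont: "continuous_on UNIV \<gamma>"
    using \<gamma> by (simp add: integral_curve_def)
  \<comment> \<open>The closed set of times up to \<open>t\<close> spent outside \<open>Q\<close>;
    its least element \<open>t1\<close> is the first exit time.\<close>
  define Z where "Z = {a..t} \<inter> \<gamma> -` (- U)"
  have Z: "s \<in> Z \<longleftrightarrow> s \<in> {a..t} \<and> \<gamma> s \<notin> Q" for s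
    using \<gamma>S[of s] c(3) U by (auto simp: Z_def)
  have "closed Z"
    unfolding Z_def using U continuous_on_subset[OF cont]
    by (intro continuous_closed_preimage) (auto simp: closed_def)
  then have "compact Z"
    unfolding Z_def by (metis compact_Icc compact_Int_closed inf.left_idem)
  moreover have "t \<in> Z" using neg t by (simp add: Z)
  ultimately obtain t1 where t1: "t1 \<in> Z" "\<And>s. s \<in> Z \<Longrightarrow> t1 \<le> s"
    using compact_attains_inf[of Z] by blast
  have at1: "a < t1" "t1 \<le> t"
  proof -
    have "a \<notin> Z" using \<gamma> r by (auto simp: Z Q_def)
    then have "t1 \<noteq> a" using t1 by auto
    then show "a < t1" "t1 \<le> t" using t1(1) by (auto simp: Z)
  qed
  have before: "\<gamma> s \<in> Q" if "s \<in> {a..<t1}" for s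
  proof (rule ccontr)
    assume "\<gamma> s \<notin> Q"
    then have "s \<in> Z" using that at1 by (auto simp: Z)
    then show False using t1(2)[of s] that by auto
  qed
  \<comment> \<open>The compact set \<open>K\<close> lies inside the chart domain and contains
    \<open>Q\<close>. Being closed, it still contains the curve at the exit time, so the speed bound
    applies up to and including \<open>t1\<close>.\<close>
  define K where "K = chart_inv c ` (img c \<inter> cball x0 r)"
  have "continuous_on (img c \<inter> cball x0 r) (chart_inv c)"
    by (rule continuous_on_subset[OF homeomorphism_cont2[OF is_chart_homeomorphism[OF c(1)]]]) auto
  then have "compact K" unfolding K_def using r by (intro compact_continuous_image)
  have QK: "q \<in> K" if "q \<in> Q" for q
  proof -
    have "q = chart_inv c (snd c q)" "snd c q \<in> img c \<inter> cball x0 r"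
      using that chart_inv_snd[OF c(1)] snd_in_img[of q c] by (auto simp: Q_def dist_commute)
    then show ?thesis unfolding K_def by blast
  qed
  have KI: "q \<in> fst c" "snd c q \<in> cball x0 r" if "q \<in> K" for q
    using that by (auto simp: K_def chart_inv_in snd_chart_inv)
  have "closed K" using \<open>compact K\<close> by (rule compact_imp_closed)
  then have "closed (\<gamma> -` K)"
    using continuous_closed_vimage cont by (metis continuous_on_eq_continuous_at open_UNIV UNIV_I)
  moreover have "{a..<t1} \<subseteq> \<gamma> -` K"
    using before QK by blast
  ultimately have "closure {a..<t1} \<subseteq> \<gamma> -` K"
    by (simp add: closure_minimal)
  then have inK: "\<gamma> s \<in> K" if "s \<in> {a..t1}" for s
    using that at1 by auto
  have "norm (snd c (\<gamma> t1) - snd c (\<gamma> a)) \<le> B * norm (t1 - a)"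
  proof (rule differentiable_bound[of "{a..t1}" "\<lambda>s. snd c (\<gamma> s)" "\<lambda>s h. h *\<^sub>R X s c (snd c (\<gamma> s))"])
    fix s assume s: "s \<in> {a..t1}"
    have "((\<lambda>s. snd c (\<gamma> s)) has_vector_derivative X s c (snd c (\<gamma> s))) (at s)"
      using \<gamma>(1) c(2) KI(1)[OF inK[OF s]] by (auto simp: integral_curve_def)
    then show "((\<lambda>s. snd c (\<gamma> s)) has_derivative (\<lambda>h. h *\<^sub>R X s c (snd c (\<gamma> s)))) (at s within {a..t1})"
      unfolding has_vector_derivative_def by (rule has_derivative_at_withinI)
    have "norm (X s c (snd c (\<gamma> s))) \<le> B"
      using KI[OF inK[OF s]] \<gamma>S[of s] by (intro B) auto
    then show "onorm (\<lambda>h. h *\<^sub>R X s c (snd c (\<gamma> s))) \<le> B"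
      by (intro onorm_le) (auto simp: mult.commute[of B] intro!: mult_left_mono)
  qed (use at1 in auto)
  also have "\<dots> \<le> B * \<tau>"
    using at1 t B by (intro mult_left_mono) auto
  finally have "dist (snd c (\<gamma> t1)) (snd c (\<gamma> a)) \<le> r / 4"
    using \<tau> by (simp add: dist_norm)
  then have "dist (snd c (\<gamma> t1)) x0 < r"
    using \<gamma>(3) r(1) dist_triangle[of "snd c (\<gamma> t1)" x0 "snd c (\<gamma> a)"] by linarith
  then have "\<gamma> t1 \<in> Q"
    using KI(1)[OF inK[of t1]] at1 by (auto simp: Q_def)
  then show False
    using t1(1) Z by blast
qed

text \<open>Existence of integral curves is never needed, so continuous dependence on initial conditions
  is stated for whatever integral curves there are.\<close>

definition close_near where
  "close_near A S X p \<rho> \<tau> \<epsilon> \<delta> \<longleftrightarrow>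
     (\<forall>\<gamma> \<gamma>' a. integral_curve A S X \<gamma> \<longrightarrow> integral_curve A S X \<gamma>' \<longrightarrow>
        dist (\<gamma> a) p < \<rho> \<longrightarrow> dist (\<gamma>' a) p < \<rho> \<longrightarrow> dist (\<gamma> a) (\<gamma>' a) < \<delta> \<longrightarrow>
        (\<forall>t\<in>{a..a + \<tau>}. dist (\<gamma> t) (\<gamma>' t) < \<epsilon>))"

definition slow_near where
  "slow_near A S X p \<rho> \<epsilon> \<delta> \<longleftrightarrow>
     (\<forall>\<gamma> a. integral_curve A S X \<gamma> \<longrightarrow> dist (\<gamma> a) p < \<rho> \<longrightarrow>
        (\<forall>t\<in>{a..a + \<delta>}. dist (\<gamma> t) (\<gamma> a) < \<epsilon>))"

text \<open>The radius \<open>\<rho>\<close> and the time span \<open>\<tau>\<close> come before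
  \<open>\<epsilon>\<close>: steps of one fixed length can then be chained to reach any time, and a
  finite cover of a compact set yields one common step.\<close>

definition tame_at where
  "tame_at A S X p \<longleftrightarrow> (\<exists>\<rho>>0. \<exists>\<tau>>0. \<forall>\<epsilon>>0.
     (\<exists>\<delta>>0. close_near A S X p \<rho> \<tau> \<epsilon> \<delta>) \<and> (\<exists>\<delta>>0. slow_near A S X p \<rho> \<epsilon> \<delta>))"

text \<open>The metric need not be related to the coordinates. All estimates are made in the chart,
  and uniform continuity of the chart and of its inverse on compact sets translates between
  coordinate distance and \<open>dist\<close>.\<close>

lemma lipschitz_imp_tame_at:
  fixes c :: "('a::metric_space, 'e::euclidean_space) chart"
  assumes c: "is_chart M c" "c \<in> A" "S \<subseteq> M" "p \<in> fst c"
    and e: "e > 0"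
    and L: "\<And>t y z. y \<in> snd c ` (S \<inter> fst c) \<inter> ball (snd c p) e \<Longrightarrow> z \<in> snd c ` (S \<inter> fst c) \<inter> ball (snd c p) e \<Longrightarrow>
        norm (X t c y - X t c z) \<le> L * norm (y - z)"
    and B0: "\<And>t y. y \<in> snd c ` (S \<inter> fst c) \<inter> ball (snd c p) e \<Longrightarrow> norm (X t c y) \<le> B"
  shows "tame_at A S X p"
proof -
  define x0 where "x0 = snd c p"
  obtain r where r: "0 < r" "r < e" "compact (img c \<inter> cball x0 r)"
    using chart_compact_ball[OF c(1,4) e] unfolding x0_def .
  define C where "C = img c \<inter> cball x0 r"
  define B' where "B' = \<bar>B\<bar> + 1"
  have B': "B' > 0" "\<And>t y. y \<in> snd c ` (S \<inter> fst c) \<inter> cball x0 r \<Longrightarrow> norm (X t c y) \<le> B'"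
  proof -
    show "B' > 0" by (simp add: B'_def)
    fix t y assume "y \<in> snd c ` (S \<inter> fst c) \<inter> cball x0 r"
    then have "norm (X t c y) \<le> B" using r by (intro B0) (auto simp: x0_def)
    then show "norm (X t c y) \<le> B'" by (simp add: B'_def)
  qed
  \<comment> \<open>The time needed to travel \<open>r / 4\<close> at speed \<open>B'\<close>, as
    \<open>integral_curve_stays\<close> requires.\<close>
  define \<tau> where "\<tau> = r / (4 * B')"
  have \<tau>: "\<tau> > 0" "B' * \<tau> \<le> r / 4"
    using r B' by (auto simp: \<tau>_def)
  define Q where "Q = {q \<in> fst c. dist (snd c q) x0 < r / 2}"
  have "p \<in> Q"
    using c(4) r by (auto simp: Q_def x0_def)
  moreover have "openin (top_of_set M) Q"
    unfolding Q_def by (rule openin_chart_ball[OF c(1)])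
  ultimately obtain \<rho> where \<rho>: "\<rho> > 0" "ball p \<rho> \<inter> M \<subseteq> Q"
    unfolding openin_contains_ball by blast
  have QI: "\<gamma> a \<in> fst c" "dist (snd c (\<gamma> a)) x0 < r / 2" if "integral_curve A S X \<gamma>" "dist (\<gamma> a) p < \<rho>"
      for \<gamma> a
  proof -
    have "\<gamma> a \<in> M" using that(1) c(3) integral_curve_in by blast
    then have "\<gamma> a \<in> Q" using \<rho> that(2) by (auto simp: dist_commute)
    then show "\<gamma> a \<in> fst c" "dist (snd c (\<gamma> a)) x0 < r / 2"
      by (auto simp: Q_def)
  qed
  have stay: "\<gamma> t \<in> fst c" "dist (snd c (\<gamma> t)) x0 < r" "snd c (\<gamma> t) \<in> C"
    "snd c (\<gamma> t) \<in> snd c ` (S \<inter> fst c) \<inter> ball (snd c p) e"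
    "((\<lambda>s. snd c (\<gamma> s)) has_vector_derivative X t c (snd c (\<gamma> t))) (at t)"
    if \<gamma>: "integral_curve A S X \<gamma>" "dist (\<gamma> a) p < \<rho>" and t: "t \<in> {a..a + \<tau>}" for \<gamma> a t
  proof -
    show *: "\<gamma> t \<in> fst c" "dist (snd c (\<gamma> t)) x0 < r"
      using integral_curve_stays[OF c(1-3) r(1,3) _ B'(2) \<tau>(2) \<gamma>(1) QI[OF \<gamma>] t] B'(1) by auto
    show "snd c (\<gamma> t) \<in> C" "snd c (\<gamma> t) \<in> snd c ` (S \<inter> fst c) \<inter> ball (snd c p) e"
      using * snd_in_img[OF *(1)] r(2) integral_curve_in[OF \<gamma>(1), of t]
      by (auto simp: C_def dist_commute x0_def)
    show "((\<lambda>s. snd c (\<gamma> s)) has_vector_derivative X t c (snd c (\<gamma> t))) (at t)"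
      using \<gamma>(1) * c(2) by (auto simp: integral_curve_def)
  qed
  have "continuous_on C (chart_inv c)"
    unfolding C_def by (rule continuous_on_subset[OF homeomorphism_cont2[OF is_chart_homeomorphism[OF
        c(1)]]]) auto
  then have "uniformly_continuous_on C (chart_inv c)"
    using r(3) unfolding C_def by (intro compact_uniformly_continuous)
  then have inv_close: "\<exists>\<eta>>0. \<forall>q q'. q \<in> fst c \<longrightarrow> q' \<in> fst c \<longrightarrow> snd c q \<in> C \<longrightarrow> snd c q' \<in> C \<longrightarrow>
      dist (snd c q) (snd c q') < \<eta> \<longrightarrow> dist q q' < \<epsilon>" if "\<epsilon> > 0" for \<epsilon>
    using that chart_inv_snd[OF c(1)] unfolding uniformly_continuous_on_def by (metis dist_commute)
  define K where "K = chart_inv c ` C"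
  have "compact K"
    unfolding K_def using \<open>continuous_on C _\<close> r(3) by (auto simp: C_def intro: compact_continuous_image)
  have "K \<subseteq> fst c"
    by (auto simp: K_def C_def chart_inv_in)
  then have "continuous_on K (snd c)"
    by (rule continuous_on_subset[OF homeomorphism_cont1[OF is_chart_homeomorphism[OF c(1)]]])
  then have "uniformly_continuous_on K (snd c)"
    using \<open>compact K\<close> by (intro compact_uniformly_continuous)
  moreover have "q \<in> K" if "q \<in> fst c" "snd c q \<in> C" for q
    using that chart_inv_snd[OF c(1)] unfolding K_def by (metis imageI)
  ultimately have chart_close: "\<exists>\<delta>>0. \<forall>q q'. q \<in> fst c \<longrightarrow> q' \<in> fst c \<longrightarrow> snd c q \<in> C \<longrightarrow> snd c q' \<in> C \<longrightarrow>
      dist q q' < \<delta> \<longrightarrow> dist (snd c q) (snd c q') < \<eta>" if "\<eta> > 0" for \<eta>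
    using that unfolding uniformly_continuous_on_def by (metis dist_commute)
  have close: "\<exists>\<delta>>0. close_near A S X p \<rho> \<tau> \<epsilon> \<delta>" if \<epsilon>: "\<epsilon> > 0" for \<epsilon>
  proof -
    obtain \<eta> where \<eta>: "\<eta> > 0" "\<And>q q'. q \<in> fst c \<Longrightarrow> q' \<in> fst c \<Longrightarrow> snd c q \<in> C \<Longrightarrow> snd c q' \<in> C \<Longrightarrow>
      dist (snd c q) (snd c q') < \<eta> \<Longrightarrow> dist q q' < \<epsilon>"
      using inv_close[OF \<epsilon>] by blast
    \<comment> \<open>Initial closeness that stays below \<open>\<eta>\<close> after growth by
      Gronwall's factor.\<close>
    define \<eta>' where "\<eta>' = \<eta> * exp (- \<bar>L\<bar> * \<tau>)"
    have "\<eta>' > 0" using \<eta> by (simp add: \<eta>'_def)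
    from chart_close[OF this] obtain \<delta> where \<delta>: "\<delta> > 0" "\<And>q q'. q \<in> fst c \<Longrightarrow> q' \<in> fst c \<Longrightarrow> snd c q \<in> C \<Longrightarrow>
        snd c q' \<in> C \<Longrightarrow>
      dist q q' < \<delta> \<Longrightarrow> dist (snd c q) (snd c q') < \<eta>'"
      by blast
    show ?thesis
      unfolding close_near_def
    proof (intro exI[of _ \<delta>] conjI allI impI ballI \<delta>(1))
      fix \<gamma> \<gamma>' a t
      assume g: "integral_curve A S X \<gamma>" and g': "integral_curve A S X \<gamma>'"
        and d: "dist (\<gamma> a) p < \<rho>" and d': "dist (\<gamma>' a) p < \<rho>" and dd: "dist (\<gamma> a) (\<gamma>' a) < \<delta>"
        and t: "t \<in> {a..a + \<tau>}"
      note s = stay[OF g d] and s' = stay[OF g' d']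
      have a: "a \<in> {a..a + \<tau>}" using \<tau> by simp
      have "norm (snd c (\<gamma> t) - snd c (\<gamma>' t)) \<le> exp (\<bar>L\<bar> * (t - a)) * norm (snd c (\<gamma> a) - snd c (\<gamma>' a))"
      proof (rule gronwall_norm[OF s(5) s'(5) _ t])
        fix u assume u: "u \<in> {a..a + \<tau>}"
        have "norm (X u c (snd c (\<gamma> u)) - X u c (snd c (\<gamma>' u))) \<le> L * norm (snd c (\<gamma> u) - snd c (\<gamma>' u))"
          by (rule L[OF s(4)[OF u] s'(4)[OF u]])
        also have "\<dots> \<le> \<bar>L\<bar> * norm (snd c (\<gamma> u) - snd c (\<gamma>' u))"
          by (intro mult_right_mono) auto
        finally show "norm (X u c (snd c (\<gamma> u)) - X u c (snd c (\<gamma>' u))) \<le> \<bar>L\<bar> * norm (snd c (\<gamma> u) - snd c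
            (\<gamma>' u))" .
      qed
      also have "\<dots> \<le> exp (\<bar>L\<bar> * \<tau>) * norm (snd c (\<gamma> a) - snd c (\<gamma>' a))"
        using t by (intro mult_right_mono) (auto intro: mult_left_mono)
      also have "\<dots> < exp (\<bar>L\<bar> * \<tau>) * \<eta>'"
        using \<delta>(2)[OF s(1)[OF a] s'(1)[OF a] s(3)[OF a] s'(3)[OF a] dd] by (simp add: dist_norm)
      also have "\<dots> = \<eta>"
        by (simp add: \<eta>'_def exp_minus)
      finally show "dist (\<gamma> t) (\<gamma>' t) < \<epsilon>"
        by (intro \<eta>(2) s(1,3) s'(1,3) t) (simp add: dist_norm)
    qed
  qed
  have speed: "\<exists>\<delta>>0. slow_near A S X p \<rho> \<epsilon> \<delta>" if \<epsilon>: "\<epsilon> > 0" for \<epsilon>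
  proof -
    obtain \<eta> where \<eta>: "\<eta> > 0" "\<And>q q'. q \<in> fst c \<Longrightarrow> q' \<in> fst c \<Longrightarrow> snd c q \<in> C \<Longrightarrow> snd c q' \<in> C \<Longrightarrow>
      dist (snd c q) (snd c q') < \<eta> \<Longrightarrow> dist q q' < \<epsilon>"
      using inv_close[OF \<epsilon>] by blast
    define \<delta> where "\<delta> = min \<tau> (\<eta> / (2 * B'))"
    have \<delta>: "\<delta> > 0" "\<delta> \<le> \<tau>" "B' * \<delta> < \<eta>"
    proof -
      show "\<delta> > 0" "\<delta> \<le> \<tau>" using \<tau> \<eta> B' by (auto simp: \<delta>_def)
      have "B' * \<delta> \<le> B' * (\<eta> / (2 * B'))"
        using B' by (intro mult_left_mono) (auto simp: \<delta>_def)
      also have "\<dots> < \<eta>" using B' \<eta> by simp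
      finally show "B' * \<delta> < \<eta>" .
    qed
    show ?thesis
      unfolding slow_near_def
    proof (intro exI[of _ \<delta>] conjI allI impI ballI \<delta>(1))
      fix \<gamma> a t
      assume g: "integral_curve A S X \<gamma>" and d: "dist (\<gamma> a) p < \<rho>" and t: "t \<in> {a..a + \<delta>}"
      note s = stay[OF g d]
      have sub: "u \<in> {a..a + \<tau>}" if "u \<in> {a..a + \<delta>}" for u using that \<delta> by auto
      have a: "a \<in> {a..a + \<tau>}" using \<tau> by simp
      have "norm (snd c (\<gamma> t) - snd c (\<gamma> a)) \<le> B' * norm (t - a)"
      proof (rule differentiable_bound[of "{a..a + \<delta>}" "\<lambda>s. snd c (\<gamma> s)" "\<lambda>s h. h *\<^sub>R X s c (snd c (\<gamma> s))"])
        fix u assume u: "u \<in> {a..a + \<delta>}"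
        show "((\<lambda>s. snd c (\<gamma> s)) has_derivative (\<lambda>h. h *\<^sub>R X u c (snd c (\<gamma> u)))) (at u within {a..a + \<delta>})"
          using s(5)[OF sub[OF u]] unfolding has_vector_derivative_def by (rule has_derivative_at_withinI)
        have "norm (X u c (snd c (\<gamma> u))) \<le> B'"
          using s(2,4)[OF sub[OF u]] by (intro B') (auto simp: dist_commute)
        then show "onorm (\<lambda>h. h *\<^sub>R X u c (snd c (\<gamma> u))) \<le> B'"
          by (intro onorm_le) (auto simp: mult.commute[of B'] intro!: mult_left_mono)
      qed (use t in auto)
      also have "\<dots> \<le> B' * \<delta>"
        using t B' by (intro mult_left_mono) auto
      finally have "dist (snd c (\<gamma> t)) (snd c (\<gamma> a)) < \<eta>"
        using \<delta>(3) by (simp add: dist_norm)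
      then show "dist (\<gamma> t) (\<gamma> a) < \<epsilon>"
        by (intro \<eta>(2) s(1,3) sub t a)
    qed
  qed
  show ?thesis
    unfolding tame_at_def using \<rho>(1) \<tau>(1) close speed by blast
qed

text \<open>A finite subcover by balls of half the radius of tameness. Only the first curve has to
  start in \<open>K\<close>; the second may start next to it.\<close>

lemma tame_at_uniform:
  assumes "compact K" "\<And>p. p \<in> K \<Longrightarrow> tame_at A S X p"
  obtains \<tau> where "\<tau> > 0"
    "\<And>\<epsilon>. \<epsilon> > 0 \<Longrightarrow> \<exists>\<delta>>0. \<forall>\<gamma> \<gamma>' a. integral_curve A S X \<gamma> \<longrightarrow> integral_curve A S X \<gamma>' \<longrightarrow>
        \<gamma> a \<in> K \<longrightarrow> dist (\<gamma> a) (\<gamma>' a) < \<delta> \<longrightarrow> (\<forall>t\<in>{a..a + \<tau>}. dist (\<gamma> t) (\<gamma>' t) < \<epsilon>)"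
    "\<And>\<epsilon>. \<epsilon> > 0 \<Longrightarrow> \<exists>\<delta>>0. \<forall>\<gamma> a. integral_curve A S X \<gamma> \<longrightarrow> \<gamma> a \<in> K \<longrightarrow>
        (\<forall>t\<in>{a..a + \<delta>}. dist (\<gamma> t) (\<gamma> a) < \<epsilon>)"
proof (cases "K = {}")
  case True
  then show thesis
    by (intro that[of 1]) (auto intro: exI[of _ 1])
next
  case False
  obtain \<rho> \<tau> where pos: "\<And>p. p \<in> K \<Longrightarrow> \<rho> p > 0" "\<And>p. p \<in> K \<Longrightarrow> \<tau> p > 0"
    and close: "\<And>p \<epsilon>. p \<in> K \<Longrightarrow> \<epsilon> > 0 \<Longrightarrow> \<exists>\<delta>>0. close_near A S X p (\<rho> p) (\<tau> p) \<epsilon> \<delta>"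
    and speed: "\<And>p \<epsilon>. p \<in> K \<Longrightarrow> \<epsilon> > 0 \<Longrightarrow> \<exists>\<delta>>0. slow_near A S X p (\<rho> p) \<epsilon> \<delta>"
    using assms(2) unfolding tame_at_def by metis
  obtain D where D: "D \<subseteq> K" "finite D" "K \<subseteq> (\<Union>p\<in>D. ball p (\<rho> p / 2))"
  proof (rule compactE_image[OF assms(1), of K "\<lambda>p. ball p (\<rho> p / 2)"])
    show "K \<subseteq> (\<Union>p\<in>K. ball p (\<rho> p / 2))"
      using pos(1) by force
  qed auto
  have "D \<noteq> {}" using D False by auto
  have cover: "\<exists>p\<in>D. dist q p < \<rho> p / 2" if "q \<in> K" for q
    using D(3) that by (fastforce simp: dist_commute)
  define \<tau>0 where "\<tau>0 = Min (\<tau> ` D)"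
  have \<tau>0: "\<tau>0 > 0" "\<And>p. p \<in> D \<Longrightarrow> \<tau>0 \<le> \<tau> p"
    using D \<open>D \<noteq> {}\<close> pos by (auto simp: \<tau>0_def)
  show thesis
  proof (rule that[OF \<tau>0(1)])
    fix \<epsilon> :: real assume "\<epsilon> > 0"
    then have "\<forall>p\<in>K. \<exists>\<delta>. \<delta> > 0 \<and> close_near A S X p (\<rho> p) (\<tau> p) \<epsilon> \<delta>"
      using close by blast
    from bchoice[OF this] obtain \<delta> where \<delta>: "\<And>p. p \<in> K \<Longrightarrow> \<delta> p > 0"
      "\<And>p. p \<in> K \<Longrightarrow> close_near A S X p (\<rho> p) (\<tau> p) \<epsilon> (\<delta> p)"
      by blast
    \<comment> \<open>The bound \<open>\<rho> p / 2\<close> puts the start of the second curve into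
      the full ball around \<open>p\<close>.\<close>
    define \<delta>0 where "\<delta>0 = Min ((\<lambda>p. min (\<delta> p) (\<rho> p / 2)) ` D)"
    have \<delta>0: "\<delta>0 > 0" "\<And>p. p \<in> D \<Longrightarrow> \<delta>0 \<le> min (\<delta> p) (\<rho> p / 2)"
    proof -
      have "min (\<delta> p) (\<rho> p / 2) > 0" if "p \<in> D" for p
        using \<delta>(1) pos(1) D that by (simp add: subset_iff)
      then show "\<delta>0 > 0"
        using D \<open>D \<noteq> {}\<close> by (simp add: \<delta>0_def)
      show "\<delta>0 \<le> min (\<delta> p) (\<rho> p / 2)" if "p \<in> D" for p
        unfolding \<delta>0_def using D that by (intro Min_le) auto
    qed
    show "\<exists>\<delta>>0. \<forall>\<gamma> \<gamma>' a. integral_curve A S X \<gamma> \<longrightarrow> integral_curve A S X \<gamma>' \<longrightarrow>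
        \<gamma> a \<in> K \<longrightarrow> dist (\<gamma> a) (\<gamma>' a) < \<delta> \<longrightarrow> (\<forall>t\<in>{a..a + \<tau>0}. dist (\<gamma> t) (\<gamma>' t) < \<epsilon>)"
    proof (intro exI[of _ \<delta>0] conjI allI impI ballI \<delta>0(1))
      fix \<gamma> \<gamma>' a t
      assume g: "integral_curve A S X \<gamma>" "integral_curve A S X \<gamma>'"
        and a: "\<gamma> a \<in> K" and d: "dist (\<gamma> a) (\<gamma>' a) < \<delta>0" and t: "t \<in> {a..a + \<tau>0}"
      obtain p where p: "p \<in> D" "dist (\<gamma> a) p < \<rho> p / 2"
        using cover[OF a] by blast
      have "dist (\<gamma>' a) p < \<rho> p"
        using dist_triangle[of "\<gamma>' a" p "\<gamma> a"] p \<delta>0(2)[OF p(1)] d by (simp add: dist_commute)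
      moreover have "dist (\<gamma> a) p < \<rho> p"
        using p zero_le_dist[of "\<gamma> a" p] by linarith
      ultimately show "dist (\<gamma> t) (\<gamma>' t) < \<epsilon>"
        using \<delta>(2)[of p] g d t \<delta>0(2)[OF p(1)] \<tau>0(2)[OF p(1)] D(1) p(1)
        unfolding close_near_def by (smt (verit) atLeastAtMost_iff subsetD)
    qed
  next
    fix \<epsilon> :: real assume "\<epsilon> > 0"
    then have "\<forall>p\<in>K. \<exists>\<delta>. \<delta> > 0 \<and> slow_near A S X p (\<rho> p) \<epsilon> \<delta>"
      using speed by blast
    from bchoice[OF this] obtain \<delta> where \<delta>: "\<And>p. p \<in> K \<Longrightarrow> \<delta> p > 0"
      "\<And>p. p \<in> K \<Longrightarrow> slow_near A S X p (\<rho> p) \<epsilon> (\<delta> p)"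
      by blast
    define \<delta>0 where "\<delta>0 = Min (\<delta> ` D)"
    have \<delta>0: "\<delta>0 > 0" "\<And>p. p \<in> D \<Longrightarrow> \<delta>0 \<le> \<delta> p"
      using D \<open>D \<noteq> {}\<close> \<delta>(1) by (auto simp: \<delta>0_def)
    show "\<exists>\<delta>>0. \<forall>\<gamma> a. integral_curve A S X \<gamma> \<longrightarrow> \<gamma> a \<in> K \<longrightarrow> (\<forall>t\<in>{a..a + \<delta>}. dist (\<gamma> t) (\<gamma> a) < \<epsilon>)"
    proof (intro exI[of _ \<delta>0] conjI allI impI ballI \<delta>0(1))
      fix \<gamma> a t
      assume g: "integral_curve A S X \<gamma>" and a: "\<gamma> a \<in> K" and t: "t \<in> {a..a + \<delta>0}"
      obtain p where p: "p \<in> D" "dist (\<gamma> a) p < \<rho> p / 2"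
        using cover[OF a] by blast
      then have "dist (\<gamma> a) p < \<rho> p"
        using zero_le_dist[of "\<gamma> a" p] by linarith
      then show "dist (\<gamma> t) (\<gamma> a) < \<epsilon>"
        using \<delta>(2)[of p] g t \<delta>0(2)[OF p(1)] D(1) p(1)
        unfolding slow_near_def by (smt (verit) atLeastAtMost_iff subsetD)
    qed
  qed
qed

text \<open>Iterates the fixed step \<open>\<tau>\<close> until \<open>T\<close> is covered. Only
  \<open>\<gamma>\<close> is asked to stay in \<open>K\<close>: later \<open>K\<close> is the
  boundary or the binding, where tameness is known, while a competing curve \<open>\<gamma>'\<close>
  may run anywhere in \<open>S\<close>.\<close>

lemma integral_curves_close:
  assumes "compact K" "\<And>p. p \<in> K \<Longrightarrow> tame_at A S X p" "\<epsilon> > 0"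
  shows "\<exists>\<delta>>0. \<forall>\<gamma> \<gamma>' a. integral_curve A S X \<gamma> \<longrightarrow> integral_curve A S X \<gamma>' \<longrightarrow>
     (\<forall>t\<ge>a. \<gamma> t \<in> K) \<longrightarrow> dist (\<gamma> a) (\<gamma>' a) < \<delta> \<longrightarrow> (\<forall>t\<in>{a..a + T}. dist (\<gamma> t) (\<gamma>' t) < \<epsilon>)"
proof -
  obtain \<tau> where \<tau>: "\<tau> > 0" and
    step: "\<And>\<epsilon>. \<epsilon> > 0 \<Longrightarrow> \<exists>\<delta>>0. \<forall>\<gamma> \<gamma>' a. integral_curve A S X \<gamma> \<longrightarrow> integral_curve A S X \<gamma>' \<longrightarrow>
        \<gamma> a \<in> K \<longrightarrow> dist (\<gamma> a) (\<gamma>' a) < \<delta> \<longrightarrow> (\<forall>t\<in>{a..a + \<tau>}. dist (\<gamma> t) (\<gamma>' t) < \<epsilon>)"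
    using tame_at_uniform[OF assms(1,2)] by metis
  have *: "\<exists>\<delta>>0. \<forall>\<gamma> \<gamma>' a. integral_curve A S X \<gamma> \<longrightarrow> integral_curve A S X \<gamma>' \<longrightarrow>
     (\<forall>t\<ge>a. \<gamma> t \<in> K) \<longrightarrow> dist (\<gamma> a) (\<gamma>' a) < \<delta> \<longrightarrow> (\<forall>t\<in>{a..a + real n * \<tau>}. dist (\<gamma> t) (\<gamma>' t) < \<epsilon>)"
    if "\<epsilon> > 0" for n \<epsilon>
    using that
  proof (induction n arbitrary: \<epsilon>)
    case 0
    then show ?case by (intro exI[of _ \<epsilon>]) auto
  next
    case (Suc n)
    obtain \<eta> where \<eta>: "\<eta> > 0" "\<And>\<gamma> \<gamma>' a t. integral_curve A S X \<gamma> \<Longrightarrow> integral_curve A S X \<gamma>' \<Longrightarrow>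
        \<gamma> a \<in> K \<Longrightarrow> dist (\<gamma> a) (\<gamma>' a) < \<eta> \<Longrightarrow> t \<in> {a..a + \<tau>} \<Longrightarrow> dist (\<gamma> t) (\<gamma>' t) < \<epsilon>"
      using step[OF Suc.prems] by metis
    obtain \<delta> where \<delta>: "\<delta> > 0" "\<And>\<gamma> \<gamma>' a t. integral_curve A S X \<gamma> \<Longrightarrow> integral_curve A S X \<gamma>' \<Longrightarrow>
        \<forall>t\<ge>a. \<gamma> t \<in> K \<Longrightarrow> dist (\<gamma> a) (\<gamma>' a) < \<delta> \<Longrightarrow> t \<in> {a..a + real n * \<tau>} \<Longrightarrow> dist (\<gamma> t) (\<gamma>' t) < min \<epsilon> \<eta>"
      using Suc.IH[of "min \<epsilon> \<eta>"] Suc.prems \<eta>(1) by (metis min_less_iff_conj)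
    show ?case
    proof (intro exI[of _ \<delta>] conjI allI impI ballI \<delta>(1))
      fix \<gamma> \<gamma>' a t
      assume g: "integral_curve A S X \<gamma>" "integral_curve A S X \<gamma>'"
        "\<forall>t\<ge>a. \<gamma> t \<in> K" "dist (\<gamma> a) (\<gamma>' a) < \<delta>" and t: "t \<in> {a..a + real (Suc n) * \<tau>}"
      show "dist (\<gamma> t) (\<gamma>' t) < \<epsilon>"
      proof (cases "t \<le> a + real n * \<tau>")
        case True
        then have "dist (\<gamma> t) (\<gamma>' t) < min \<epsilon> \<eta>"
          using t by (intro \<delta>(2)[OF g]) auto
        then show ?thesis by simp
      next
        case False
        define b where "b = a + real n * \<tau>"
        have b: "b \<ge> a" using \<tau> by (simp add: b_def)
        have "dist (\<gamma> b) (\<gamma>' b) < min \<epsilon> \<eta>"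
          using b by (intro \<delta>(2)[OF g]) (auto simp: b_def)
        then show ?thesis
          using False t g(3) b by (intro \<eta>(2)[OF g(1,2), of b]) (auto simp: b_def algebra_simps)
      qed
    qed
  qed
  obtain n :: nat where "T / \<tau> \<le> real n"
    using real_arch_simple by blast
  then have "T \<le> real n * \<tau>"
    using \<tau> by (simp add: pos_divide_le_eq)
  then have "{a..a + T} \<subseteq> {a..a + real n * \<tau>}" for a
    by auto
  with *[OF assms(3), of n] show ?thesis
    by (meson subsetD)
qed

lemma integral_curve_unique:
  assumes "compact K" "\<And>p. p \<in> K \<Longrightarrow> tame_at A S X p"
    and "integral_curve A S X \<gamma>" "integral_curve A S X \<gamma>'" "\<And>t. t \<ge> a \<Longrightarrow> \<gamma> t \<in> K" "\<gamma> a = \<gamma>' a" "t \<ge> a"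
  shows "\<gamma> t = \<gamma>' t"
proof -
  have "dist (\<gamma> t) (\<gamma>' t) < \<epsilon>" if "\<epsilon> > 0" for \<epsilon>
    using integral_curves_close[OF assms(1,2) that, of "t - a"] assms(3-7) by force
  then show ?thesis
    by (metis dist_pos_lt less_irrefl)
qed

text \<open>Evaluates the \<open>THE\<close> in \<open>time_one_map\<close>: uniqueness is tested
  against all integral curves in \<open>S\<close>, including those that might leave
  \<open>K\<close>.\<close>

lemma time_one_map_eq:
  assumes "compact K" "\<And>p. p \<in> K \<Longrightarrow> tame_at A S X p"
    and "integral_curve A S X \<gamma>" "\<And>t. t \<ge> 0 \<Longrightarrow> \<gamma> t \<in> K"
  shows "time_one_map A S X (\<gamma> 0) = \<gamma> 1"
  unfolding time_one_map_def
proof (rule the_equality)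
  show "\<exists>\<gamma>'. integral_curve A S X \<gamma>' \<and> \<gamma>' 0 = \<gamma> 0 \<and> \<gamma>' 1 = \<gamma> 1"
    using assms(3) by blast
  fix q assume "\<exists>\<gamma>'. integral_curve A S X \<gamma>' \<and> \<gamma>' 0 = \<gamma> 0 \<and> \<gamma>' 1 = q"
  then obtain \<gamma>' where g: "integral_curve A S X \<gamma>'" "\<gamma>' 0 = \<gamma> 0" "\<gamma>' 1 = q"
    by blast
  then show "q = \<gamma> 1"
    using integral_curve_unique[OF assms(1-3) g(1) assms(4), of 0 1] by simp
qed

text \<open>A shifted solution is again a solution when the field does not change with time; the
  second assumption asks for this along the curve itself.\<close>

lemma integral_curve_shift:
  assumes "integral_curve A S X \<gamma>"
    and "\<And>t c. c \<in> A \<Longrightarrow> \<gamma> t \<in> fst c \<Longrightarrow> X t c (snd c (\<gamma> t)) = X (t - b) c (snd c (\<gamma> t))"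
  shows "integral_curve A S X (\<lambda>t. \<gamma> (t + b))"
  unfolding integral_curve_def
proof (intro conjI allI ballI impI)
  show "range (\<lambda>t. \<gamma> (t + b)) \<subseteq> S"
    using integral_curve_in[OF assms(1)] by auto
  have "continuous_on UNIV \<gamma>"
    using assms(1) by (simp add: integral_curve_def)
  then show "continuous_on UNIV (\<lambda>t. \<gamma> (t + b))"
    by (rule continuous_on_compose2[where f = "\<lambda>t. t + b"]) (auto intro: continuous_intros)
  fix t c assume c: "c \<in> A" "\<gamma> (t + b) \<in> fst c"
  have "((\<lambda>s. snd c (\<gamma> s)) has_vector_derivative X (t + b) c (snd c (\<gamma> (t + b)))) (at (t + b))"
    using assms(1) c by (auto simp: integral_curve_def)
  moreover have "((\<lambda>t. t + b) has_vector_derivative 1) (at t)"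
    by (auto intro!: derivative_eq_intros)
  ultimately have "((\<lambda>s. snd c (\<gamma> (s + b))) has_vector_derivative X (t + b) c (snd c (\<gamma> (t + b)))) (at t)"
    using vector_diff_chain_at[of "\<lambda>t. t + b" 1 t] by (fastforce simp: o_def)
  then show "((\<lambda>s. snd c (\<gamma> (s + b))) has_vector_derivative X t c (snd c (\<gamma> (t + b)))) (at t)"
    using assms(2)[OF c] by simp
qed

section \<open>Positive topological entropy\<close>

text \<open>Positivity of the limsup means exponential growth at one scale \<open>\<epsilon>\<close>
  for arbitrarily large \<open>n\<close>. The arguments below work with this form, free of
  suprema.\<close>

lemma h_top_pos_iff:
  "0 < h_top X f \<longleftrightarrow> (\<exists>\<epsilon>>0. \<exists>c>0. \<forall>N. \<exists>n\<ge>N. \<exists>E. finite E \<and> E \<subseteq> X \<and> separated f n \<epsilon> E \<and>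
     exp (c * real n) \<le> real (card E))"
proof -
  define g where "g \<epsilon> n = (SUP E\<in>{E. finite E \<and> E \<subseteq> X \<and> separated f n \<epsilon> E}. ereal (ln (real (card E)) /
      real n))" for \<epsilon> n
  have h: "h_top X f = (SUP \<epsilon>\<in>{0<..}. limsup (g \<epsilon>))"
    by (simp add: h_top_def g_def[abs_def])
  show ?thesis
  proof
    assume "0 < h_top X f"
    then obtain \<epsilon> where \<epsilon>: "\<epsilon> > 0" "0 < limsup (g \<epsilon>)"
      unfolding h less_SUP_iff by auto
    then obtain c where c: "0 < ereal c" "ereal c < limsup (g \<epsilon>)"
      using ereal_dense2 by blast
    have "\<exists>n\<ge>N. \<exists>E. finite E \<and> E \<subseteq> X \<and> separated f n \<epsilon> E \<and> exp (c * real n) \<le> real (card E)" for N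
    proof -
      have "\<not> (\<forall>\<^sub>F n in sequentially. g \<epsilon> n \<le> ereal c)"
        using c(2) Limsup_bounded by (metis not_le)
      \<comment> \<open>\<open>Suc N\<close> makes \<open>n\<close> positive, so that the division
        by \<open>real n\<close> is a genuine one.\<close>
      then obtain n where n: "n \<ge> Suc N" "ereal c < g \<epsilon> n"
        unfolding eventually_sequentially by (meson not_le)
      then obtain E where E: "finite E" "E \<subseteq> X" "separated f n \<epsilon> E" "c < ln (real (card E)) / real n"
        unfolding g_def less_SUP_iff by auto
      have *: "c * real n < ln (real (card E))"
        using E(4) n(1) by (simp add: pos_less_divide_eq)
      moreover have "0 < c * real n"
        using c(1) n(1) by simp
      \<comment> \<open>The default value of \<open>ln\<close> matters: \<open>ln 0\<close> is 0,
        which would contradict the positive lower bound.\<close>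
      ultimately have "card E \<noteq> 0"
        by (intro notI) simp
      then have "exp (c * real n) \<le> real (card E)"
        using * by (metis exp_le_cancel_iff exp_ln less_imp_le of_nat_0_less_iff not_gr_zero)
      then show ?thesis
        using E n(1) by (intro exI[of _ n] conjI exI[of _ E]) auto
    qed
    then show "\<exists>\<epsilon>>0. \<exists>c>0. \<forall>N. \<exists>n\<ge>N. \<exists>E. finite E \<and> E \<subseteq> X \<and> separated f n \<epsilon> E \<and> exp (c * real n) \<le> real
        (card E)"
      using \<epsilon>(1) c(1) by auto
  next
    assume "\<exists>\<epsilon>>0. \<exists>c>0. \<forall>N. \<exists>n\<ge>N. \<exists>E. finite E \<and> E \<subseteq> X \<and> separated f n \<epsilon> E \<and> exp (c * real n) \<le> real (card E)"
    then obtain \<epsilon> c where \<epsilon>: "\<epsilon> > 0" and c: "c > 0"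
      and E: "\<And>N. \<exists>n\<ge>N. \<exists>E. finite E \<and> E \<subseteq> X \<and> separated f n \<epsilon> E \<and> exp (c * real n) \<le> real (card E)"
      by blast
    have "ereal c \<le> limsup (g \<epsilon>)"
    proof (rule ccontr)
      assume "\<not> ereal c \<le> limsup (g \<epsilon>)"
      then have "\<forall>\<^sub>F n in sequentially. g \<epsilon> n < ereal c"
        by (intro Limsup_lessD) auto
      then obtain N where N: "\<And>n. n \<ge> N \<Longrightarrow> g \<epsilon> n < ereal c"
        unfolding eventually_sequentially by blast
      obtain n E where n: "n \<ge> max N 1" and E': "finite E" "E \<subseteq> X" "separated f n \<epsilon> E" "exp (c * real n)
          \<le> real (card E)"
        using E by blast
      have "0 < real (card E)"
        using E'(4) exp_gt_zero less_le_trans by blast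
      then have "c * real n \<le> ln (real (card E))"
        using E'(4) by (simp add: ln_ge_iff)
      then have "c \<le> ln (real (card E)) / real n"
        using n by (simp add: pos_le_divide_eq)
      also have "ereal \<dots> \<le> g \<epsilon> n"
        unfolding g_def using E' by (intro SUP_upper) auto
      finally have "ereal c \<le> g \<epsilon> n" by simp
      then show False using N[of n] n by auto
    qed
    also have "\<dots> \<le> h_top X f"
      unfolding h using \<epsilon> by (intro SUP_upper) auto
    finally show "0 < h_top X f"
      using c by (meson ereal_less(2) less_le_trans)
  qed
qed

text \<open>Separated sets and their cardinalities are carried along an invariant isometric copy. It
  serves for the inclusion of an invariant set into \<open>W\<close> and for the embedding of the
  Reeb flow as binding by p -> (p, 0).\<close>

lemma h_top_pos_isometric_embedding:
  assumes "0 < h_top Y g"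
    and i: "i ` Y \<subseteq> X" "\<And>x y. x \<in> Y \<Longrightarrow> y \<in> Y \<Longrightarrow> dist (i x) (i y) = dist x y"
    and g: "\<And>y. y \<in> Y \<Longrightarrow> g y \<in> Y" "\<And>y. y \<in> Y \<Longrightarrow> f (i y) = i (g y)"
  shows "0 < h_top X f"
proof -
  have pow: "(f ^^ k) (i y) = i ((g ^^ k) y) \<and> (g ^^ k) y \<in> Y" if "y \<in> Y" for k y
    using that g by (induction k) auto
  have inj: "inj_on i Y"
    using i(2) by (metis dist_eq_0_iff inj_onI)
  have sep: "separated f n \<epsilon> (i ` E)" if EY: "E \<subseteq> Y" "separated g n \<epsilon> E" for n \<epsilon> E
    unfolding separated_def
  proof (intro ballI impI)
    fix x' y' assume "x' \<in> i ` E" "y' \<in> i ` E" "x' \<noteq> y'"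
    then obtain x y where xy: "x \<in> E" "y \<in> E" "x' = i x" "y' = i y" "x \<noteq> y"
      by blast
    then obtain k where "k < n" "\<epsilon> < dist ((g ^^ k) x) ((g ^^ k) y)"
      using EY(2) unfolding separated_def by blast
    then show "\<exists>k<n. \<epsilon> < dist ((f ^^ k) x') ((f ^^ k) y')"
      using xy EY(1) pow i(2) by (intro exI[of _ k]) (auto simp: subset_iff)
  qed
  from assms(1)[unfolded h_top_pos_iff] obtain \<epsilon> c where \<epsilon>: "\<epsilon> > 0" and c: "c > 0"
    and E: "\<And>N. \<exists>n\<ge>N. \<exists>E. finite E \<and> E \<subseteq> Y \<and> separated g n \<epsilon> E \<and> exp (c * real n) \<le> real (card E)"
    by blast
  have "\<exists>n\<ge>N. \<exists>E. finite E \<and> E \<subseteq> X \<and> separated f n \<epsilon> E \<and> exp (c * real n) \<le> real (card E)" for N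
  proof -
    obtain n E where n: "n \<ge> N" and E': "finite E" "E \<subseteq> Y" "separated g n \<epsilon> E" "exp (c * real n) \<le> real
        (card E)"
      using E by blast
    have "card (i ` E) = card E"
      using inj E'(2) by (meson card_image inj_on_subset)
    then show ?thesis
      using n E' sep[OF E'(2,3)] i(1) by (intro exI[of _ n] conjI exI[of _ "i ` E"]) auto
  qed
  then show ?thesis
    unfolding h_top_pos_iff using \<epsilon> c by blast
qed

text \<open>Here \<open>y\<close> is exp(c n / 2) and \<open>C\<close> bounds the number of
  discarded points: discarding \<open>C\<close> out of exp(c n) points leaves at least exp(c n /
  2).\<close>

lemma exp_square_absorb:
  fixes C y :: real
  assumes "C \<ge> 0" "y \<ge> C + 1"
  shows "y \<le> y * y - C"
proof -
  have "(C + 1) * y \<le> y * y"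
    using assms by (intro mult_right_mono) auto
  moreover have "C * 1 \<le> C * y"
    using assms by (intro mult_left_mono) auto
  ultimately show ?thesis
    by (simp add: algebra_simps)
qed

text \<open>Points outside \<open>P\<close> merge after one step, so an \<open>\<epsilon>\<close>-separated set contains only boundedly many
  of them.\<close>

lemma h_top_pos_remove_constant:
  assumes "0 < h_top X f" "compact K" "X \<subseteq> K" "\<And>x. x \<in> X - P \<Longrightarrow> f x = u"
  shows "0 < h_top (X \<inter> P) f"
proof -
  from assms(1)[unfolded h_top_pos_iff] obtain \<epsilon> c where \<epsilon>: "\<epsilon> > 0" and c: "c > 0"
    and E: "\<And>N. \<exists>n\<ge>N. \<exists>E. finite E \<and> E \<subseteq> X \<and> separated f n \<epsilon> E \<and> exp (c * real n) \<le> real (card E)"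
    by blast
  obtain D where D: "finite D" "K \<subseteq> (\<Union>x\<in>D. ball x (\<epsilon> / 2))"
  proof (rule compactE_image[OF assms(2), of K "\<lambda>x. ball x (\<epsilon> / 2)"])
    show "K \<subseteq> (\<Union>x\<in>K. ball x (\<epsilon> / 2))"
      using \<epsilon> by force
  qed auto
  have few: "card (E - P) \<le> card D" if E: "E \<subseteq> X" "separated f n \<epsilon> E" for E n
  proof -
    have "\<exists>d\<in>D. dist d x < \<epsilon> / 2" if "x \<in> E - P" for x
      using D(2) assms(3) E(1) that by fastforce
    then obtain d where d: "\<And>x. x \<in> E - P \<Longrightarrow> d x \<in> D" "\<And>x. x \<in> E - P \<Longrightarrow> dist (d x) x < \<epsilon> / 2"
      by metis
    \<comment> \<open>Two points near the same centre are not separated at time 0, and from time 1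
      on their orbits coincide.\<close>
    have "inj_on d (E - P)"
    proof (rule inj_onI, rule ccontr)
      fix x y assume xy: "x \<in> E - P" "y \<in> E - P" "d x = d y" "x \<noteq> y"
      then obtain k where k: "\<epsilon> < dist ((f ^^ k) x) ((f ^^ k) y)"
        using E(2) unfolding separated_def by blast
      show False
      proof (cases k)
        case 0
        then show False
          using k d(2)[OF xy(1)] d(2)[OF xy(2)] dist_triangle[of x y "d x"] xy(3) by (simp add: dist_commute)
      next
        case (Suc j)
        have "f x = f y"
          using assms(4) xy(1,2) E(1) by (metis Diff_iff subsetD)
        then have "(f ^^ k) x = (f ^^ k) y"
          unfolding Suc by (simp add: funpow_Suc_right del: funpow.simps)
        then show False
          using k \<epsilon> by simp
      qed
    qed
    then show ?thesis
      using d(1) D(1) by (intro card_inj_on_le) auto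
  qed
  define C where "C = real (card D)"
  have "\<exists>n\<ge>N. \<exists>E. finite E \<and> E \<subseteq> X \<inter> P \<and> separated f n \<epsilon> E \<and> exp (c / 2 * real n) \<le> real (card E)" for N
  proof -
    obtain n E where n: "n \<ge> max N (nat \<lceil>2 * (C + 1) / c\<rceil>)" and E': "finite E" "E \<subseteq> X" "separated f n \<epsilon> E"
      "exp (c * real n) \<le> real (card E)"
      using E by blast
    have "2 * (C + 1) / c \<le> real n"
      using n by linarith
    then have "C + 1 \<le> c / 2 * real n"
      using c by (simp add: pos_divide_le_eq mult.commute)
    also have "\<dots> \<le> exp (c / 2 * real n)"
      using exp_ge_add_one_self[of "c / 2 * real n"] by linarith
    finally have "exp (c / 2 * real n) \<le> exp (c / 2 * real n) * exp (c / 2 * real n) - C"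
      by (intro exp_square_absorb) (auto simp: C_def)
    also have "exp (c / 2 * real n) * exp (c / 2 * real n) = exp (c * real n)"
      by (simp add: exp_add[symmetric])
    also have "real (card E) = real (card (E \<inter> P)) + real (card (E - P))"
      using card_Int_Diff[OF E'(1), of P] by simp
    then have "exp (c * real n) - C \<le> real (card (E \<inter> P))"
      using E'(4) few[OF E'(2,3)] by (simp add: C_def)
    finally show ?thesis
      using n E' by (intro exI[of _ n] conjI exI[of _ "E \<inter> P"]) (auto simp: separated_def)
  qed
  then show ?thesis
    unfolding h_top_pos_iff using \<epsilon> c by (metis half_gt_zero)
qed

text \<open>A maximal separated subset also spans. A set that is separated for one map is thereby
  covered by Bowen balls of another map, as many as the other map separates.\<close>

lemma maximal_separated_subset:
  assumes "finite E"
  obtains E' where "E' \<subseteq> E" "separated f n \<epsilon> E'"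
    "\<And>x. x \<in> E \<Longrightarrow> x \<notin> E' \<Longrightarrow> \<exists>z\<in>E'. \<forall>k<n. dist ((f ^^ k) x) ((f ^^ k) z) \<le> \<epsilon>"
proof -
  define \<S> where "\<S> = {E'. E' \<subseteq> E \<and> separated f n \<epsilon> E'}"
  have "finite \<S>" "{} \<in> \<S>"
    using assms by (auto simp: \<S>_def separated_def)
  then obtain E' where E': "E' \<in> \<S>" "\<And>F. F \<in> \<S> \<Longrightarrow> E' \<subseteq> F \<Longrightarrow> E' = F"
    using finite_has_maximal[of \<S>] by blast
  show thesis
  proof (rule that[of E'])
    fix x assume x: "x \<in> E" "x \<notin> E'"
    show "\<exists>z\<in>E'. \<forall>k<n. dist ((f ^^ k) x) ((f ^^ k) z) \<le> \<epsilon>"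
    proof (rule ccontr)
      assume "\<not> ?thesis"
      then have far: "\<And>z. z \<in> E' \<Longrightarrow> \<exists>k<n. \<epsilon> < dist ((f ^^ k) x) ((f ^^ k) z)"
        by (meson not_le)
      have "separated f n \<epsilon> (insert x E')"
        using far E'(1) unfolding separated_def \<S>_def
        by (auto simp: dist_commute)
      then have "insert x E' \<in> \<S>"
        using E'(1) x by (auto simp: \<S>_def)
      then show False
        using E'(2) x by blast
    qed
  qed (use E' in \<open>auto simp: \<S>_def\<close>)
qed

lemma derivative_bound_imp_lipschitz:
  fixes D :: "real \<Rightarrow> real"
  assumes "\<And>t. t \<in> {a..b} \<Longrightarrow> (D has_real_derivative d t) (at t)" "\<And>t. t \<in> {a..b} \<Longrightarrow> \<bar>d t\<bar> \<le> B"
    and "s \<in> {a..b}" "t \<in> {a..b}"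
  shows "\<bar>D s - D t\<bar> \<le> B * \<bar>s - t\<bar>"
  using field_differentiable_bound[of "{a..b}" D d B s t] assms
  by (auto intro: has_field_derivative_at_within)

lemma floor_diff_le:
  fixes x y :: real
  assumes "\<bar>x - y\<bar> \<le> 1"
  shows "\<lfloor>x\<rfloor> - \<lfloor>y\<rfloor> \<in> {-1..1}"
proof -
  have "\<lfloor>x\<rfloor> \<le> \<lfloor>y + 1\<rfloor>" "\<lfloor>y\<rfloor> \<le> \<lfloor>x + 1\<rfloor>"
    using assms by (intro floor_mono; linarith)+
  then show ?thesis
    by auto
qed

text \<open>Orbits of the time-changed flow that shadow \<open>z\<close> determine, up to a slowly drifting time shift,
  orbits of the original flow. Sampling the shift at multiples of \<open>L\<close> on a grid of mesh \<open>\<kappa>\<close> encodes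
  them by words over three letters.\<close>

lemma time_change_fibre:
  fixes \<phi> :: "real \<Rightarrow> 'a::metric_space \<Rightarrow> 'a" and s :: "'a \<Rightarrow> real \<Rightarrow> real"
  assumes P: "F \<subseteq> P" "z \<in> P" and L: "L > 0" and \<kappa>: "\<kappa> > 0"
    and ds: "\<And>p t. p \<in> P \<Longrightarrow> t \<ge> 0 \<Longrightarrow> (s p has_real_derivative v p t) (at t)"
    and s0: "\<And>p. p \<in> P \<Longrightarrow> s p 0 = 0"
    and v: "\<And>p t. p \<in> P \<Longrightarrow> t \<ge> 0 \<Longrightarrow> 0 < v p t"
    and sN: "\<And>p. p \<in> P \<Longrightarrow> real n \<le> s p (real N)"
    and close: "\<And>x t. x \<in> F \<Longrightarrow> t \<in> {0..real N} \<Longrightarrow> dist (\<phi> (s x t) x) (\<phi> (s z t) z) < \<epsilon> / 3"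
    and close_v: "\<And>x t. x \<in> F \<Longrightarrow> t \<in> {0..real N} \<Longrightarrow> \<bar>v x t - v z t\<bar> \<le> \<kappa> / real L"
    and slow: "\<And>p u w. p \<in> P \<Longrightarrow> 0 \<le> u \<Longrightarrow> 0 \<le> w \<Longrightarrow> \<bar>u - w\<bar> < 4 * \<kappa> \<Longrightarrow> dist (\<phi> u p) (\<phi> w p) < \<epsilon> / 3"
    and sep: "\<And>x y. x \<in> F \<Longrightarrow> y \<in> F \<Longrightarrow> x \<noteq> y \<Longrightarrow> \<exists>k<n. \<epsilon> < dist (\<phi> (real k) x) (\<phi> (real k) y)"
  shows "card F \<le> 3 ^ (N div L)"
proof -
  define J where "J = N div L"
  \<comment> \<open>The time shift of the orbit of \<open>x\<close> relative to the reference orbit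
    of \<open>z\<close>. By \<open>close_v\<close> it drifts by at most \<open>\<kappa>\<close>
    during time \<open>L\<close>.\<close>
  define D where "D x t = s x t - s z t" for x t
  define a where "a x i = \<lfloor>D x (real (i * L)) / \<kappa>\<rfloor>" for x and i :: nat
  have lip: "\<bar>D x u - D x t\<bar> \<le> \<kappa> / real L * \<bar>u - t\<bar>" if "x \<in> F" "u \<in> {0..real N}" "t \<in> {0..real N}" for x u t
  proof (rule derivative_bound_imp_lipschitz[OF _ _ that(2,3)])
    fix r assume r: "r \<in> {0..real N}"
    show "(D x has_real_derivative v x r - v z r) (at r)"
      unfolding D_def using r P that(1) by (intro DERIV_diff ds) auto
    show "\<bar>v x r - v z r\<bar> \<le> \<kappa> / real L"
      using close_v that(1) r by blast
  qed
  have short: "\<bar>D x u - D x t\<bar> \<le> \<kappa>" if "x \<in> F" "u \<in> {0..real N}" "t \<in> {0..real N}" "\<bar>u - t\<bar> \<le> real L" for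
      x u t
  proof -
    have "\<kappa> / real L * \<bar>u - t\<bar> \<le> \<kappa> / real L * real L"
      using that(4) \<kappa> L by (intro mult_left_mono) auto
    then show ?thesis
      using lip[OF that(1-3)] L by simp
  qed
  have grid: "real (i * L) \<in> {0..real N}" if "i \<le> J" for i
  proof -
    have "i * L \<le> N"
      using that unfolding J_def by (meson div_times_less_eq_dividend le_trans mult_le_mono1)
    then show ?thesis
      by (simp del: of_nat_mult)
  qed
  \<comment> \<open>The increments of the grid index lie in {-1, 0, 1}, because the shift moves by
    at most one mesh width between two samples.\<close>
  define code where "code x = restrict (\<lambda>i. a x (Suc i) - a x i) {..<J}" for x
  have "code x \<in> {..<J} \<rightarrow>\<^sub>E {-1..1}" if "x \<in> F" for x
  proof -
    have "a x (Suc i) - a x i \<in> {-1..1}" if i: "i < J" for i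
    proof -
      have "\<bar>D x (real (Suc i * L)) - D x (real (i * L))\<bar> \<le> \<kappa>"
        using i by (intro short \<open>x \<in> F\<close> grid) (auto simp: algebra_simps)
      then have "\<bar>D x (real (Suc i * L)) / \<kappa> - D x (real (i * L)) / \<kappa>\<bar> \<le> 1"
        using \<kappa> by (simp add: diff_divide_distrib[symmetric] abs_divide del: of_nat_mult)
      then show ?thesis
        unfolding a_def by (rule floor_diff_le)
    qed
    then show ?thesis
      by (auto simp: code_def simp del: atLeastAtMost_iff)
  qed
  then have sub: "code ` F \<subseteq> {..<J} \<rightarrow>\<^sub>E {-1..1}"
    by blast
  have "inj_on code F"
  proof (rule inj_onI, rule ccontr)
    fix x y assume xy: "x \<in> F" "y \<in> F" "code x = code y" "x \<noteq> y"
    \<comment> \<open>All shifts start at 0, so equal increments give equal grid indices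
      throughout.\<close>
    have aeq: "i \<le> J \<Longrightarrow> a x i = a y i" for i
    proof (induction i)
      case 0
      then show ?case
        using xy P s0 by (auto simp: a_def D_def subset_iff)
    next
      case (Suc i)
      moreover have "code x i = code y i"
        using xy by simp
      ultimately show ?case
        by (simp add: code_def)
    qed
    \<comment> \<open>Being in the same cell at the last sample before \<open>t\<close> costs less
      than \<open>\<kappa>\<close>, and each of the two shifts has drifted by at most
      \<open>\<kappa>\<close> since then.\<close>
    have near: "\<bar>D x t - D y t\<bar> < 4 * \<kappa>" if t: "t \<in> {0..real N}" for t
    proof -
      define i where "i = nat \<lfloor>t / real L\<rfloor>"
      have ir: "real i = of_int \<lfloor>t / real L\<rfloor>"
        using t L by (simp add: i_def)
      have i1: "real i * real L \<le> t" "t < real i * real L + real L"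
      proof -
        have "real i \<le> t / real L" "t / real L < real i + 1"
          unfolding ir by (auto simp: floor_correct)
        then show "real i * real L \<le> t" "t < real i * real L + real L"
          using L by (auto simp: pos_le_divide_eq pos_divide_less_eq algebra_simps)
      qed
      then have "real (i * L) \<le> real N"
        using t by auto
      then have "i * L \<le> N"
        by (simp del: of_nat_mult)
      then have iJ: "i \<le> J"
        using L by (simp add: J_def less_eq_div_iff_mult_less_eq)
      have tl: "\<bar>t - real (i * L)\<bar> \<le> real L"
        using i1 by simp
      have "\<bar>D x (real (i * L)) / \<kappa> - D y (real (i * L)) / \<kappa>\<bar> < 1"
        using aeq[OF iJ] unfolding a_def by linarith
      then have "\<bar>D x (real (i * L)) - D y (real (i * L))\<bar> < \<kappa>"
        using \<kappa> by (simp add: diff_divide_distrib[symmetric] abs_divide del: of_nat_mult)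
      then show ?thesis
        using short[OF xy(1) t grid[OF iJ] tl] short[OF xy(2) t grid[OF iJ] tl] \<kappa> by linarith
    qed
    obtain k where k: "k < n" "\<epsilon> < dist (\<phi> (real k) x) (\<phi> (real k) y)"
      using sep xy by blast
    have xP: "x \<in> P" and yP: "y \<in> P"
      using xy P by auto
    \<comment> \<open>The new time at which \<open>x\<close> has run through \<open>k\<close> units
      of original time; it comes before \<open>N\<close> because \<open>s x (real N)\<close> is at
      least \<open>n\<close>, which exceeds \<open>k\<close>.\<close>
    have "\<exists>t\<ge>0. t \<le> real N \<and> s x t = real k"
    proof (rule IVT)
      show "s x 0 \<le> real k" "real k \<le> s x (real N)"
        using s0[OF xP] sN[OF xP] k by auto
      show "\<forall>t. 0 \<le> t \<and> t \<le> real N \<longrightarrow> isCont (s x) t"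
        using ds[OF xP] DERIV_isCont by blast
    qed simp
    then obtain t where t: "t \<in> {0..real N}" "s x t = real k"
      by auto
    have "s y 0 \<le> s y t"
    proof (rule DERIV_nonneg_imp_nondecreasing[of 0 t "s y"])
      fix r :: real assume "0 \<le> r"
      then show "\<exists>d. (s y has_real_derivative d) (at r) \<and> 0 \<le> d"
        using ds[OF yP] v[OF yP] less_imp_le by blast
    qed (use t in auto)
    then have sy: "0 \<le> s y t"
      using s0[OF yP] by simp
    have "\<bar>s y t - real k\<bar> < 4 * \<kappa>"
      using near[OF t(1)] t(2) by (simp add: D_def abs_minus_commute)
    \<comment> \<open>Three steps of size \<open>\<epsilon> / 3\<close> lead from \<open>x\<close>
      at original time \<open>k\<close> over \<open>z\<close> to \<open>y\<close> at its own shifted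
      time, and from there to \<open>y\<close> at time \<open>k\<close>, contradicting
      separation.\<close>
    then have "dist (\<phi> (s y t) y) (\<phi> (real k) y) < \<epsilon> / 3"
      using sy by (intro slow yP) auto
    moreover have "dist (\<phi> (real k) x) (\<phi> (s z t) z) < \<epsilon> / 3"
      using close[OF xy(1) t(1)] t(2) by simp
    moreover have "dist (\<phi> (s z t) z) (\<phi> (s y t) y) < \<epsilon> / 3"
      using close[OF xy(2) t(1)] by (simp add: dist_commute)
    ultimately have "dist (\<phi> (real k) x) (\<phi> (real k) y) < \<epsilon>"
      using dist_triangle[of "\<phi> (real k) x" "\<phi> (real k) y" "\<phi> (s z t) z"]
        dist_triangle[of "\<phi> (s z t) z" "\<phi> (real k) y" "\<phi> (s y t) y"] by linarith
    then show False using k by simp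
  qed
  then have "card F \<le> card ({..<J} \<rightarrow>\<^sub>E {-1..1::int})"
    using sub by (intro card_inj_on_le finite_PiE) auto
  also have "\<dots> = 3 ^ J"
    by (simp add: card_funcsetE)
  finally show ?thesis
    by (simp add: J_def)
qed

text \<open>An \<open>F\<close>-separated set \<open>E\<close> is covered by the
  \<open>G\<close>-orbit balls around a maximal \<open>G\<close>-separated subset \<open>E1\<close>.
  By \<open>time_change_fibre\<close> each ball contains at most \<open>3 ^ (N div L)\<close> points
  of \<open>E\<close>, which is at most exp(c n / 2). Hence \<open>E1\<close> keeps at least exp(c n
  / 2) points, while \<open>N\<close> grows at most linearly in \<open>n\<close>.\<close>

lemma h_top_pos_time_change:
  fixes \<phi> :: "real \<Rightarrow> 'a::metric_space \<Rightarrow> 'a" and s :: "'a \<Rightarrow> real \<Rightarrow> real" and f :: "'a \<Rightarrow> real"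
  assumes m: "0 < m" "\<And>p. p \<in> P \<Longrightarrow> m \<le> f p"
    and f: "uniformly_continuous_on P f"
    and \<phi>P: "\<And>p t. p \<in> P \<Longrightarrow> t \<ge> 0 \<Longrightarrow> \<phi> t p \<in> P"
    and ds: "\<And>p t. p \<in> P \<Longrightarrow> t \<ge> 0 \<Longrightarrow> (s p has_real_derivative f (\<phi> (s p t) p)) (at t)"
    and s0: "\<And>p. p \<in> P \<Longrightarrow> s p 0 = 0"
    and s_nonneg: "\<And>p t. p \<in> P \<Longrightarrow> t \<ge> 0 \<Longrightarrow> 0 \<le> s p t"
    and slow: "\<And>\<epsilon>. \<epsilon> > 0 \<Longrightarrow> \<exists>\<delta>>0. \<forall>p\<in>P. \<forall>u\<ge>0. \<forall>w\<ge>0. \<bar>u - w\<bar> < \<delta> \<longrightarrow> dist (\<phi> u p) (\<phi> w p) < \<epsilon>"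
    and equicont: "\<And>\<epsilon>. \<epsilon> > 0 \<Longrightarrow> \<exists>\<delta>>0. \<forall>p\<in>P. \<forall>q\<in>P. \<forall>k::nat.
       dist (\<phi> (s p (real k)) p) (\<phi> (s q (real k)) q) < \<delta> \<longrightarrow>
       (\<forall>t\<in>{real k..real k + 1}. dist (\<phi> (s p t) p) (\<phi> (s q t) q) < \<epsilon>)"
    and F: "\<And>p k. p \<in> P \<Longrightarrow> (F ^^ k) p = \<phi> (real k) p"
    and G: "\<And>p k. p \<in> P \<Longrightarrow> (G ^^ k) p = \<phi> (s p (real k)) p"
    and pos: "0 < h_top P F"
  shows "0 < h_top P G"
proof -
  from pos[unfolded h_top_pos_iff] obtain \<epsilon> c where \<epsilon>: "\<epsilon> > 0" and c: "c > 0"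
    and E: "\<And>N. \<exists>n\<ge>N. \<exists>E. finite E \<and> E \<subseteq> P \<and> separated F n \<epsilon> E \<and> exp (c * real n) \<le> real (card E)"
    by blast
  obtain \<delta>0 where \<delta>0: "\<delta>0 > 0" "\<And>p u w. p \<in> P \<Longrightarrow> 0 \<le> u \<Longrightarrow> 0 \<le> w \<Longrightarrow> \<bar>u - w\<bar> < \<delta>0 \<Longrightarrow> dist (\<phi> u p) (\<phi> w p) < \<epsilon> / 3"
    using slow[of "\<epsilon> / 3"] \<epsilon> by auto
  define \<kappa> where "\<kappa> = \<delta>0 / 4"
  have \<kappa>: "\<kappa> > 0" using \<delta>0 by (simp add: \<kappa>_def)
  \<comment> \<open>Large enough that ln 3 / (m L) is at most c / 4: words of length about n / (m L)
    over three letters then number at most exp(c n / 4), up to rounding.\<close>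
  define L where "L = Suc (nat \<lceil>4 * ln 3 / (m * c)\<rceil>)"
  have L: "L > 0" "4 * ln 3 / (m * c) \<le> real L"
    unfolding L_def by (simp, linarith)
  have "\<kappa> / real L > 0" using \<kappa> L by simp
  then obtain \<epsilon>f where \<epsilon>f: "\<epsilon>f > 0" "\<And>p q. p \<in> P \<Longrightarrow> q \<in> P \<Longrightarrow> dist p q < \<epsilon>f \<Longrightarrow> dist (f p) (f q) < \<kappa> / real L"
    using f unfolding uniformly_continuous_on_def by metis
  define \<epsilon>1 where "\<epsilon>1 = min (\<epsilon> / 3) \<epsilon>f"
  have "\<epsilon>1 > 0" using \<epsilon> \<epsilon>f by (simp add: \<epsilon>1_def)
  then obtain \<delta>1 where \<delta>1: "\<delta>1 > 0" "\<And>p q k t. p \<in> P \<Longrightarrow> q \<in> P \<Longrightarrow>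
       dist (\<phi> (s p (real k)) p) (\<phi> (s q (real k)) q) < \<delta>1 \<Longrightarrow>
       t \<in> {real k..real k + 1} \<Longrightarrow> dist (\<phi> (s p t) p) (\<phi> (s q t) q) < \<epsilon>1"
    using equicont by metis
  \<comment> \<open>Halved because membership in a fibre gives a weak inequality, while the
    equicontinuity asks for a strict one.\<close>
  define \<epsilon>' where "\<epsilon>' = \<delta>1 / 2"
  have \<epsilon>': "\<epsilon>' > 0" using \<delta>1 by (simp add: \<epsilon>'_def)
  \<comment> \<open>Since N is at most (1 / m + 2) n, this rate satisfies c' N \<le> (c / 2)
    n.\<close>
  define c' where "c' = c / (2 * (1 / m + 2))"
  have c': "c' > 0" using c m by (simp add: c'_def add_pos_pos)
  have "\<exists>N\<ge>N0. \<exists>E. finite E \<and> E \<subseteq> P \<and> separated G N \<epsilon>' E \<and> exp (c' * real N) \<le> real (card E)" for N0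
  proof -
    \<comment> \<open>The demands on \<open>n\<close>: it is positive, n / m reaches
      \<open>N0\<close>, and 2 ln 3 \<le> (c / 4) n, which absorbs the rounding in
      \<open>N\<close>.\<close>
    obtain n E where n: "n \<ge> Suc (max (nat \<lceil>m * real N0\<rceil>) (nat \<lceil>8 * ln 3 / c\<rceil>))"
      and E': "finite E" "E \<subseteq> P" "separated F n \<epsilon> E" "exp (c * real n) \<le> real (card E)"
      using E by blast
    have n1: "n \<ge> 1" "m * real N0 \<le> real n" "8 * ln 3 / c \<le> real n"
      using n by (simp, linarith, linarith)
    \<comment> \<open>At speed at least \<open>m\<close>, new time \<open>N\<close> covers at least
      \<open>n\<close> units of original time.\<close>
    define N where "N = Suc (nat \<lceil>real n / m\<rceil>)"
    have N: "real n / m \<le> real N" "real N \<le> real n / m + 2"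
    proof -
      have "0 \<le> real n / m" using m by simp
      then show "real n / m \<le> real N" "real N \<le> real n / m + 2"
        unfolding N_def by linarith+
    qed
    have NN0: "N \<ge> N0"
    proof -
      have "real N0 \<le> real n / m"
        using n1(2) m(1) by (simp add: pos_le_divide_eq mult.commute)
      then show ?thesis using N(1) by linarith
    qed
    obtain E1 where E1: "E1 \<subseteq> E" "separated G N \<epsilon>' E1"
      "\<And>x. x \<in> E \<Longrightarrow> x \<notin> E1 \<Longrightarrow> \<exists>z\<in>E1. \<forall>k<N. dist ((G ^^ k) x) ((G ^^ k) z) \<le> \<epsilon>'"
      using maximal_separated_subset[OF E'(1), where f = G and n = N and \<epsilon> = \<epsilon>'] by blast
    define fib where "fib z = {x \<in> E. \<forall>k<N. dist ((G ^^ k) x) ((G ^^ k) z) \<le> \<epsilon>'}" for z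
    have cover: "E \<subseteq> (\<Union>z\<in>E1. fib z)"
    proof
      fix x assume x: "x \<in> E"
      show "x \<in> (\<Union>z\<in>E1. fib z)"
      proof (cases "x \<in> E1")
        case True
        then show ?thesis using x \<epsilon>' by (auto simp: fib_def intro!: bexI[of _ x])
      next
        case False
        then show ?thesis using E1(3)[OF x] x by (auto simp: fib_def)
      qed
    qed
    have fibre: "card (fib z) \<le> 3 ^ (N div L)" if z: "z \<in> E1" for z
    proof (rule time_change_fibre[where P = P and z = z and s = s and \<phi> = \<phi> and \<kappa> = \<kappa> and \<epsilon> = \<epsilon> and n = n
          and v = "\<lambda>p t. f (\<phi> (s p t) p)"])
      show fP: "fib z \<subseteq> P" and zP: "z \<in> P"
        using E'(2) E1(1) z by (auto simp: fib_def)
      have sh: "dist (\<phi> (s x t) x) (\<phi> (s z t) z) < \<epsilon>1" if x: "x \<in> fib z" and t: "t \<in> {0..real N}" for x t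
      proof -
        \<comment> \<open>Closeness is known at integer times below \<open>N\<close> only, so the
          endpoint \<open>t = N\<close> is assigned to the last unit interval.\<close>
        define k where "k = (if t = real N then N - 1 else nat \<lfloor>t\<rfloor>)"
        have k: "k < N" "t \<in> {real k..real k + 1}"
        proof -
          have "N \<ge> 1" by (simp add: N_def)
          show "k < N"
          proof (cases "t = real N")
            case True
            then show ?thesis using \<open>N \<ge> 1\<close> by (simp add: k_def)
          next
            case False
            then have "t < real N" using t by simp
            then have "\<lfloor>t\<rfloor> < int N" by (simp add: floor_less_iff)
            then show ?thesis using False t by (simp add: k_def nat_less_iff)
          qed
          show "t \<in> {real k..real k + 1}"
          proof (cases "t = real N")
            case True
            then show ?thesis using \<open>N \<ge> 1\<close> by (simp add: k_def of_nat_diff)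
          next
            case False
            then show ?thesis using t floor_correct[of t] by (simp add: k_def)
          qed
        qed
        have xP: "x \<in> P" using fP x by blast
        have "dist ((G ^^ k) x) ((G ^^ k) z) \<le> \<epsilon>'"
          using x k(1) by (simp add: fib_def)
        also have "\<epsilon>' < \<delta>1" using \<delta>1(1) by (simp add: \<epsilon>'_def)
        finally show ?thesis
          using G[OF xP] G[OF zP] by (intro \<delta>1(2)[OF xP zP _ k(2)]) simp
      qed
      show "dist (\<phi> (s x t) x) (\<phi> (s z t) z) < \<epsilon> / 3" if "x \<in> fib z" "t \<in> {0..real N}" for x t
        using sh[OF that] by (simp add: \<epsilon>1_def)
      show "\<bar>f (\<phi> (s x t) x) - f (\<phi> (s z t) z)\<bar> \<le> \<kappa> / real L" if x: "x \<in> fib z" and t: "t \<in> {0..real N}"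
          for x t
      proof -
        have "\<phi> (s x t) x \<in> P" "\<phi> (s z t) z \<in> P"
          using x t fP zP by (auto intro!: \<phi>P s_nonneg)
        then have "dist (f (\<phi> (s x t) x)) (f (\<phi> (s z t) z)) < \<kappa> / real L"
          using sh[OF x t] by (intro \<epsilon>f(2)) (auto simp: \<epsilon>1_def)
        then show ?thesis by (simp add: dist_real_def)
      qed
      show "real n \<le> s p (real N)" if p: "p \<in> P" for p
      proof -
        have "s p 0 - m * 0 \<le> s p (real N) - m * real N"
        proof (rule DERIV_nonneg_imp_nondecreasing[of 0 "real N" "\<lambda>t. s p t - m * t"])
          fix t :: real assume t: "0 \<le> t"
          have "((\<lambda>t. s p t - m * t) has_real_derivative f (\<phi> (s p t) p) - m) (at t)"
            using ds[OF p t] by (auto intro!: derivative_eq_intros)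
          moreover have "m \<le> f (\<phi> (s p t) p)"
            using p t by (intro m(2) \<phi>P s_nonneg)
          ultimately show "\<exists>y. ((\<lambda>t. s p t - m * t) has_real_derivative y) (at t) \<and> 0 \<le> y"
            by (intro exI conjI) auto
        qed simp
        moreover have "real n \<le> m * real N"
          using N(1) m(1) by (simp add: pos_divide_le_eq mult.commute)
        ultimately show ?thesis using s0[OF p] by simp
      qed
      show "\<exists>k<n. \<epsilon> < dist (\<phi> (real k) x) (\<phi> (real k) y)" if ne: "x \<in> fib z" "y \<in> fib z" "x \<noteq> y" for x y
      proof -
        have xy: "x \<in> E" "y \<in> E" using ne by (auto simp: fib_def)
        then obtain k where "k < n" "\<epsilon> < dist ((F ^^ k) x) ((F ^^ k) y)"
          using E'(3) ne(3) unfolding separated_def by blast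
        then show ?thesis
          using F xy E'(2) by (intro exI[of _ k]) (auto simp: subset_iff)
      qed
      show "0 < f (\<phi> (s p t) p)" if "p \<in> P" "t \<ge> 0" for p t
        using m(1) m(2)[OF \<phi>P[OF that(1) s_nonneg[OF that]]] by linarith
      show "dist (\<phi> u p) (\<phi> w p) < \<epsilon> / 3" if "p \<in> P" "0 \<le> u" "0 \<le> w" "\<bar>u - w\<bar> < 4 * \<kappa>" for p u w
        using that by (intro \<delta>0(2)) (auto simp: \<kappa>_def)
    qed (use L \<kappa> ds s0 in auto)
    have finE1: "finite E1" using E1(1) E'(1) finite_subset by blast
    have "card E \<le> card (\<Union>z\<in>E1. fib z)"
      using cover finE1 E'(1) by (intro card_mono) (auto simp: fib_def)
    also have "\<dots> \<le> (\<Sum>z\<in>E1. card (fib z))"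
      using finE1 by (rule card_UN_le)
    also have "\<dots> \<le> (\<Sum>z\<in>E1. 3 ^ (N div L))"
      using fibre by (rule sum_mono)
    finally have "card E \<le> card E1 * 3 ^ (N div L)"
      by simp
    then have "real (card E) \<le> real (card E1) * 3 ^ (N div L)"
      by (metis of_nat_le_iff of_nat_mult of_nat_numeral of_nat_power)
    moreover have "(3::real) ^ (N div L) \<le> exp (c / 2 * real n)"
    proof -
      have "(3::real) ^ (N div L) = exp (real (N div L) * ln 3)"
        by (simp add: exp_of_nat_mult)
      also have "\<dots> \<le> exp (c / 2 * real n)"
      proof -
        have l3: "ln (3::real) > 0" by simp
        have "real (N div L) \<le> real N / real L"
          by (rule of_nat_div_le_of_nat)
        also have "\<dots> \<le> (real n / m + 2) / real L"
          using N(2) by (intro divide_right_mono) auto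
        finally have "real (N div L) * ln 3 \<le> (real n / m + 2) / real L * ln 3"
          using l3 by (intro mult_right_mono) auto
        also have "\<dots> = real n * (ln 3 / (m * real L)) + 2 * ln 3 / real L"
          using m(1) L(1) by (simp add: field_simps)
        also have "\<dots> \<le> real n * (c / 4) + 2 * ln 3 / 1"
        proof (intro add_mono mult_left_mono divide_left_mono)
          show "ln 3 / (m * real L) \<le> c / 4"
            using L m(1) c by (simp add: field_simps)
        qed (use L l3 in auto)
        also have "2 * ln 3 / 1 \<le> real n * (c / 4)"
          using n1(3) c by (simp add: field_simps)
        finally show ?thesis by (simp add: mult.commute)
      qed
      finally show ?thesis .
    qed
    ultimately have "exp (c * real n) \<le> real (card E1) * exp (c / 2 * real n)"
      using E'(4) by (meson mult_left_mono of_nat_0_le_iff order_trans)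
    moreover have "exp (c * real n) = exp (c / 2 * real n) * exp (c / 2 * real n)"
      by (simp add: exp_add[symmetric])
    ultimately have "exp (c / 2 * real n) \<le> real (card E1)"
      by simp
    moreover have "c' * real N \<le> c / 2 * real n"
    proof -
      have "real N \<le> (1 / m + 2) * real n"
        using N(2) n1(1) by (simp add: algebra_simps)
      then have "c' * real N \<le> c' * ((1 / m + 2) * real n)"
        using c' by (intro mult_left_mono) auto
      also have "\<dots> = c / 2 * real n"
      proof -
        have "1 / m + 2 \<noteq> 0" using m(1) by (smt (verit) divide_pos_pos)
        moreover have "c / (2 * d) * (d * real n) = c / 2 * real n" if "d \<noteq> 0" for d
          using that by (simp add: field_simps)
        ultimately show ?thesis by (simp only: c'_def)
      qed
      finally show ?thesis .
    qed
    ultimately have "exp (c' * real N) \<le> real (card E1)"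
      by (meson exp_le_cancel_iff order_trans)
    then show ?thesis
      using NN0 E1 E' finE1 by (intro exI[of _ N] conjI exI[of _ E1]) auto
  qed
  then show ?thesis
    unfolding h_top_pos_iff using \<epsilon>' c' by blast
qed

section \<open>Local Lipschitz continuity\<close>

text \<open>Lipschitz continuity near one point, a notion stable under sums, products and
  reciprocals; the Reeb field is assembled by these operations.\<close>

definition lip_near :: "'a::real_normed_vector set \<Rightarrow> 'a \<Rightarrow> ('a \<Rightarrow> 'b::real_normed_vector) \<Rightarrow> bool" where
  "lip_near S x f \<longleftrightarrow> (\<exists>e>0. \<exists>L\<ge>0. \<forall>y\<in>S \<inter> ball x e. \<forall>z\<in>S \<inter> ball x e. norm (f y - f z) \<le> L * norm (y - z))"

lemma smooth_in_lip_near: "smooth_in S f \<Longrightarrow> x \<in> S \<Longrightarrow> lip_near S x f"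
  unfolding lip_near_def by (rule smooth_in_lipschitz)

lemma lip_nearI:
  assumes "e > 0" "\<And>y z. y \<in> S \<inter> ball x e \<Longrightarrow> z \<in> S \<inter> ball x e \<Longrightarrow> norm (f y - f z) \<le> L * norm (y - z)"
  shows "lip_near S x f"
proof -
  have "norm (f y - f z) \<le> \<bar>L\<bar> * norm (y - z)" if "y \<in> S \<inter> ball x e" "z \<in> S \<inter> ball x e" for y z
    by (rule order_trans[OF assms(2)[OF that] mult_right_mono[OF abs_ge_self norm_ge_zero]])
  then show ?thesis
    unfolding lip_near_def using assms(1) by (intro exI[of _ e] conjI exI[of _ "\<bar>L\<bar>"]) auto
qed

lemma lip_near_subset: "lip_near S x f \<Longrightarrow> T \<subseteq> S \<Longrightarrow> lip_near T x f"
  unfolding lip_near_def by (meson IntD1 IntD2 IntI subsetD)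

lemma lip_near_cong:
  assumes "lip_near S x f" "e > 0" "\<And>y. y \<in> S \<Longrightarrow> y \<in> ball x e \<Longrightarrow> f y = g y"
  shows "lip_near S x g"
proof -
  obtain d L where d: "d > 0" "\<And>y z. y \<in> S \<inter> ball x d \<Longrightarrow> z \<in> S \<inter> ball x d \<Longrightarrow> norm (f y - f z) \<le> L * norm (y
      - z)"
    using assms(1) unfolding lip_near_def by blast
  show ?thesis
  proof (rule lip_nearI[of "min d e" S x g L])
    show "norm (g y - g z) \<le> L * norm (y - z)" if "y \<in> S \<inter> ball x (min d e)" "z \<in> S \<inter> ball x (min d e)"
        for y z
      using d(2)[of y z] that assms(3)[of y] assms(3)[of z] by simp
  qed (use d assms in auto)
qed

lemma lip_near_continuous:
  assumes "lip_near S x f" "x \<in> S"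
  shows "continuous (at x within S) f"
proof -
  obtain e L where e: "e > 0" "L \<ge> 0" "\<And>y z. y \<in> S \<inter> ball x e \<Longrightarrow> z \<in> S \<inter> ball x e \<Longrightarrow> norm (f y - f z) \<le> L *
      norm (y - z)"
    using assms(1) unfolding lip_near_def by blast
  show ?thesis
    unfolding continuous_within_eps_delta
  proof (intro allI impI)
    fix \<epsilon> :: real assume \<epsilon>: "\<epsilon> > 0"
    have "dist (f y) (f x) < \<epsilon>" if y: "y \<in> S" "dist y x < min e (\<epsilon> / (L + 1))" for y
    proof -
      have "norm (f y - f x) \<le> L * norm (y - x)"
        using y assms(2) e(1) by (intro e(3)) (auto simp: dist_commute)
      also have "\<dots> \<le> L * (\<epsilon> / (L + 1))"
        using y e(2) by (intro mult_left_mono) (auto simp: dist_norm)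
      also have "\<dots> < (L + 1) * (\<epsilon> / (L + 1))"
        using \<epsilon> e(2) by (intro mult_strict_right_mono) auto
      also have "\<dots> = \<epsilon>" using e(2) by simp
      finally show ?thesis by (simp add: dist_norm)
    qed
    then show "\<exists>d>0. \<forall>y\<in>S. dist y x < d \<longrightarrow> dist (f y) (f x) < \<epsilon>"
      using e \<epsilon> by (intro exI[of _ "min e (\<epsilon> / (L + 1))"]) auto
  qed
qed

lemma lip_near_bounded:
  assumes "lip_near S x f" "x \<in> S"
  obtains e B where "e > 0" "B \<ge> 0" "\<And>y. y \<in> S \<inter> ball x e \<Longrightarrow> norm (f y) \<le> B"
proof -
  obtain e where e: "e > 0" "\<And>y. y \<in> S \<Longrightarrow> dist y x < e \<Longrightarrow> dist (f y) (f x) < 1"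
    using lip_near_continuous[OF assms] unfolding continuous_within_eps_delta by (metis zero_less_one)
  show thesis
  proof (rule that[of e "norm (f x) + 1"])
    fix y assume "y \<in> S \<inter> ball x e"
    then have "norm (f y - f x) < 1" using e(2)[of y] by (simp add: dist_norm norm_minus_commute)
    then show "norm (f y) \<le> norm (f x) + 1"
      using norm_triangle_sub[of "f y" "f x"] by linarith
  qed (use e in auto)
qed

lemma lip_near_const: "lip_near S x (\<lambda>_. c)"
  by (rule lip_nearI[of 1 _ _ _ 0]) auto

lemma lip_near_add:
  assumes "lip_near S x f" "lip_near S x g"
  shows "lip_near S x (\<lambda>y. f y + g y)"
proof -
  obtain d L where d: "d > 0" "\<And>y z. y \<in> S \<inter> ball x d \<Longrightarrow> z \<in> S \<inter> ball x d \<Longrightarrow> norm (f y - f z) \<le> L * norm (y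
      - z)"
    using assms(1) unfolding lip_near_def by blast
  obtain e K where e: "e > 0" "\<And>y z. y \<in> S \<inter> ball x e \<Longrightarrow> z \<in> S \<inter> ball x e \<Longrightarrow> norm (g y - g z) \<le> K * norm (y
      - z)"
    using assms(2) unfolding lip_near_def by blast
  show ?thesis
  proof (rule lip_nearI[of "min d e"])
    fix y z assume yz: "y \<in> S \<inter> ball x (min d e)" "z \<in> S \<inter> ball x (min d e)"
    have "norm (f y + g y - (f z + g z)) \<le> norm (f y - f z) + norm (g y - g z)"
      using norm_triangle_ineq[of "f y - f z" "g y - g z"] by (simp add: algebra_simps)
    also have "\<dots> \<le> L * norm (y - z) + K * norm (y - z)"
      using yz by (intro add_mono d e) auto
    finally show "norm (f y + g y - (f z + g z)) \<le> (L + K) * norm (y - z)"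
      by (simp add: algebra_simps)
  qed (use d e in auto)
qed

lemma lip_near_sum:
  "(\<And>i. i \<in> I \<Longrightarrow> lip_near S x (f i)) \<Longrightarrow> lip_near S x (\<lambda>y. \<Sum>i\<in>I. f i y)"
  by (induction I rule: infinite_finite_induct) (auto intro: lip_near_add lip_near_const)

lemma lip_near_scaleR:
  assumes "lip_near S x f" "lip_near S x g" "x \<in> S"
  shows "lip_near S x (\<lambda>y. f y *\<^sub>R g y)"
proof -
  obtain d L where d: "d > 0" "L \<ge> 0" "\<And>y z. y \<in> S \<inter> ball x d \<Longrightarrow> z \<in> S \<inter> ball x d \<Longrightarrow> norm (f y - f z) \<le> L *
      norm (y - z)"
    using assms(1) unfolding lip_near_def by blast
  obtain e K where e: "e > 0" "K \<ge> 0" "\<And>y z. y \<in> S \<inter> ball x e \<Longrightarrow> z \<in> S \<inter> ball x e \<Longrightarrow> norm (g y - g z) \<le> K *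
      norm (y - z)"
    using assms(2) unfolding lip_near_def by blast
  obtain d' L' where d': "d' > 0" "L' \<ge> 0" "\<And>y. y \<in> S \<inter> ball x d' \<Longrightarrow> norm (f y) \<le> L'"
    using lip_near_bounded[OF assms(1,3)] by metis
  obtain e' K' where e': "e' > 0" "K' \<ge> 0" "\<And>y. y \<in> S \<inter> ball x e' \<Longrightarrow> norm (g y) \<le> K'"
    using lip_near_bounded[OF assms(2,3)] by metis
  define r where "r = min (min d e) (min d' e')"
  show ?thesis
  proof (rule lip_nearI[of r])
    fix y z assume yz: "y \<in> S \<inter> ball x r" "z \<in> S \<inter> ball x r"
    have "f y *\<^sub>R g y - f z *\<^sub>R g z = f y *\<^sub>R (g y - g z) + (f y - f z) *\<^sub>R g z"
      by (simp add: algebra_simps)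
    then have "norm (f y *\<^sub>R g y - f z *\<^sub>R g z) \<le> norm (f y) * norm (g y - g z) + norm (f y - f z) * norm (g z)"
      using norm_triangle_ineq[of "f y *\<^sub>R (g y - g z)" "(f y - f z) *\<^sub>R g z"] by simp
    also have "\<dots> \<le> L' * (K * norm (y - z)) + L * norm (y - z) * K'"
      using yz d(2) d'(2) by (intro add_mono mult_mono d(3) e(3) d'(3) e'(3)) (auto simp: r_def)
    finally show "norm (f y *\<^sub>R g y - f z *\<^sub>R g z) \<le> (L' * K + L * K') * norm (y - z)"
      by (simp add: algebra_simps)
  qed (use d e d' e' in \<open>auto simp: r_def\<close>)
qed

lemma lip_near_inverse:
  fixes f :: "'a::real_normed_vector \<Rightarrow> real"
  assumes "lip_near S x f" "x \<in> S" "f x \<noteq> 0"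
  shows "lip_near S x (\<lambda>y. inverse (f y))"
proof -
  obtain d L where d: "d > 0" "L \<ge> 0" "\<And>y z. y \<in> S \<inter> ball x d \<Longrightarrow> z \<in> S \<inter> ball x d \<Longrightarrow> norm (f y - f z) \<le> L *
      norm (y - z)"
    using assms(1) unfolding lip_near_def by blast
  define m where "m = \<bar>f x\<bar> / 2"
  have m: "m > 0" using assms by (simp add: m_def)
  obtain e where e: "e > 0" "\<And>y. y \<in> S \<Longrightarrow> dist y x < e \<Longrightarrow> dist (f y) (f x) < m"
    using lip_near_continuous[OF assms(1,2)] m unfolding continuous_within_eps_delta by metis
  have low: "m \<le> \<bar>f y\<bar>" if "y \<in> S \<inter> ball x e" for y
  proof -
    have "\<bar>f y - f x\<bar> < \<bar>f x\<bar> / 2"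
      using e(2)[of y] that by (simp add: dist_real_def dist_commute[of x] m_def)
    then show ?thesis
      unfolding m_def by linarith
  qed
  show ?thesis
  proof (rule lip_nearI[of "min d e"])
    fix y z assume yz: "y \<in> S \<inter> ball x (min d e)" "z \<in> S \<inter> ball x (min d e)"
    have ly: "m \<le> \<bar>f y\<bar>" and lz: "m \<le> \<bar>f z\<bar>" using low yz by auto
    then have "f y \<noteq> 0" "f z \<noteq> 0" using m by auto
    then have "norm (inverse (f y) - inverse (f z)) = inverse \<bar>f y\<bar> * norm (f z - f y) * inverse \<bar>f z\<bar>"
      by (simp add: inverse_diff_inverse abs_mult)
    also have "\<dots> \<le> inverse m * (L * norm (y - z)) * inverse m"
    proof (intro mult_mono)
      show "norm (f z - f y) \<le> L * norm (y - z)"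
        using d(3)[of z y] yz by (simp add: norm_minus_commute)
      show "inverse \<bar>f y\<bar> \<le> inverse m" "inverse \<bar>f z\<bar> \<le> inverse m"
        using ly lz m by (auto intro: le_imp_inverse_le)
    qed (use m d(2) in auto)
    finally show "norm (inverse (f y) - inverse (f z)) \<le> (inverse m * L * inverse m) * norm (y - z)"
      by (simp add: mult_ac)
  qed (use d e in auto)
qed

section \<open>Boundary points\<close>

lemma inward_normal_hs_open: "inward_normal c x \<nu> \<Longrightarrow> hs_open (img c)"
  by (auto simp: inward_normal_def hs_open_def)

text \<open>A tangent direction, or any direction at an interior point, can be followed both ways.
  Two-sided segments are what first-order arguments at the boundary require.\<close>

lemma openin_half_space_tangent:
  assumes "openin (top_of_set (half_space \<nu>)) T" "x \<in> T" "v \<bullet> \<nu> = 0 \<or> 0 < x \<bullet> \<nu>"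
  shows "\<exists>e>0. \<forall>s. \<bar>s\<bar> < e \<longrightarrow> x + s *\<^sub>R v \<in> T"
proof -
  obtain e where e: "e > 0" "ball x e \<inter> half_space \<nu> \<subseteq> T" "T \<subseteq> half_space \<nu>"
    using assms(1,2) unfolding openin_contains_ball by blast
  have x: "0 \<le> x \<bullet> \<nu>" using e assms by (auto simp: half_space_def)
  \<comment> \<open>The second bound keeps \<open>x \<bullet> \<nu>\<close> positive along the
    segment; the value 1 is a dummy for tangent directions.\<close>
  define r where "r = min (e / (norm v + 1)) (if v \<bullet> \<nu> = 0 then 1 else (x \<bullet> \<nu>) / \<bar>v \<bullet> \<nu>\<bar>)"
  have n: "norm v + 1 > 0"
    by (simp add: add_nonneg_pos)
  have r: "r > 0"
    using e n assms(3) by (auto simp: r_def)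
  have "x + s *\<^sub>R v \<in> T" if s: "\<bar>s\<bar> < r" for s
  proof -
    have "\<bar>s\<bar> * norm v \<le> \<bar>s\<bar> * (norm v + 1)"
      by (simp add: mult_left_mono)
    also have "\<dots> < e"
      using s n by (simp add: r_def pos_less_divide_eq)
    finally have "x + s *\<^sub>R v \<in> ball x e"
      by (simp add: dist_norm)
    moreover have "0 \<le> (x + s *\<^sub>R v) \<bullet> \<nu>"
    proof (cases "v \<bullet> \<nu> = 0")
      case True
      then show ?thesis using x by (simp add: inner_add_left)
    next
      case False
      then have "\<bar>s * (v \<bullet> \<nu>)\<bar> < x \<bullet> \<nu>"
        using s by (simp add: r_def pos_less_divide_eq abs_mult)
      then show ?thesis by (simp add: inner_add_left)
    qed
    ultimately show ?thesis using e(2) by (auto simp: half_space_def)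
  qed
  then show ?thesis using r by blast
qed

lemma inward_normal_tangent:
  assumes "inward_normal c x \<nu>" "v \<bullet> \<nu> = 0"
  shows "\<exists>e>0. \<forall>s. \<bar>s\<bar> < e \<longrightarrow> x + s *\<^sub>R v \<in> img c"
  using assms openin_half_space_tangent unfolding inward_normal_def by blast

text \<open>Moving both ways along \<open>v\<close> stays in the image, hence in the half-space of
  \<open>\<nu>'\<close>; a linear function that is nonnegative on both sides of 0 vanishes.\<close>

lemma inward_normal_unique:
  assumes "inward_normal c x \<nu>" "inward_normal c x \<nu>'" "v \<bullet> \<nu> = 0"
  shows "v \<bullet> \<nu>' = 0"
proof -
  obtain e where e: "e > 0" "\<And>s. \<bar>s\<bar> < e \<Longrightarrow> x + s *\<^sub>R v \<in> img c"
    using inward_normal_tangent[OF assms(1,3)] by blast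
  have "img c \<subseteq> half_space \<nu>'" "x \<bullet> \<nu>' = 0"
    using assms(2) openin_imp_subset unfolding inward_normal_def by blast+
  then have "0 \<le> s * (v \<bullet> \<nu>')" if "\<bar>s\<bar> < e" for s
    using e(2)[OF that] by (auto simp: half_space_def inner_add_left)
  from this[of "e / 2"] this[of "- (e / 2)"] show ?thesis
    using e(1) by (simp add: zero_le_mult_iff mult_le_0_iff)
qed

text \<open>Along a direction that can be followed both ways, \<open>h \<bullet> \<nu>'\<close> has
  a minimum at \<open>x\<close>, so \<open>D\<close> maps that direction into the hyperplane of
  \<open>\<nu>'\<close>. If \<open>x\<close> were interior this would apply to all directions,
  against surjectivity of \<open>D\<close>. Coordinate changes thus respect boundary points for a
  first-order reason.\<close>

lemma boundary_tangent:
  fixes h :: "'e::euclidean_space \<Rightarrow> 'f::euclidean_space"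
  assumes T: "openin (top_of_set (half_space \<nu>)) T" "x \<in> T" and h: "(h has_derivative D) (at x within T)"
    and surj: "surj D" and \<nu>': "\<nu>' \<noteq> 0" "h ` T \<subseteq> half_space \<nu>'" "h x \<bullet> \<nu>' = 0"
  shows "\<nu> \<noteq> 0 \<and> x \<bullet> \<nu> = 0 \<and> (\<forall>v. v \<bullet> \<nu> = 0 \<longrightarrow> D v \<bullet> \<nu>' = 0)"
proof -
  have lin: "linear D" using h has_derivative_linear by blast
  have tangent: "D v \<bullet> \<nu>' = 0" if v: "v \<bullet> \<nu> = 0 \<or> 0 < x \<bullet> \<nu>" for v
  proof -
    obtain e where e: "e > 0" "\<And>s. \<bar>s\<bar> < e \<Longrightarrow> x + s *\<^sub>R v \<in> T"
      using openin_half_space_tangent[OF T v] by blast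
    have "((\<lambda>s. x + s *\<^sub>R v) has_derivative (\<lambda>s. s *\<^sub>R v)) (at 0 within {-e<..<e})"
      by (auto intro!: derivative_eq_intros)
    moreover have "(h has_derivative D) (at (x + 0 *\<^sub>R v) within (\<lambda>s. x + s *\<^sub>R v) ` {-e<..<e})"
      using has_derivative_subset[OF h] e(2) by (auto simp: image_subset_iff abs_less_iff)
    ultimately have "((\<lambda>s. h (x + s *\<^sub>R v)) has_derivative (\<lambda>s. D (s *\<^sub>R v))) (at 0 within {-e<..<e})"
      by (rule has_derivative_in_compose)
    then have "((\<lambda>s. h (x + s *\<^sub>R v) \<bullet> \<nu>') has_derivative (\<lambda>s. D (s *\<^sub>R v) \<bullet> \<nu>')) (at 0 within {-e<..<e})"
      by (rule has_derivative_inner_left)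
    then have d: "((\<lambda>s. h (x + s *\<^sub>R v) \<bullet> \<nu>') has_derivative (\<lambda>s. D (s *\<^sub>R v) \<bullet> \<nu>')) (at 0)"
      using e(1) by (subst (asm) at_within_open) auto
    have "(\<lambda>s. D (s *\<^sub>R v) \<bullet> \<nu>') = (\<lambda>s. 0)"
    proof (rule has_derivative_local_min[OF d])
      have "\<forall>\<^sub>F s in at 0. s \<in> {-e<..<e}"
        using e(1) by (intro eventually_at_in_open') auto
      then show "\<forall>\<^sub>F s in at 0. h (x + 0 *\<^sub>R v) \<bullet> \<nu>' \<le> h (x + s *\<^sub>R v) \<bullet> \<nu>'"
      proof eventually_elim
        case (elim s)
        then have "x + s *\<^sub>R v \<in> T" by (intro e(2)) auto
        then have "h (x + s *\<^sub>R v) \<in> half_space \<nu>'" using \<nu>'(2) by blast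
        then show ?case using \<nu>'(3) by (simp add: half_space_def)
      qed
    qed
    from fun_cong[OF this, of 1] show ?thesis by simp
  qed
  have "\<exists>v. D v \<bullet> \<nu>' \<noteq> 0"
    using surj \<nu>'(1) by (metis inner_eq_zero_iff surjD)
  moreover have "0 \<le> x \<bullet> \<nu>"
    using T openin_imp_subset by (fastforce simp: half_space_def)
  ultimately show ?thesis
    using tangent by fastforce
qed

section \<open>Coordinate changes\<close>

lemma openin_overlap:
  assumes "is_chart M c" "openin (top_of_set (fst c)) (fst c \<inter> fst d)"
  shows "openin (top_of_set (img c)) (overlap c d)"
  unfolding overlap_def
  using homeomorphism_imp_open_map[OF is_chart_homeomorphism[OF assms(1)] assms(2)] .

lemma overlap_iff: "is_chart M c \<Longrightarrow> x \<in> overlap c d \<longleftrightarrow> x \<in> img c \<and> chart_inv c x \<in> fst d"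
  using chart_inv_snd[of M c] by (auto simp: overlap_def img_def chart_inv_in image_iff chart_inv_def
      f_inv_into_f inv_into_into)

lemma coord_change_in_overlap:
  assumes "is_chart M c" "x \<in> overlap c d"
  shows "coord_change c d x \<in> overlap d c"
proof -
  have "x \<in> img c" "chart_inv c x \<in> fst d" "chart_inv c x \<in> fst c"
    using assms(2) by (simp_all add: overlap_iff[OF assms(1)] chart_inv_in)
  then show ?thesis by (auto simp: overlap_def coord_change_def)
qed

lemma coord_change_inverse:
  assumes "is_chart M c" "is_chart M' d" "x \<in> overlap c d"
  shows "coord_change d c (coord_change c d x) = x"
proof -
  have "x \<in> img c" "chart_inv c x \<in> fst d"
    using assms(3) by (simp_all add: overlap_iff[OF assms(1)])
  then show ?thesis
    using chart_inv_snd[OF assms(2)] snd_chart_inv by (simp add: coord_change_def)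
qed

lemma overlap_subset_img: "overlap c d \<subseteq> img c"
  by (auto simp: overlap_def img_def)

lemma snd_in_overlap: "p \<in> fst c \<Longrightarrow> p \<in> fst d \<Longrightarrow> snd c p \<in> overlap c d"
  by (auto simp: overlap_def)

lemma coord_change_snd: "is_chart M c \<Longrightarrow> p \<in> fst c \<Longrightarrow> coord_change c d (snd c p) = snd d p"
  by (simp add: coord_change_def chart_inv_snd)

text \<open>Differentiates \<open>g (h y) = y\<close>. Uniqueness of derivatives within
  \<open>T\<close> identifies the composite with the identity, at boundary points too.\<close>

lemma left_inverse_derivative:
  fixes h :: "'e::euclidean_space \<Rightarrow> 'f::euclidean_space" and g :: "'f \<Rightarrow> 'e"
  assumes "hs_open T" "x \<in> T" "(h has_derivative D) (at x within T)" "(g has_derivative L) (at (h x)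
      within Q)"
    and "h ` T \<subseteq> Q" "\<And>y. y \<in> T \<Longrightarrow> g (h y) = y"
  shows "L (D v) = v"
proof -
  have "((\<lambda>y. g (h y)) has_derivative (\<lambda>v. L (D v))) (at x within T)"
    using has_derivative_in_compose[OF assms(3) has_derivative_subset[OF assms(4,5)]] .
  then have "((\<lambda>y. y) has_derivative (\<lambda>v. L (D v))) (at x within T)"
    by (rule has_derivative_transform[OF assms(2), rotated]) (simp add: assms(6))
  from hs_open_frechet_derivative[OF assms(1,2) this]
    hs_open_frechet_derivative[OF assms(1,2) has_derivative_ident]
  show ?thesis by metis
qed

lemma linear_left_inverse_bij:
  fixes D L :: "'e::euclidean_space \<Rightarrow> 'e"
  assumes "linear D" "\<And>v. L (D v) = v"
  shows "surj D" "D (L w) = w"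
proof -
  have "inj D" using assms(2) by (metis injI)
  then show "surj D" using assms(1) linear_injective_imp_surjective by blast
  then show "D (L w) = w" using assms(2) by (metis surjD)
qed

section \<open>The Reeb vector field\<close>

definition nondegenerate :: "('a::real_vector \<Rightarrow> 'a \<Rightarrow> real) \<Rightarrow> bool" where
  "nondegenerate \<omega> \<longleftrightarrow> (\<forall>u. (\<forall>v. \<omega> u v = 0) \<longrightarrow> u = 0)"

definition reeb_vector :: "('e::euclidean_space \<Rightarrow> real) \<Rightarrow> ('e \<Rightarrow> 'e \<Rightarrow> real) \<Rightarrow> 'e \<Rightarrow> 'e \<Rightarrow> bool" where
  "reeb_vector a \<omega> \<nu> r \<longleftrightarrow> r \<bullet> \<nu> = 0 \<and> a r = 1 \<and> (\<forall>v. v \<bullet> \<nu> = 0 \<longrightarrow> \<omega> r v = 0)"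

lemma functional_vanishing_on_hyperplane:
  fixes \<theta> :: "'e::real_inner \<Rightarrow> real"
  assumes "linear \<theta>" "\<nu> \<noteq> 0" "\<And>v. v \<bullet> \<nu> = 0 \<Longrightarrow> \<theta> v = 0"
  shows "\<theta> v = \<theta> \<nu> / (\<nu> \<bullet> \<nu>) * (v \<bullet> \<nu>)"
proof -
  have "\<theta> (v - (v \<bullet> \<nu> / (\<nu> \<bullet> \<nu>)) *\<^sub>R \<nu>) = 0"
    using assms(2) by (intro assms(3)) (simp add: inner_diff_left)
  then show ?thesis
    by (simp add: linear_diff[OF assms(1)] linear_scale[OF assms(1)])
qed

text \<open>The Reeb line is dual to the conormal: \<open>\<omega> r\<close> vanishes on the
  hyperplane, so it is a multiple of \<open>\<nu>\<close>, and a nonzero one because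
  \<open>a r = 1\<close> excludes \<open>r = 0\<close>.\<close>

lemma reeb_vector_conormal:
  assumes "linear (\<omega> r)" "linear a" "nondegenerate \<omega>" "\<nu> \<noteq> 0" "reeb_vector a \<omega> \<nu> r"
  obtains k where "k \<noteq> 0" "\<And>v. \<omega> r v = k * (v \<bullet> \<nu>)"
proof -
  define k where "k = \<omega> r \<nu> / (\<nu> \<bullet> \<nu>)"
  have k: "\<omega> r v = k * (v \<bullet> \<nu>)" for v
    unfolding k_def using assms by (intro functional_vanishing_on_hyperplane) (auto simp: reeb_vector_def)
  have "k \<noteq> 0"
  proof
    assume "k = 0"
    then have "r = 0" using k assms(3) by (auto simp: nondegenerate_def)
    then show False using linear_0[OF assms(2)] assms(5) by (simp add: reeb_vector_def)
  qed
  with k show thesis by (rule that[rotated])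
qed

text \<open>Both vectors are dual to multiples of \<open>\<nu>\<close>, hence proportional by
  nondegeneracy; the normalization by \<open>a\<close> makes the factor 1.\<close>

lemma reeb_vector_unique:
  assumes "\<And>u. linear (\<omega> u)" "\<And>v. linear (\<lambda>u. \<omega> u v)" "linear a" "nondegenerate \<omega>" "\<nu> \<noteq> 0"
    and r: "reeb_vector a \<omega> \<nu> r" "reeb_vector a \<omega> \<nu> r'"
  shows "r = r'"
proof -
  obtain k where k: "k \<noteq> 0" "\<And>v. \<omega> r v = k * (v \<bullet> \<nu>)"
    using reeb_vector_conormal[OF assms(1,3,4,5) r(1)] by blast
  obtain k' where k': "k' \<noteq> 0" "\<And>v. \<omega> r' v = k' * (v \<bullet> \<nu>)"
    using reeb_vector_conormal[OF assms(1,3,4,5) r(2)] by blast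
  have "\<omega> (k' *\<^sub>R r - k *\<^sub>R r') v = 0" for v
    using k(2) k'(2) by (simp add: linear_diff[OF assms(2)] linear_scale[OF assms(2)])
  then have eq: "k' *\<^sub>R r - k *\<^sub>R r' = 0"
    using assms(4) unfolding nondegenerate_def by blast
  have "a (k' *\<^sub>R r - k *\<^sub>R r') = k' - k"
    using r by (simp add: reeb_vector_def linear_diff[OF assms(3)] linear_scale[OF assms(3)])
  then have "k' = k" using eq linear_0[OF assms(3)] by simp
  then show ?thesis using eq k(1) by (simp add: scaleR_diff_right[symmetric])
qed

lemma reeb_vector_normal_change:
  assumes "inward_normal c x \<nu>" "inward_normal c x \<nu>'" "reeb_vector a \<omega> \<nu> r"
  shows "reeb_vector a \<omega> \<nu>' r"
  using assms inward_normal_unique unfolding reeb_vector_def by metis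

lemma reeb_field_eq:
  assumes \<nu>: "inward_normal c x \<nu>" and \<beta>: "smooth_form_in (\<beta> c) (img c)" and nd: "nondegenerate
      (ext_deriv \<beta> c x)"
    and r: "reeb_vector (\<beta> c x) (ext_deriv \<beta> c x) \<nu> r"
  shows "reeb_field \<beta> c x = r"
proof -
  have x: "x \<in> img c" using \<nu> by (simp add: inward_normal_def)
  have lin: "linear (ext_deriv \<beta> c x u)" "linear (\<lambda>u. ext_deriv \<beta> c x u v)" "linear (\<beta> c x)" for u v
    using linear_d1_form_right[OF \<beta> inward_normal_hs_open[OF \<nu>] x] linear_d1_form_left[OF \<beta>
        inward_normal_hs_open[OF \<nu>] x]
      \<beta> x by (auto simp: ext_deriv_d1_form smooth_form_in_def)
  have "(THE r. \<exists>\<nu>. inward_normal c x \<nu> \<and> reeb_vector (\<beta> c x) (ext_deriv \<beta> c x) \<nu> r) = r"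
  proof (rule the_equality)
    show "\<exists>\<nu>. inward_normal c x \<nu> \<and> reeb_vector (\<beta> c x) (ext_deriv \<beta> c x) \<nu> r"
      using \<nu> r by blast
    fix r' assume "\<exists>\<nu>. inward_normal c x \<nu> \<and> reeb_vector (\<beta> c x) (ext_deriv \<beta> c x) \<nu> r'"
    then have "reeb_vector (\<beta> c x) (ext_deriv \<beta> c x) \<nu> r'"
      using reeb_vector_normal_change \<nu> by blast
    then show "r' = r"
      using \<nu> r nd lin by (intro reeb_vector_unique[of "ext_deriv \<beta> c x" "\<beta> c x" \<nu>]) (auto simp:
          inward_normal_def)
  qed
  then show ?thesis by (simp add: reeb_field_def reeb_vector_def)
qed

lemma dual_vector_eq:
  assumes \<beta>: "smooth_form_in (\<beta> c) (img c)" and hs: "hs_open (img c)" and x: "x \<in> img c"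
    and nd: "nondegenerate (ext_deriv \<beta> c x)" and u: "\<And>v. ext_deriv \<beta> c x u v = \<theta> v"
  shows "dual_vector \<beta> c x \<theta> = u"
  unfolding dual_vector_def
proof (rule the_equality)
  fix u' assume u': "\<forall>v. ext_deriv \<beta> c x u' v = \<theta> v"
  have "ext_deriv \<beta> c x (u' - u) v = 0" for v
    using linear_diff[OF linear_d1_form_left[OF \<beta> hs x, of v], of u' u] u u' by (simp add: ext_deriv_d1_form)
  then have "u' - u = 0" using nd unfolding nondegenerate_def by blast
  then show "u' = u" by simp
qed (use u in auto)

lemma dual_vector_lip_near:
  assumes \<beta>: "smooth_form_in (\<beta> c) (img c)" and hs: "hs_open (img c)" and x: "x \<in> img c"
    and nd: "nondegenerate (ext_deriv \<beta> c x)" and \<theta>: "smooth_form_in \<theta> (img c)"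
  shows "lip_near (img c) x (\<lambda>y. dual_vector \<beta> c y (\<theta> y))"
    and "\<exists>e>0. \<forall>y\<in>img c \<inter> ball x e. nondegenerate (ext_deriv \<beta> c y)
       \<and> (\<forall>v. ext_deriv \<beta> c y (dual_vector \<beta> c y (\<theta> y)) v = \<theta> y v)"
proof -
  have nd': "u = 0" if "\<And>v. d1_form (\<beta> c) (img c) x u v = 0" for u
    using nd that unfolding nondegenerate_def ext_deriv_d1_form by blast
  obtain e n L where e: "e > 0"
    "\<And>y v. y \<in> img c \<inter> ball x e \<Longrightarrow> ext_deriv \<beta> c y (n y) v = \<theta> y v"
    "\<And>y. y \<in> img c \<inter> ball x e \<Longrightarrow> nondegenerate (ext_deriv \<beta> c y)"
    "\<And>y z. y \<in> img c \<inter> ball x e \<Longrightarrow> z \<in> img c \<inter> ball x e \<Longrightarrow> norm (n y - n z) \<le> L * norm (y - z)"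
    using dual_solution_lipschitz[OF x linear_d1_form_right[OF \<beta> hs] linear_d1_form_left[OF \<beta> hs]
        smooth_in_d1_form[OF \<beta> hs] nd' \<theta>]
    unfolding ext_deriv_d1_form[symmetric] nondegenerate_def by metis
  have n: "dual_vector \<beta> c y (\<theta> y) = n y" if "y \<in> img c \<inter> ball x e" for y
    using that e(2,3) by (intro dual_vector_eq \<beta> hs) auto
  have "lip_near (img c) x n"
    using e(1,4) by (rule lip_nearI)
  then show "lip_near (img c) x (\<lambda>y. dual_vector \<beta> c y (\<theta> y))"
    by (rule lip_near_cong[OF _ e(1)]) (simp add: n)
  show "\<exists>e>0. \<forall>y\<in>img c \<inter> ball x e. nondegenerate (ext_deriv \<beta> c y)
       \<and> (\<forall>v. ext_deriv \<beta> c y (dual_vector \<beta> c y (\<theta> y)) v = \<theta> y v)"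
    using e(1-3) n by (intro exI[of _ e]) auto
qed

lemma smooth_form_apply_lip_near:
  assumes "smooth_form_in \<beta> T" "lip_near T x n" "x \<in> T"
  shows "lip_near T x (\<lambda>y. \<beta> y (n y))"
proof -
  have "lip_near T x (\<lambda>y. \<Sum>b\<in>Basis. (\<beta> y b) *\<^sub>R ((n y \<bullet> b)))"
  proof (intro lip_near_sum lip_near_scaleR assms(3))
    fix b :: 'a assume "b \<in> Basis"
    show "lip_near T x (\<lambda>y. \<beta> y b)"
      using assms by (auto simp: smooth_form_in_def intro: smooth_in_lip_near)
    obtain e L where e: "e > 0" "\<And>y z. y \<in> T \<inter> ball x e \<Longrightarrow> z \<in> T \<inter> ball x e \<Longrightarrow> norm (n y - n z) \<le> L * norm
        (y - z)"
      using assms(2) unfolding lip_near_def by blast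
    show "lip_near T x (\<lambda>y. n y \<bullet> b)"
    proof (rule lip_nearI[OF e(1)])
      fix y z assume yz: "y \<in> T \<inter> ball x e" "z \<in> T \<inter> ball x e"
      have "norm (n y \<bullet> b - n z \<bullet> b) \<le> norm (n y - n z)"
        using Basis_le_norm[OF \<open>b \<in> Basis\<close>, of "n y - n z"] by (simp add: inner_diff_left)
      then show "norm (n y \<bullet> b - n z \<bullet> b) \<le> L * norm (y - z)"
        using e(2)[OF yz] by simp
    qed
  qed
  then show ?thesis
  proof (rule lip_near_cong[OF _ zero_less_one])
    fix y assume "y \<in> T"
    then have "linear (\<beta> y)" using assms by (simp add: smooth_form_in_def)
    from linear_expand_basis[OF this, of "n y"]
    show "(\<Sum>b\<in>Basis. (\<beta> y b) *\<^sub>R ((n y \<bullet> b))) = \<beta> y (n y)"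
      by (simp add: mult.commute)
  qed
qed

text \<open>The vector \<open>n\<close> dual to \<open>\<nu>\<close> is Lipschitz near
  \<open>x\<close> on the chart image, and the Reeb vector is \<open>n\<close> divided by its value
  under \<open>\<beta>\<close>. The restriction to the hyperplane selects the boundary points, where
  a Reeb vector makes sense.\<close>

lemma reeb_field_lip_near:
  assumes \<nu>: "inward_normal c x \<nu>" and \<beta>: "smooth_form_in (\<beta> c) (img c)" and nd: "nondegenerate
      (ext_deriv \<beta> c x)"
    and r: "reeb_vector (\<beta> c x) (ext_deriv \<beta> c x) \<nu> r"
  shows "lip_near (img c \<inter> {y. y \<bullet> \<nu> = 0}) x (reeb_field \<beta> c)"
proof -
  have x: "x \<in> img c" "x \<bullet> \<nu> = 0" and hs: "hs_open (img c)" and \<nu>0: "\<nu> \<noteq> 0"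
    using \<nu> inward_normal_hs_open[OF \<nu>] by (auto simp: inward_normal_def)
  define n where "n y = dual_vector \<beta> c y (\<lambda>v. v \<bullet> \<nu>)" for y
  have \<theta>: "smooth_form_in (\<lambda>y v. v \<bullet> \<nu>) (img c)"
    by (auto simp: smooth_form_in_def smooth_in_const bounded_linear.linear bounded_linear_inner_left)
  have lin: "linear (ext_deriv \<beta> c y u)" "linear (\<lambda>u. ext_deriv \<beta> c y u v)" "linear (\<beta> c y)" if "y \<in> img
      c" for u v y
    using linear_d1_form_right[OF \<beta> hs that] linear_d1_form_left[OF \<beta> hs that]
      \<beta> that by (auto simp: ext_deriv_d1_form smooth_form_in_def)
  have lip: "lip_near (img c) x n"
    unfolding n_def using dual_vector_lip_near(1)[OF \<beta> hs x(1) nd \<theta>] .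
  obtain e where e: "e > 0" "\<And>y. y \<in> img c \<Longrightarrow> y \<in> ball x e \<Longrightarrow> nondegenerate (ext_deriv \<beta> c y)"
    "\<And>y v. y \<in> img c \<Longrightarrow> y \<in> ball x e \<Longrightarrow> ext_deriv \<beta> c y (n y) v = v \<bullet> \<nu>"
    unfolding n_def using dual_vector_lip_near(2)[OF \<beta> hs x(1) nd \<theta>] by blast
  have lipb: "lip_near (img c) x (\<lambda>y. \<beta> c y (n y))"
    using smooth_form_apply_lip_near[OF \<beta> lip x(1)] .
  obtain k where k: "k \<noteq> 0" "\<And>v. ext_deriv \<beta> c x r v = k * (v \<bullet> \<nu>)"
    using reeb_vector_conormal[OF lin(1)[OF x(1)] lin(3)[OF x(1)] nd \<nu>0 r] by blast
  \<comment> \<open>At \<open>x\<close> the dual vector is the given Reeb vector over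
    \<open>k\<close>, so the denominator is nonzero there and, by continuity, nearby.\<close>
  have "n x = inverse k *\<^sub>R r"
    unfolding n_def using k by (intro dual_vector_eq \<beta> hs x nd) (simp add: linear_scale[OF lin(2)[OF x(1)]])
  then have bx: "\<beta> c x (n x) \<noteq> 0"
    using k(1) r by (simp add: linear_scale[OF lin(3)[OF x(1)]] reeb_vector_def)
  obtain d where d: "d > 0" "\<And>y. y \<in> img c \<Longrightarrow> dist y x < d \<Longrightarrow> dist (\<beta> c y (n y)) (\<beta> c x (n x)) < \<bar>\<beta> c x (n x)\<bar>"
    using lip_near_continuous[OF lipb x(1)] bx unfolding continuous_within_eps_delta by (metis
        zero_less_abs_iff)
  have "lip_near (img c) x (\<lambda>y. inverse (\<beta> c y (n y)) *\<^sub>R n y)"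
    by (intro lip_near_scaleR lip_near_inverse lipb lip x bx)
  then have "lip_near (img c \<inter> {y. y \<bullet> \<nu> = 0}) x (\<lambda>y. inverse (\<beta> c y (n y)) *\<^sub>R n y)"
    by (rule lip_near_subset) auto
  then show ?thesis
  proof (rule lip_near_cong)
    show "min d e > 0" using d e by simp
    fix y assume y: "y \<in> img c \<inter> {y. y \<bullet> \<nu> = 0}" "y \<in> ball x (min d e)"
    then have y': "y \<in> img c" "y \<in> ball x e" "y \<bullet> \<nu> = 0" "dist y x < d" by (auto simp: dist_commute)
    have \<nu>y: "inward_normal c y \<nu>"
      using \<nu> y' by (simp add: inward_normal_def)
    have bny: "\<beta> c y (n y) \<noteq> 0"
      using d(2)[OF y'(1,4)] by (auto simp: dist_real_def)
    \<comment> \<open>By antisymmetry the 2-form vanishes on the pair of \<open>n y\<close> with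
      itself, hence \<open>n y\<close> is tangent.\<close>
    have "n y \<bullet> \<nu> = 0"
      using e(3)[OF y'(1,2), of "n y"] d1_form_antisym[of "\<beta> c" "img c" y "n y" "n y"] by (simp add:
          ext_deriv_d1_form)
    then have "reeb_vector (\<beta> c y) (ext_deriv \<beta> c y) \<nu> (inverse (\<beta> c y (n y)) *\<^sub>R n y)"
      using bny e(3)[OF y'(1,2)]
      by (simp add: reeb_vector_def linear_scale[OF lin(3)[OF y'(1)]] linear_scale[OF lin(2)[OF y'(1)]])
    then show "inverse (\<beta> c y (n y)) *\<^sub>R n y = reeb_field \<beta> c y"
      using reeb_field_eq[OF \<nu>y \<beta> e(2)[OF y'(1,2)]] by simp
  qed
qed

text \<open>Near \<open>p\<close> the field has to coincide at all times with one field
  \<open>Y\<close>; this makes the Lipschitz constant and the speed bound uniform in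
  \<open>t\<close>.\<close>

lemma lip_near_imp_tame_at:
  assumes c: "is_chart M c" "c \<in> A" "S \<subseteq> M" "p \<in> S" "p \<in> fst c"
    and lip: "lip_near (snd c ` (S \<inter> fst c)) (snd c p) Y"
    and X: "e > 0" "\<And>t q. q \<in> S \<Longrightarrow> q \<in> fst c \<Longrightarrow> snd c q \<in> ball (snd c p) e \<Longrightarrow> X t c (snd c q) = Y (snd c q)"
  shows "tame_at A S X p"
proof -
  have x: "snd c p \<in> snd c ` (S \<inter> fst c)" using c by blast
  obtain e1 L where e1: "e1 > 0" "\<And>y z. y \<in> snd c ` (S \<inter> fst c) \<inter> ball (snd c p) e1 \<Longrightarrow>
      z \<in> snd c ` (S \<inter> fst c) \<inter> ball (snd c p) e1 \<Longrightarrow> norm (Y y - Y z) \<le> L * norm (y - z)"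
    using lip unfolding lip_near_def by blast
  obtain e2 B where e2: "e2 > 0" "\<And>y. y \<in> snd c ` (S \<inter> fst c) \<inter> ball (snd c p) e2 \<Longrightarrow> norm (Y y) \<le> B"
    using lip_near_bounded[OF lip x] by metis
  define r where "r = min e (min e1 e2)"
  have r: "r > 0" using X e1 e2 by (simp add: r_def)
  have XY: "X t c y = Y y" if "y \<in> snd c ` (S \<inter> fst c) \<inter> ball (snd c p) r" for t y
    using that X(2) by (auto simp: r_def)
  show ?thesis
  proof (rule lipschitz_imp_tame_at[OF c(1-3,5) r, of X L B])
    fix t y z assume yz: "y \<in> snd c ` (S \<inter> fst c) \<inter> ball (snd c p) r" "z \<in> snd c ` (S \<inter> fst c) \<inter> ball
        (snd c p) r"
    show "norm (X t c y - X t c z) \<le> L * norm (y - z)"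
      using XY[OF yz(1)] XY[OF yz(2)] e1(2)[of y z] yz by (simp add: r_def)
    show "norm (X t c y) \<le> B"
      using XY[OF yz(1)] e2(2)[of y] yz by (simp add: r_def)
  qed
qed

section \<open>The Hamiltonian flow on the boundary\<close>

lemma openin_Int_subset:
  assumes "U \<subseteq> M" "openin (top_of_set M) V"
  shows "openin (top_of_set U) (U \<inter> V)"
proof -
  obtain V' where "open V'" "V = M \<inter> V'"
    using assms(2) by (auto simp: openin_open)
  then show ?thesis
    using assms(1) by (auto simp: openin_open)
qed

lemma openin_chart_Int:
  assumes "is_chart M c" "is_chart M d"
  shows "openin (top_of_set (fst c)) (fst c \<inter> fst d)"
  using openin_Int_subset[OF is_chart_subset[OF assms(1)]] assms(2) by (simp add: is_chart_def)

lemma boundary_point_unique: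
  assumes "openin (top_of_set (half_space \<nu>)) T" "x \<in> T" "\<nu>' \<noteq> 0" "T \<subseteq> half_space \<nu>'" "x \<bullet> \<nu>' = 0"
  shows "\<nu> \<noteq> 0 \<and> x \<bullet> \<nu> = 0"
  using boundary_tangent[OF assms(1,2) has_derivative_ident, of \<nu>'] assms(3-5) by auto

lemma inward_normal_subset: "inward_normal c x \<nu> \<Longrightarrow> img c \<subseteq> half_space \<nu>"
  using openin_imp_subset by (auto simp: inward_normal_def)

lemma frechet_derivative_openin_cong:
  assumes "hs_open T" "openin (top_of_set T) V" "x \<in> V" "smooth_in T f" "\<And>y. y \<in> V \<Longrightarrow> g y = f y"
  shows "frechet_derivative g (at x within T) = frechet_derivative f (at x within T)"
proof -
  have "x \<in> T" using assms(2,3) openin_imp_subset by blast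
  have "(f has_derivative frechet_derivative f (at x within T)) (at x within V)"
    using smooth_in_has_derivative[OF assms(4) \<open>x \<in> T\<close>] unfolding at_within_openin[OF assms(2,3)] .
  then have "(g has_derivative frechet_derivative f (at x within T)) (at x within V)"
    by (rule has_derivative_transform[OF assms(3), rotated]) (rule assms(5))
  then have "(g has_derivative frechet_derivative f (at x within T)) (at x within T)"
    unfolding at_within_openin[OF assms(2,3)] .
  then show ?thesis
    by (rule hs_open_frechet_derivative[OF assms(1) \<open>x \<in> T\<close>])
qed

text \<open>\<open>s\<close> is the inverse of an antiderivative \<open>G\<close> of 1 /
  \<open>f\<close>. The upper bound \<open>M\<close> on \<open>f\<close> bounds the slope of
  \<open>G\<close> from below, which makes \<open>G\<close> onto and its inverse continuous, so
  \<open>s\<close> is defined for all times.\<close>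

lemma time_change_exists:
  fixes f :: "real \<Rightarrow> real"
  assumes f: "continuous_on UNIV f" and m: "0 < m" "\<And>u. m \<le> f u" "\<And>u. f u \<le> M"
  obtains s where "s 0 = 0" "\<And>t. (s has_real_derivative f (s t)) (at t)"
proof -
  have fpos: "0 < f u" for u
    using m(1) m(2)[of u] by linarith
  have M: "M > 0" using fpos[of 0] m(3)[of 0] by linarith
  have "\<exists>G. \<forall>x. -\<infinity> < ereal x \<longrightarrow> ereal x < \<infinity> \<longrightarrow> (G has_vector_derivative inverse (f x)) (at x)"
  proof (rule einterval_antiderivative)
    fix x show "isCont (\<lambda>x. inverse (f x)) x"
      using f fpos by (intro continuous_at_within_inverse) (auto simp: continuous_on_eq_continuous_at
          less_imp_neq[symmetric])
  qed auto
  then obtain G0 where G0: "\<And>x. (G0 has_real_derivative inverse (f x)) (at x)"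
    by (auto simp: has_real_derivative_iff_has_vector_derivative)
  define G where "G x = G0 x - G0 0" for x
  have G: "(G has_real_derivative inverse (f x)) (at x)" for x
    unfolding G_def using G0[of x] by (auto intro!: derivative_eq_intros)
  have low: "(v - u) / M \<le> G v - G u" if "u \<le> v" for u v
  proof -
    have "G u - u / M \<le> G v - v / M"
    proof (rule DERIV_nonneg_imp_nondecreasing[OF that, of "\<lambda>x. G x - x / M"])
      fix x
      have "((\<lambda>x. G x - x / M) has_real_derivative inverse (f x) - 1 / M) (at x)"
        using G M by (auto intro!: derivative_eq_intros)
      moreover have "0 \<le> inverse (f x) - 1 / M"
        using m(3)[of x] fpos[of x] by (simp add: inverse_eq_divide frac_le)
      ultimately show "\<exists>y. ((\<lambda>x. G x - x / M) has_real_derivative y) (at x) \<and> 0 \<le> y"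
        by blast
    qed
    then show ?thesis by (simp add: diff_divide_distrib)
  qed
  have mono: "v - u \<le> M * (G v - G u)" "G u \<le> G v" if "u \<le> v" for u v
  proof -
    show "v - u \<le> M * (G v - G u)"
      using low[OF that] M by (simp add: pos_divide_le_eq mult.commute)
    have "0 \<le> (v - u) / M"
      using that M by simp
    then show "G u \<le> G v"
      using low[OF that] by linarith
  qed
  have lip: "\<bar>u - v\<bar> \<le> M * \<bar>G u - G v\<bar>" for u v
    using mono[of u v] mono[of v u] by (cases "u \<le> v") (simp_all add: abs_of_nonpos abs_of_nonneg not_le)
  have "\<exists>u. G u = t" for t
  proof -
    \<comment> \<open>With \<open>G 0 = 0\<close> and slope at least 1 / \<open>M\<close>, all
      values of absolute value up to \<open>\<bar>t\<bar>\<close> are taken on this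
      interval.\<close>
    have "\<exists>u\<ge>- (M * \<bar>t\<bar>). u \<le> M * \<bar>t\<bar> \<and> G u = t"
    proof (rule IVT)
      show "G (- (M * \<bar>t\<bar>)) \<le> t" "t \<le> G (M * \<bar>t\<bar>)"
        using low[of "- (M * \<bar>t\<bar>)" 0] low[of 0 "M * \<bar>t\<bar>"] M by (auto simp: G_def)
      show "- (M * \<bar>t\<bar>) \<le> M * \<bar>t\<bar>"
        using M by simp
      show "\<forall>x. - (M * \<bar>t\<bar>) \<le> x \<and> x \<le> M * \<bar>t\<bar> \<longrightarrow> isCont G x"
        using G DERIV_isCont by blast
    qed
    then show ?thesis by blast
  qed
  then obtain s where s: "\<And>t. G (s t) = t"
    by metis
  have "s 0 = 0"
    using lip[of "s 0" 0] s[of 0] by (simp add: G_def)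
  moreover have "(s has_real_derivative f (s t)) (at t)" for t
  proof -
    have "isCont s t"
      unfolding continuous_at_eps_delta
    proof (intro allI impI)
      fix e :: real assume "e > 0"
      then show "\<exists>d>0. \<forall>x'. dist x' t < d \<longrightarrow> dist (s x') (s t) < e"
        using lip[of "s _" "s t"] M s
        by (intro exI[of _ "e / M"])
          (auto simp: dist_real_def pos_less_divide_eq mult.commute intro: le_less_trans)
    qed
    then have "(s has_real_derivative inverse (inverse (f (s t)))) (at t)"
      using G fpos[of "s t"] s by (intro DERIV_inverse_function[where f = G and g = s and x = t and a =
          "t - 1" and b = "t + 1"]) auto
    then show ?thesis by simp
  qed
  ultimately show thesis by (rule that)
qed

locale liouville_hamiltonian =
  fixes W :: "'a::metric_space set" and A :: "('a, 'e::euclidean_space) chart set"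
    and \<alpha> :: "('a, 'e) one_form" and H :: "real \<Rightarrow> 'a \<Rightarrow> real"
  assumes liouville: "liouville_domain W A \<alpha>" and admissible: "H \<in> admissible_hamiltonians W A \<alpha>"
begin

lemma compact_W: "compact W" and W_eq: "W = (\<Union>c\<in>A. fst c)"
  and chart: "c \<in> A \<Longrightarrow> is_chart W c"
  and smooth_coord_change: "c \<in> A \<Longrightarrow> d \<in> A \<Longrightarrow> smooth_in (overlap c d) (coord_change c d)"
  and smooth_form: "c \<in> A \<Longrightarrow> smooth_form_in (\<alpha> c) (img c)"
  and form_coord_change: "c \<in> A \<Longrightarrow> d \<in> A \<Longrightarrow> x \<in> overlap c d \<Longrightarrow>
    \<alpha> c x v = \<alpha> d (coord_change c d x) (frechet_derivative (coord_change c d) (at x within overlap c d) v)"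
  and nondeg: "c \<in> A \<Longrightarrow> x \<in> img c \<Longrightarrow> nondegenerate (ext_deriv \<alpha> c x)"
  and liouville_outward: "c \<in> A \<Longrightarrow> inward_normal c x \<nu> \<Longrightarrow> liouville_field \<alpha> c x \<bullet> \<nu> < 0"
  using liouville
  unfolding liouville_domain_def smooth_atlas_def compatible_def smooth_one_form_def smooth_form_in_def
      nondegenerate_def
  by blast+

lemma hs_open_img: "c \<in> A \<Longrightarrow> hs_open (img c)"
  using chart is_chart_hs_open by blast

lemma openin_overlap_img: "c \<in> A \<Longrightarrow> d \<in> A \<Longrightarrow> openin (top_of_set (img c)) (overlap c d)"
  by (rule openin_overlap[OF chart openin_chart_Int[OF chart chart]])

lemma hs_open_overlap: "c \<in> A \<Longrightarrow> d \<in> A \<Longrightarrow> hs_open (overlap c d)"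
  using hs_open_openin[OF hs_open_img openin_overlap_img] .

lemma coord_change_image: "c \<in> A \<Longrightarrow> coord_change c d ` overlap c d \<subseteq> overlap d c"
  using coord_change_in_overlap[OF chart] by blast

definition D where
  "D c d x = frechet_derivative (coord_change c d) (at x within overlap c d)"

lemma D_has_derivative:
  "c \<in> A \<Longrightarrow> d \<in> A \<Longrightarrow> x \<in> overlap c d \<Longrightarrow> (coord_change c d has_derivative D c d x) (at x within overlap c d)"
  unfolding D_def using smooth_in_has_derivative[OF smooth_coord_change] .

lemma D_inverse:
  assumes "c \<in> A" "d \<in> A" "x \<in> overlap c d"
  shows "D d c (coord_change c d x) (D c d x v) = v"
proof (rule left_inverse_derivative[OF hs_open_overlap[OF assms(1,2)] assms(3) D_has_derivative[OF assms]])
  show "(coord_change d c has_derivative D d c (coord_change c d x)) (at (coord_change c d x) within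
      overlap d c)"
    using assms by (intro D_has_derivative coord_change_in_overlap[OF chart])
  show "coord_change c d ` overlap c d \<subseteq> overlap d c"
    using coord_change_image[OF assms(1)] .
  show "coord_change d c (coord_change c d y) = y" if "y \<in> overlap c d" for y
    using coord_change_inverse[OF chart[OF assms(1)] chart[OF assms(2)] that] .
qed

lemma surj_D:
  assumes "c \<in> A" "d \<in> A" "x \<in> overlap c d"
  shows "surj (D c d x)"
  using linear_left_inverse_bij(1)[OF has_derivative_linear[OF D_has_derivative[OF assms]] D_inverse[OF
      assms]] .

lemma ext_deriv_coord_change:
  assumes "c \<in> A" "d \<in> A" "x \<in> overlap c d"
  shows "ext_deriv \<alpha> c x u v = ext_deriv \<alpha> d (coord_change c d x) (D c d x u) (D c d x v)"
proof -
  have "coord_change c d ` overlap c d \<subseteq> img d"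
    by (rule order_trans[OF coord_change_image[OF assms(1)] overlap_subset_img])
  from d1_form_pullback[OF hs_open_overlap[OF assms(1,2)] hs_open_img[OF assms(2)] smooth_coord_change[OF
      assms(1,2)]
      this smooth_form[OF assms(2)] form_coord_change[OF assms(1,2)] assms(3)]
  show ?thesis
    by (simp add: ext_deriv_d1_form D_def d1_form_openin[OF openin_overlap_img[OF assms(1,2)] assms(3)])
qed

definition dH where
  "dH t c x = frechet_derivative (\<lambda>y. H t (chart_inv c y)) (at x within img c)"

lemma smooth_H:
  assumes "c \<in> A"
  shows "smooth_in (img c) (\<lambda>y. H t (chart_inv c y))"
proof -
  have "smooth_in (UNIV \<times> img c) (\<lambda>(t, x). H t (chart_inv c x))"
    using admissible assms by (auto simp: admissible_hamiltonians_def)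
  moreover have "smooth_in (img c) (\<lambda>x. (t, x))"
    by (intro smooth_in_Pair smooth_in_const smooth_in_linear bounded_linear_ident)
  ultimately show ?thesis
    using smooth_in_compose[of "img c" "\<lambda>x. (t, x)" "UNIV \<times> img c" "\<lambda>(t, x). H t (chart_inv c x)"] by auto
qed

lemma dH_has_derivative:
  "c \<in> A \<Longrightarrow> x \<in> img c \<Longrightarrow> ((\<lambda>y. H t (chart_inv c y)) has_derivative dH t c x) (at x within img c)"
  unfolding dH_def by (rule smooth_in_has_derivative[OF smooth_H])

lemma smooth_dH: "c \<in> A \<Longrightarrow> smooth_form_in (dH t c) (img c)"
  unfolding smooth_form_in_def
  using has_derivative_linear[OF dH_has_derivative] smooth_in_frechet_derivative[OF hs_open_img smooth_H]
  by (auto simp: dH_def)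

lemma dH_coord_change:
  assumes "c \<in> A" "d \<in> A" "x \<in> overlap c d"
  shows "dH t c x v = dH t d (coord_change c d x) (D c d x v)"
proof -
  have x: "x \<in> img c" "coord_change c d x \<in> img d"
    using assms(3) overlap_subset_img[of c d] overlap_subset_img[of d c] coord_change_image[OF assms(1),
        of d] by auto
  have "((\<lambda>y. H t (chart_inv d y)) has_derivative dH t d (coord_change c d x)) (at (coord_change c d x)
      within coord_change c d ` overlap c d)"
    by (rule has_derivative_subset[OF dH_has_derivative[OF assms(2) x(2)]
          order_trans[OF coord_change_image[OF assms(1)] overlap_subset_img]])
  from has_derivative_in_compose[OF D_has_derivative[OF assms] this]
  have "((\<lambda>y. H t (chart_inv c y)) has_derivative (\<lambda>v. dH t d (coord_change c d x) (D c d x v))) (at x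
      within overlap c d)"
  proof (rule has_derivative_transform[OF assms(3), rotated])
    fix y assume "y \<in> overlap c d"
    then have "chart_inv c y \<in> fst d"
      using overlap_iff[OF chart[OF assms(1)]] by blast
    then show "H t (chart_inv c y) = H t (chart_inv d (coord_change c d y))"
      using chart_inv_snd[OF chart[OF assms(2)]] by (simp add: coord_change_def)
  qed
  then have "((\<lambda>y. H t (chart_inv c y)) has_derivative (\<lambda>v. dH t d (coord_change c d x) (D c d x v))) (at
      x within img c)"
    unfolding at_within_openin[OF openin_overlap_img[OF assms(1,2)] assms(3)] .
  then show ?thesis
    unfolding dH_def[of t c] using hs_open_frechet_derivative[OF hs_open_img[OF assms(1)] x(1)] by metis
qed

section \<open>The Hamiltonian vector field in charts\<close>

abbreviation X where "X \<equiv> hamiltonian_field \<alpha> H"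

lemma X_dual: "X t c x = dual_vector \<alpha> c x (dH t c x)"
  by (simp add: hamiltonian_field_def dH_def)

lemma ext_deriv_X:
  assumes "c \<in> A" "x \<in> img c"
  shows "ext_deriv \<alpha> c x (X t c x) v = dH t c x v"
  using dual_vector_lip_near(2)[OF smooth_form[OF assms(1)] hs_open_img[OF assms(1)] assms(2) nondeg[OF
      assms] smooth_dH[OF assms(1), of t]]
    assms(2) unfolding X_dual by auto

lemma X_lip_near:
  assumes "c \<in> A" "x \<in> img c"
  shows "lip_near (img c) x (X t c)"
  using dual_vector_lip_near(1)[OF smooth_form[OF assms(1)] hs_open_img[OF assms(1)] assms(2) nondeg[OF
      assms] smooth_dH[OF assms(1), of t]]
  by (simp add: X_dual[abs_def])

text \<open>The push-forward of the field satisfies the equation that determines the field in the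
  other chart.\<close>

lemma X_coord_change:
  assumes "c \<in> A" "d \<in> A" "x \<in> overlap c d"
  shows "X t d (coord_change c d x) = D c d x (X t c x)"
proof -
  have x: "x \<in> img c" "coord_change c d x \<in> img d"
    using assms(3) overlap_subset_img[of c d] overlap_subset_img[of d c] coord_change_image[OF assms(1),
        of d] by auto
  have "ext_deriv \<alpha> d (coord_change c d x) (D c d x (X t c x)) v = dH t d (coord_change c d x) v" for v
  proof -
    obtain u where u: "v = D c d x u" using surj_D[OF assms] by (metis surjD)
    show ?thesis
      unfolding u using ext_deriv_coord_change[OF assms] ext_deriv_X[OF assms(1) x(1)] dH_coord_change[OF
          assms] by metis
  qed
  then show ?thesis
    unfolding X_dual[of t d] using assms(2) by (intro dual_vector_eq smooth_form hs_open_img x nondeg)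
qed

text \<open>The function \<lambda>(X) at time 0, read in an arbitrary chart around \<open>p\<close>.
  On the boundary it equals \<tau> because H vanishes there, and it is the speed of Hamiltonian
  orbits relative to Reeb orbits.\<close>

definition speed where
  "speed p = (let c = (SOME c. c \<in> A \<and> p \<in> fst c) in \<alpha> c (snd c p) (X 0 c (snd c p)))"

lemma speed_eq:
  assumes "c \<in> A" "p \<in> fst c"
  shows "speed p = \<alpha> c (snd c p) (X 0 c (snd c p))"
proof -
  define d where "d = (SOME c. c \<in> A \<and> p \<in> fst c)"
  have d: "d \<in> A" "p \<in> fst d"
    using someI[of "\<lambda>c. c \<in> A \<and> p \<in> fst c"] assms unfolding d_def by blast+
  have x: "snd d p \<in> overlap d c" using d assms by (intro snd_in_overlap)
  have cc: "coord_change d c (snd d p) = snd c p"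
    by (rule coord_change_snd[OF chart[OF d(1)] d(2)])
  have "speed p = \<alpha> d (snd d p) (X 0 d (snd d p))"
    by (simp add: speed_def d_def Let_def)
  also have "\<dots> = \<alpha> c (snd c p) (X 0 c (snd c p))"
    using form_coord_change[OF d(1) assms(1) x] X_coord_change[OF d(1) assms(1) x] cc by (simp add: D_def)
  finally show ?thesis .
qed

lemma continuous_speed: "continuous_on W speed"
  unfolding continuous_on_eq_continuous_within
proof
  fix p assume "p \<in> W"
  then obtain c where c: "c \<in> A" "p \<in> fst c" using W_eq by blast
  have "continuous_on (img c) (\<lambda>y. \<alpha> c y (X 0 c y))"
    unfolding continuous_on_eq_continuous_within
    using smooth_form_apply_lip_near[OF smooth_form[OF c(1)] X_lip_near[OF c(1)]] by (auto intro:
        lip_near_continuous)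
  then have "continuous_on (fst c) (\<lambda>q. \<alpha> c (snd c q) (X 0 c (snd c q)))"
    by (rule continuous_on_compose2[OF _ homeomorphism_cont1[OF is_chart_homeomorphism[OF chart[OF
        c(1)]]]]) (auto simp: img_def)
  then have "continuous_on (fst c) speed"
    by (rule continuous_on_eq) (simp add: speed_eq[OF c(1)])
  moreover have "openin (top_of_set W) (fst c)"
    using chart[OF c(1)] by (simp add: is_chart_def)
  ultimately show "continuous (at p within W) speed"
    using at_within_openin c(2) by (metis continuous_on_eq_continuous_within)
qed

section \<open>The boundary and its conormals\<close>

abbreviation bd where "bd \<equiv> mfd_boundary A"

lemma bd_subset: "bd \<subseteq> W"
  using W_eq by (auto simp: mfd_boundary_def)

text \<open>Membership in \<open>mfd_boundary\<close> provides a normal in some chart only; by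
  \<open>boundary_tangent\<close> every chart around the point sees it as a boundary point. The unit
  length is for \<open>straightening\<close>.\<close>

lemma bd_normal:
  assumes "p \<in> bd" "c \<in> A" "p \<in> fst c"
  obtains \<nu> where "inward_normal c (snd c p) \<nu>" "norm \<nu> = 1"
proof -
  obtain d \<nu>' where d: "d \<in> A" "p \<in> fst d" "inward_normal d (snd d p) \<nu>'"
    using assms(1) unfolding mfd_boundary_def by blast
  obtain \<nu> where \<nu>: "openin (top_of_set (half_space \<nu>)) (img c)"
    using chart[OF assms(2)] by (auto simp: is_chart_def)
  have x: "snd c p \<in> overlap c d" using assms d by (intro snd_in_overlap)
  have T: "openin (top_of_set (half_space \<nu>)) (overlap c d)"
    using openin_trans[OF openin_overlap_img[OF assms(2) d(1)] \<nu>] .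
  have cc: "coord_change c d (snd c p) = snd d p"
    by (rule coord_change_snd[OF chart[OF assms(2)] assms(3)])
  have "coord_change c d ` overlap c d \<subseteq> half_space \<nu>'"
    by (rule order_trans[OF coord_change_image[OF assms(2)] order_trans[OF overlap_subset_img
        inward_normal_subset[OF d(3)]]])
  then have *: "\<nu> \<noteq> 0" "snd c p \<bullet> \<nu> = 0"
    using boundary_tangent[OF T x D_has_derivative[OF assms(2) d(1) x] surj_D[OF assms(2) d(1) x], of \<nu>']
        d(3) cc
    by (auto simp: inward_normal_def)
  define \<mu> where "\<mu> = \<nu> /\<^sub>R norm \<nu>"
  have "half_space \<mu> = half_space \<nu>"
    using * by (auto simp: half_space_def \<mu>_def zero_le_mult_iff)
  then show thesis
    using that[of \<mu>] * \<nu> assms snd_in_img[of p c] by (auto simp: inward_normal_def \<mu>_def)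
qed

lemma inward_normal_imp_bd:
  assumes "c \<in> A" "inward_normal c x \<nu>"
  shows "chart_inv c x \<in> bd"
proof -
  have "x \<in> img c" using assms(2) by (simp add: inward_normal_def)
  then have "chart_inv c x \<in> fst c" "inward_normal c (snd c (chart_inv c x)) \<nu>"
    using assms(2) by (simp_all add: chart_inv_in snd_chart_inv)
  then show ?thesis
    unfolding mfd_boundary_def using assms(1) by blast
qed

lemma bd_hyperplane:
  assumes "p \<in> bd" "c \<in> A" "p \<in> fst c" "openin (top_of_set (half_space \<nu>)) (img c)"
  shows "\<nu> \<noteq> 0 \<and> snd c p \<bullet> \<nu> = 0"
proof -
  obtain \<nu>' where \<nu>': "inward_normal c (snd c p) \<nu>'"
    using bd_normal[OF assms(1-3)] by blast
  show ?thesis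
    using boundary_point_unique[OF assms(4) snd_in_img[OF assms(3)] _ inward_normal_subset[OF \<nu>']] \<nu>'
    by (simp add: inward_normal_def)
qed

text \<open>The complement is relatively open: a chart around a point off the boundary has no
  boundary hyperplane or puts the point off it, and either property persists nearby.\<close>

lemma compact_bd: "compact bd"
proof -
  have "openin (top_of_set W) (W - bd)"
  proof (subst openin_subopen, intro ballI)
    fix p assume p: "p \<in> W - bd"
    then obtain c where c: "c \<in> A" "p \<in> fst c" using W_eq by blast
    obtain \<nu> where \<nu>: "openin (top_of_set (half_space \<nu>)) (img c)"
      using chart[OF c(1)] by (auto simp: is_chart_def)
    have fc: "openin (top_of_set W) (fst c)"
      using chart[OF c(1)] by (simp add: is_chart_def)
    define V where "V = {q \<in> fst c. \<nu> = 0 \<or> snd c q \<bullet> \<nu> \<noteq> 0}"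
    have "openin (top_of_set (fst c)) V"
    proof (cases "\<nu> = 0")
      case True
      then show ?thesis by (simp add: V_def)
    next
      case False
      have "continuous_on (fst c) (\<lambda>q. snd c q \<bullet> \<nu>)"
        by (intro continuous_intros homeomorphism_cont1[OF is_chart_homeomorphism[OF chart[OF c(1)]]])
      then have "openin (top_of_set (fst c)) (fst c \<inter> (\<lambda>q. snd c q \<bullet> \<nu>) -` (- {0}))"
        by (intro continuous_openin_preimage_gen) auto
      moreover have "V = fst c \<inter> (\<lambda>q. snd c q \<bullet> \<nu>) -` (- {0})"
        using False by (auto simp: V_def)
      ultimately show ?thesis by simp
    qed
    then have "openin (top_of_set W) V"
      using fc by (rule openin_trans)
    moreover have "p \<in> V"
    proof (rule ccontr)
      assume "p \<notin> V"
      then have "inward_normal c (snd c p) \<nu>"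
        using c \<nu> snd_in_img[of p c] by (auto simp: V_def inward_normal_def)
      then show False
        using p c unfolding mfd_boundary_def by blast
    qed
    moreover have "V \<subseteq> W - bd"
    proof
      fix q assume "q \<in> V"
      then have "q \<in> fst c" "q \<notin> bd"
        using bd_hyperplane[OF _ c(1) _ \<nu>] by (auto simp: V_def)
      then show "q \<in> W - bd" using c(1) W_eq by blast
    qed
    ultimately show "\<exists>V. openin (top_of_set W) V \<and> p \<in> V \<and> V \<subseteq> W - bd" by blast
  qed
  then have "closedin (top_of_set W) bd"
    using bd_subset by (simp add: closedin_def)
  then show ?thesis
    using compact_W closedin_compact by blast
qed

lemma H_bd: "p \<in> bd \<Longrightarrow> H t p = 0"
  using admissible by (auto simp: admissible_hamiltonians_def)

lemma tau_pos: "c \<in> A \<Longrightarrow> x \<in> img c \<Longrightarrow> 0 < \<alpha> c x (X t c x) + H t (chart_inv c x)"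
  using admissible by (auto simp: admissible_hamiltonians_def)

lemma autonomous_near_bd:
  obtains N where "openin (top_of_set W) N" "bd \<subseteq> N" "\<And>w s t. w \<in> N \<Longrightarrow> H s w = H t w"
proof -
  have "\<exists>N. openin (top_of_set W) N \<and> bd \<subseteq> N \<and> (\<forall>w\<in>N. \<forall>s t. H s w = H t w)"
    using admissible by (auto simp: admissible_hamiltonians_def)
  then obtain N where "openin (top_of_set W) N" "bd \<subseteq> N" "\<forall>w\<in>N. \<forall>s t. H s w = H t w"
    by blast
  then show thesis by (intro that[of N]) blast+
qed

lemma autonomous_in_chart:
  assumes "p \<in> bd" "c \<in> A" "p \<in> fst c"
  shows "\<exists>e>0. \<forall>x\<in>img c \<inter> ball (snd c p) e. \<forall>t. H t (chart_inv c x) = H 0 (chart_inv c x) \<and> X t c x = X 0 c x"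
proof -
  obtain N where N: "openin (top_of_set W) N" "bd \<subseteq> N" "\<And>w s t. w \<in> N \<Longrightarrow> H s w = H t w"
    using autonomous_near_bd by blast
  have "openin (top_of_set (fst c)) (fst c \<inter> N)"
    using openin_Int_subset[OF is_chart_subset[OF chart[OF assms(2)]] N(1)] .
  then have V: "openin (top_of_set (img c)) (snd c ` (fst c \<inter> N))"
    by (rule homeomorphism_imp_open_map[OF is_chart_homeomorphism[OF chart[OF assms(2)]]])
  moreover have "snd c p \<in> snd c ` (fst c \<inter> N)"
    using assms N(2) by blast
  ultimately obtain e where e: "e > 0" "ball (snd c p) e \<inter> img c \<subseteq> snd c ` (fst c \<inter> N)"
    unfolding openin_contains_ball by blast
  have inN: "chart_inv c y \<in> N" if "y \<in> snd c ` (fst c \<inter> N)" for y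
    using that chart_inv_snd[OF chart[OF assms(2)]] by auto
  show ?thesis
  proof (intro exI[of _ e] conjI ballI allI e(1))
    fix x t assume x: "x \<in> img c \<inter> ball (snd c p) e"
    then have xV: "x \<in> snd c ` (fst c \<inter> N)" using e(2) by blast
    show "H t (chart_inv c x) = H 0 (chart_inv c x)"
      using N(3)[OF inN[OF xV]] by blast
    have "dH t c x = dH 0 c x"
      unfolding dH_def
      by (rule frechet_derivative_openin_cong[OF hs_open_img[OF assms(2)] V xV smooth_H[OF assms(2)]
          N(3)[OF inN]])
    then show "X t c x = X 0 c x" by (simp add: X_dual)
  qed
qed

lemma X_autonomous:
  assumes "p \<in> bd" "c \<in> A" "p \<in> fst c"
  shows "X t c (snd c p) = X 0 c (snd c p)"
proof -
  obtain e where "e > 0" "\<forall>x\<in>img c \<inter> ball (snd c p) e. \<forall>t. X t c x = X 0 c x"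
    using autonomous_in_chart[OF assms] by blast
  moreover have "snd c p \<in> img c \<inter> ball (snd c p) e"
    using snd_in_img[OF assms(3)] \<open>e > 0\<close> by simp
  ultimately show ?thesis
    by blast
qed

text \<open>A short segment in a tangent direction consists of boundary points, along which H is
  constantly 0.\<close>

lemma dH_tangent:
  assumes c: "c \<in> A" and \<nu>: "inward_normal c x \<nu>" and v: "v \<bullet> \<nu> = 0"
  shows "dH t c x v = 0"
proof -
  have x: "x \<in> img c" "x \<bullet> \<nu> = 0" using \<nu> by (auto simp: inward_normal_def)
  obtain e where e: "e > 0" "\<And>s. \<bar>s\<bar> < e \<Longrightarrow> x + s *\<^sub>R v \<in> img c"
    using inward_normal_tangent[OF \<nu> v] by blast
  have zero: "H t (chart_inv c (x + s *\<^sub>R v)) = 0" if "\<bar>s\<bar> < e" for s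
  proof -
    have "inward_normal c (x + s *\<^sub>R v) \<nu>"
      using \<nu> e(2)[OF that] x v by (simp add: inward_normal_def inner_add_left)
    then show ?thesis
      using H_bd inward_normal_imp_bd[OF c] by blast
  qed
  have "((\<lambda>s. x + s *\<^sub>R v) has_derivative (\<lambda>s. s *\<^sub>R v)) (at 0 within {-e<..<e})"
    by (auto intro!: derivative_eq_intros)
  moreover have "((\<lambda>y. H t (chart_inv c y)) has_derivative dH t c x) (at (x + 0 *\<^sub>R v) within (\<lambda>s. x + s
      *\<^sub>R v) ` {-e<..<e})"
    using has_derivative_subset[OF dH_has_derivative[OF c x(1)]] e(2) by (auto simp: image_subset_iff
        abs_less_iff)
  ultimately have "((\<lambda>s. H t (chart_inv c (x + s *\<^sub>R v))) has_derivative (\<lambda>s. dH t c x (s *\<^sub>R v))) (at 0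
      within {-e<..<e})"
    by (rule has_derivative_in_compose)
  then have "((\<lambda>s. H t (chart_inv c (x + s *\<^sub>R v))) has_derivative (\<lambda>s. dH t c x (s *\<^sub>R v))) (at 0)"
    using e(1) by (subst (asm) at_within_open) auto
  moreover have "((\<lambda>s. H t (chart_inv c (x + s *\<^sub>R v))) has_derivative (\<lambda>s. 0)) (at 0)"
    by (rule has_derivative_transform_within[OF has_derivative_const[of 0] e(1)]) (auto simp: zero)
  ultimately have "(\<lambda>s. dH t c x (s *\<^sub>R v)) = (\<lambda>s. 0)"
    by (rule has_derivative_unique)
  from fun_cong[OF this, of 1] show ?thesis by simp
qed

text \<open>Everything comes from \<open>ext_deriv_X\<close> and antisymmetry: pairing X with the
  Liouville field fixes the sign of \<open>k\<close>, and pairing X with itself gives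
  \<open>k * (X t c x \<bullet> \<nu>) = 0\<close>. As dH vanishes on tangent vectors, X divided by
  its value under \<open>\<alpha>\<close> is the Reeb vector.\<close>

lemma boundary_X:
  assumes c: "c \<in> A" and \<nu>: "inward_normal c x \<nu>"
  shows "0 < \<alpha> c x (X t c x)" "X t c x \<bullet> \<nu> = 0" "\<exists>k>0. \<forall>v. dH t c x v = k * (v \<bullet> \<nu>)"
    "reeb_vector (\<alpha> c x) (ext_deriv \<alpha> c x) \<nu> (reeb_field \<alpha> c x)"
    "X t c x = \<alpha> c x (X t c x) *\<^sub>R reeb_field \<alpha> c x"
proof -
  have x: "x \<in> img c" and \<nu>0: "\<nu> \<noteq> 0" using \<nu> by (auto simp: inward_normal_def)
  have lin: "linear (ext_deriv \<alpha> c x u)" "linear (\<lambda>u. ext_deriv \<alpha> c x u v)" "linear (\<alpha> c x)" for u v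
    using linear_d1_form_right[OF smooth_form[OF c] hs_open_img[OF c] x] linear_d1_form_left[OF
        smooth_form[OF c] hs_open_img[OF c] x]
      smooth_form[OF c] x by (auto simp: ext_deriv_d1_form smooth_form_in_def)
  show pos: "0 < \<alpha> c x (X t c x)"
    using tau_pos[OF c x, of t] H_bd[OF inward_normal_imp_bd[OF c \<nu>]] by simp
  have dlin: "linear (dH t c x)" using smooth_dH[OF c] x by (simp add: smooth_form_in_def)
  define k where "k = dH t c x \<nu> / (\<nu> \<bullet> \<nu>)"
  have k: "dH t c x v = k * (v \<bullet> \<nu>)" for v
    unfolding k_def by (rule functional_vanishing_on_hyperplane[OF dlin \<nu>0 dH_tangent[OF c \<nu>]])
  define Y where "Y = liouville_field \<alpha> c x"
  have Y: "ext_deriv \<alpha> c x Y v = \<alpha> c x v" for v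
    using dual_vector_lip_near(2)[OF smooth_form[OF c] hs_open_img[OF c] x nondeg[OF c x] smooth_form[OF c]]
      x unfolding Y_def liouville_field_def by auto
  have "k * (Y \<bullet> \<nu>) = ext_deriv \<alpha> c x (X t c x) Y"
    using ext_deriv_X[OF c x] k by simp
  also have "\<dots> = - \<alpha> c x (X t c x)"
    using d1_form_antisym[of "\<alpha> c" "img c" x "X t c x" Y] Y by (simp add: ext_deriv_d1_form)
  finally have "k * (Y \<bullet> \<nu>) < 0" using pos by simp
  then have "k > 0"
    using liouville_outward[OF c \<nu>] by (auto simp: Y_def mult_less_0_iff)
  then show "\<exists>k>0. \<forall>v. dH t c x v = k * (v \<bullet> \<nu>)" using k by blast
  have "k * (X t c x \<bullet> \<nu>) = ext_deriv \<alpha> c x (X t c x) (X t c x)"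
    using ext_deriv_X[OF c x] k by simp
  also have "\<dots> = 0"
    using d1_form_antisym[of "\<alpha> c" "img c" x "X t c x" "X t c x"] by (simp add: ext_deriv_d1_form)
  finally show X\<nu>: "X t c x \<bullet> \<nu> = 0" using \<open>k > 0\<close> by simp
  have r: "reeb_vector (\<alpha> c x) (ext_deriv \<alpha> c x) \<nu> (inverse (\<alpha> c x (X t c x)) *\<^sub>R X t c x)"
    using pos X\<nu> k ext_deriv_X[OF c x]
    by (simp add: reeb_vector_def linear_scale[OF lin(2)] linear_scale[OF lin(3)])
  have eq: "reeb_field \<alpha> c x = inverse (\<alpha> c x (X t c x)) *\<^sub>R X t c x"
    by (rule reeb_field_eq[OF \<nu> smooth_form[OF c] nondeg[OF c x] r])
  show "reeb_vector (\<alpha> c x) (ext_deriv \<alpha> c x) \<nu> (reeb_field \<alpha> c x)"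
    using r eq by simp
  show "X t c x = \<alpha> c x (X t c x) *\<^sub>R reeb_field \<alpha> c x"
    using eq pos by simp
qed

lemma speed_pos:
  assumes "p \<in> bd"
  shows "0 < speed p"
proof -
  obtain c where c: "c \<in> A" "p \<in> fst c" using assms bd_subset W_eq by blast
  obtain \<nu> where "inward_normal c (snd c p) \<nu>"
    using bd_normal[OF assms c] by blast
  then show ?thesis
    using boundary_X(1)[OF c(1)] speed_eq[OF c] by simp
qed

lemma X_speed:
  assumes "p \<in> bd" "c \<in> A" "p \<in> fst c"
  shows "X t c (snd c p) = speed p *\<^sub>R reeb_field \<alpha> c (snd c p)"
proof -
  obtain \<nu> where "inward_normal c (snd c p) \<nu>"
    using bd_normal[OF assms] by blast
  then show ?thesis
    using boundary_X(5)[OF assms(2)] speed_eq[OF assms(2,3)] X_autonomous[OF assms] by metis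
qed

text \<open>Stated for curves in \<open>W\<close>, as in \<open>hamiltonian_time_one\<close>, but at
  boundary points only: near them the field is autonomous, hence Lipschitz uniformly in
  time.\<close>

lemma tame_X:
  assumes "p \<in> bd"
  shows "tame_at A W X p"
proof -
  have "p \<in> W" using assms bd_subset by blast
  then obtain c where c: "c \<in> A" "p \<in> fst c" using W_eq by blast
  obtain e where e: "e > 0" "\<forall>x\<in>img c \<inter> ball (snd c p) e. \<forall>t. X t c x = X 0 c x"
    using autonomous_in_chart[OF assms c] by blast
  show ?thesis
  proof (rule lip_near_imp_tame_at[OF chart[OF c(1)] c(1) subset_refl \<open>p \<in> W\<close> c(2) _ e(1), where Y = "X 0 c"])
    show "lip_near (snd c ` (W \<inter> fst c)) (snd c p) (X 0 c)"
      by (rule lip_near_subset[OF X_lip_near[OF c(1) snd_in_img[OF c(2)]]]) (auto simp: img_def)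
  qed (use e(2) snd_in_img[of _ c] in blast)
qed

lemma tame_reeb:
  assumes "p \<in> bd"
  shows "tame_at A bd (\<lambda>t. reeb_field \<alpha>) p"
proof -
  have "p \<in> W" using assms bd_subset by blast
  then obtain c where c: "c \<in> A" "p \<in> fst c" using W_eq by blast
  obtain \<nu> where \<nu>: "inward_normal c (snd c p) \<nu>"
    using bd_normal[OF assms c] by blast
  show ?thesis
  proof (rule lip_near_imp_tame_at[OF chart[OF c(1)] c(1) bd_subset assms c(2) _ zero_less_one, where Y =
      "reeb_field \<alpha> c"])
    have "lip_near (img c \<inter> {y. y \<bullet> \<nu> = 0}) (snd c p) (reeb_field \<alpha> c)"
      by (rule reeb_field_lip_near[OF \<nu> smooth_form[OF c(1)] nondeg[OF c(1) snd_in_img[OF c(2)]]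
          boundary_X(4)[OF c(1) \<nu>]])
    then show "lip_near (snd c ` (bd \<inter> fst c)) (snd c p) (reeb_field \<alpha> c)"
    proof (rule lip_near_subset)
      show "snd c ` (bd \<inter> fst c) \<subseteq> img c \<inter> {y. y \<bullet> \<nu> = 0}"
        using bd_hyperplane[OF _ c(1)] \<nu> by (auto simp: inward_normal_def img_def)
    qed
  qed simp
qed

section \<open>Complete Reeb orbits and their time change\<close>

definition complete_points where
  "complete_points = {p. \<exists>\<gamma>. integral_curve A bd (\<lambda>t. reeb_field \<alpha>) \<gamma> \<and> \<gamma> 0 = p}"

definition flow where
  "flow p = (SOME \<gamma>. integral_curve A bd (\<lambda>t. reeb_field \<alpha>) \<gamma> \<and> \<gamma> 0 = p)"

lemma flow:
  assumes "p \<in> complete_points"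
  shows "integral_curve A bd (\<lambda>t. reeb_field \<alpha>) (flow p)" "flow p 0 = p" "flow p t \<in> bd"
proof -
  have "\<exists>\<gamma>. integral_curve A bd (\<lambda>t. reeb_field \<alpha>) \<gamma> \<and> \<gamma> 0 = p"
    using assms by (simp add: complete_points_def)
  then have *: "integral_curve A bd (\<lambda>t. reeb_field \<alpha>) (flow p) \<and> flow p 0 = p"
    unfolding flow_def by (rule someI_ex)
  then show "integral_curve A bd (\<lambda>t. reeb_field \<alpha>) (flow p)" "flow p 0 = p"
    by simp_all
  then show "flow p t \<in> bd"
    using integral_curve_in by fast
qed

lemma flow_shift: "p \<in> complete_points \<Longrightarrow> integral_curve A bd (\<lambda>t. reeb_field \<alpha>) (\<lambda>t. flow p (t + b))"
  by (rule integral_curve_shift[OF flow(1)]) simp_all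

text \<open>Invariance of the set, which \<open>h_top_pos_time_change\<close> and the isometric
  embeddings ask for.\<close>

lemma flow_complete:
  assumes "p \<in> complete_points"
  shows "flow p t \<in> complete_points"
proof -
  have "integral_curve A bd (\<lambda>t. reeb_field \<alpha>) (\<lambda>s. flow p (s + t)) \<and> flow p (0 + t) = flow p t"
    using flow_shift[OF assms] by simp
  then show ?thesis
    unfolding complete_points_def by blast
qed

lemma complete_points_subset: "complete_points \<subseteq> bd"
proof
  fix p assume "p \<in> complete_points"
  then show "p \<in> bd"
    using flow(2)[of p] flow(3)[of p 0] by simp
qed

lemma reeb_time_one_flow:
  assumes "p \<in> complete_points"
  shows "reeb_time_one A \<alpha> (flow p t) = flow p (t + 1)"
  using time_one_map_eq[OF compact_bd tame_reeb flow_shift[OF assms, of t]] flow(3)[OF assms]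
  by (simp add: reeb_time_one_def add.commute)

lemma reeb_time_one_power: "p \<in> complete_points \<Longrightarrow> (reeb_time_one A \<alpha> ^^ k) p = flow p (real k)"
  by (induction k) (simp_all add: flow(2) reeb_time_one_flow add.commute)

lemma reeb_entropy_complete_points:
  assumes "0 < h_top bd (reeb_time_one A \<alpha>)"
  shows "0 < h_top complete_points (reeb_time_one A \<alpha>)"
proof -
  have "reeb_time_one A \<alpha> p = (THE q. False)" if "p \<in> bd - complete_points" for p
  proof -
    have "(\<lambda>q. \<exists>\<gamma>. integral_curve A bd (\<lambda>t. reeb_field \<alpha>) \<gamma> \<and> \<gamma> 0 = p \<and> \<gamma> 1 = q) = (\<lambda>q. False)"
      using that by (auto simp: complete_points_def)
    then show ?thesis
      by (simp add: reeb_time_one_def time_one_map_def)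
  qed
  from h_top_pos_remove_constant[where P = complete_points, OF assms compact_bd subset_refl this]
  show ?thesis
    using complete_points_subset by (simp add: inf_absorb2)
qed

lemma speed_bounds:
  assumes "bd \<noteq> {}"
  obtains m M where "0 < m" "\<And>p. p \<in> bd \<Longrightarrow> m \<le> speed p" "\<And>p. p \<in> bd \<Longrightarrow> speed p \<le> M"
proof -
  have c: "continuous_on bd speed"
    using continuous_on_subset[OF continuous_speed bd_subset] .
  obtain p where p: "p \<in> bd" "\<And>q. q \<in> bd \<Longrightarrow> speed p \<le> speed q"
    using continuous_attains_inf[OF compact_bd assms c] by blast
  obtain r where r: "r \<in> bd" "\<And>q. q \<in> bd \<Longrightarrow> speed q \<le> speed r"
    using continuous_attains_sup[OF compact_bd assms c] by blast
  show thesis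
    using speed_pos[OF p(1)] p(2) r(2) by (rule that)
qed

text \<open>\<open>clock p t\<close> is the Reeb time that the Hamiltonian orbit of \<open>p\<close>
  has run through at Hamiltonian time \<open>t\<close>.\<close>

definition clock where
  "clock p = (SOME s. s 0 = 0 \<and> (\<forall>t. (s has_real_derivative speed (flow p (s t))) (at t)))"

lemma clock:
  assumes "p \<in> complete_points"
  shows "clock p 0 = 0" "(clock p has_real_derivative speed (flow p (clock p t))) (at t)"
proof -
  have "bd \<noteq> {}" using assms complete_points_subset by blast
  then obtain m M where m: "0 < m" "\<And>p. p \<in> bd \<Longrightarrow> m \<le> speed p" "\<And>p. p \<in> bd \<Longrightarrow> speed p \<le> M"
    using speed_bounds by blast
  have "continuous_on UNIV (flow p)"
    using flow(1)[OF assms] by (simp add: integral_curve_def)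
  then have "continuous_on UNIV (\<lambda>u. speed (flow p u))"
    using flow(3)[OF assms] bd_subset by (intro continuous_on_compose2[OF continuous_speed]) auto
  then obtain s where "s 0 = 0" "\<And>t. (s has_real_derivative speed (flow p (s t))) (at t)"
    using time_change_exists[of "\<lambda>u. speed (flow p u)" m M] m flow(3)[OF assms] by metis
  then have "\<exists>s. s 0 = 0 \<and> (\<forall>t. (s has_real_derivative speed (flow p (s t))) (at t))"
    by blast
  then have "clock p 0 = 0 \<and> (\<forall>t. (clock p has_real_derivative speed (flow p (clock p t))) (at t))"
    unfolding clock_def by (rule someI_ex)
  then show "clock p 0 = 0" "(clock p has_real_derivative speed (flow p (clock p t))) (at t)"
    by blast+
qed

lemma hamiltonian_curve:
  assumes "p \<in> complete_points"
  shows "integral_curve A W X (\<lambda>t. flow p (clock p t))"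
  unfolding integral_curve_def
proof (intro conjI allI ballI impI)
  show "range (\<lambda>t. flow p (clock p t)) \<subseteq> W"
    using flow(3)[OF assms] bd_subset by blast
  have "continuous_on UNIV (clock p)"
    using clock(2)[OF assms] DERIV_isCont continuous_at_imp_continuous_on by blast
  moreover have "continuous_on UNIV (flow p)"
    using flow(1)[OF assms] by (simp add: integral_curve_def)
  ultimately show "continuous_on UNIV (\<lambda>t. flow p (clock p t))"
    by (intro continuous_on_compose2[of UNIV "flow p" UNIV "clock p"]) auto
  fix t c assume c: "c \<in> A" "flow p (clock p t) \<in> fst c"
  have "((\<lambda>s. snd c (flow p s)) has_vector_derivative reeb_field \<alpha> c (snd c (flow p (clock p t)))) (at
      (clock p t))"
    using flow(1)[OF assms] c by (auto simp: integral_curve_def)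
  from vector_diff_chain_at[OF clock(2)[OF assms, unfolded has_real_derivative_iff_has_vector_derivative]
      this]
  show "((\<lambda>s. snd c (flow p (clock p s))) has_vector_derivative X t c (snd c (flow p (clock p t)))) (at t)"
    unfolding X_speed[OF flow(3)[OF assms] c] by (simp add: o_def)
qed

lemma hamiltonian_curve_shift:
  assumes "p \<in> complete_points"
  shows "integral_curve A W X (\<lambda>t. flow p (clock p (t + b)))"
proof (rule integral_curve_shift[OF hamiltonian_curve[OF assms]])
  fix t c assume c: "c \<in> A" "flow p (clock p t) \<in> fst c"
  show "X t c (snd c (flow p (clock p t))) = X (t - b) c (snd c (flow p (clock p t)))"
    unfolding X_speed[OF flow(3)[OF assms] c] ..
qed

lemma hamiltonian_time_one_power:
  assumes "p \<in> complete_points"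
  shows "(hamiltonian_time_one W A \<alpha> H ^^ k) p = flow p (clock p (real k))"
proof (induction k)
  case 0
  then show ?case using flow(2)[OF assms] clock(1)[OF assms] by simp
next
  case (Suc k)
  have "hamiltonian_time_one W A \<alpha> H (flow p (clock p (real k))) = flow p (clock p (1 + real k))"
    using time_one_map_eq[OF compact_bd tame_X hamiltonian_curve_shift[OF assms, of "real k"]] flow(3)[OF
        assms]
    by (simp add: hamiltonian_time_one_def)
  with Suc show ?case by simp
qed

text \<open>The time change takes place on \<open>complete_points\<close>, where the iterates of
  both time-one maps are explicit along \<open>flow\<close>. Slowness comes from tameness of the
  Reeb field on the boundary, equicontinuity of Hamiltonian orbits from tameness of X in
  \<open>W\<close>.\<close>

lemma hamiltonian_entropy:
  assumes "0 < h_top bd (reeb_time_one A \<alpha>)"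
  shows "0 < h_top W (hamiltonian_time_one W A \<alpha> H)"
proof -
  have pos: "0 < h_top complete_points (reeb_time_one A \<alpha>)"
    using reeb_entropy_complete_points[OF assms] .
  show ?thesis
  proof (cases "complete_points = {}")
    case True
    \<comment> \<open>Only the empty set is available as a separated set, and its cardinality 0 lies
      below every exponential.\<close>
    have "\<not> 0 < h_top ({} :: 'a set) (reeb_time_one A \<alpha>)"
      unfolding h_top_pos_iff by (auto simp: not_le intro!: exI[of _ 0])
    then show ?thesis using pos True by simp
  next
    case False
    then have "bd \<noteq> {}" using complete_points_subset by blast
    then obtain m M where m: "0 < m" "\<And>p. p \<in> bd \<Longrightarrow> m \<le> speed p" "\<And>p. p \<in> bd \<Longrightarrow> speed p \<le> M"
      using speed_bounds by blast
    have cP: "complete_points \<subseteq> bd" by (rule complete_points_subset)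
    have "0 < h_top complete_points (hamiltonian_time_one W A \<alpha> H)"
    proof (rule h_top_pos_time_change[where P = complete_points and m = m and f = speed and \<phi> = "\<lambda>t p.
        flow p t" and s = clock
          and F = "reeb_time_one A \<alpha>", OF m(1)])
      show "m \<le> speed p" if "p \<in> complete_points" for p
        using m(2) cP that by blast
      show "uniformly_continuous_on complete_points speed"
        using compact_uniformly_continuous[OF continuous_on_subset[OF continuous_speed bd_subset]
            compact_bd] cP
        unfolding uniformly_continuous_on_def by (meson subsetD)
      show "0 \<le> clock p t" if p: "p \<in> complete_points" and t: "t \<ge> 0" for p t
      proof -
        have "clock p 0 \<le> clock p t"
        proof (rule DERIV_nonneg_imp_nondecreasing[OF t, of "clock p"])
          fix u
          show "\<exists>y. (clock p has_real_derivative y) (at u) \<and> 0 \<le> y"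
            using clock(2)[OF p] speed_pos[OF flow(3)[OF p]] less_imp_le by blast
        qed
        then show ?thesis using clock(1)[OF p] by simp
      qed
      show "\<exists>\<delta>>0. \<forall>p\<in>complete_points. \<forall>u\<ge>0. \<forall>w\<ge>0. \<bar>u - w\<bar> < \<delta> \<longrightarrow> dist (flow p u) (flow p w) < \<epsilon>"
        if \<epsilon>: "\<epsilon> > 0" for \<epsilon>
      proof -
        obtain \<delta> where \<delta>: "\<delta> > 0" "\<And>\<gamma> a t. integral_curve A bd (\<lambda>t. reeb_field \<alpha>) \<gamma> \<Longrightarrow> \<gamma> a \<in> bd \<Longrightarrow>
            t \<in> {a..a + \<delta>} \<Longrightarrow> dist (\<gamma> t) (\<gamma> a) < \<epsilon>"
          using tame_at_uniform[OF compact_bd tame_reeb] \<epsilon> by metis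
        have *: "dist (flow p w) (flow p u) < \<epsilon>" if "p \<in> complete_points" "\<bar>u - w\<bar> < \<delta>" "u \<le> w" for p u w
          using that by (intro \<delta>(2) flow) auto
        have "dist (flow p u) (flow p w) < \<epsilon>" if "p \<in> complete_points" "\<bar>u - w\<bar> < \<delta>" for p u w
          using *[of p u w] *[of p w u] that by (cases "u \<le> w") (auto simp: dist_commute abs_minus_commute)
        then show ?thesis using \<delta>(1) by blast
      qed
      show "\<exists>\<delta>>0. \<forall>p\<in>complete_points. \<forall>q\<in>complete_points. \<forall>k::nat.
          dist (flow p (clock p (real k))) (flow q (clock q (real k))) < \<delta> \<longrightarrow>
          (\<forall>t\<in>{real k..real k + 1}. dist (flow p (clock p t)) (flow q (clock q t)) < \<epsilon>)"
        if \<epsilon>: "\<epsilon> > 0" for \<epsilon>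
      proof -
        \<comment> \<open>One \<open>\<delta>\<close> serves all starting times \<open>a\<close>, in
          particular all integers \<open>k\<close>.\<close>
        obtain \<delta> where \<delta>: "\<delta> > 0" "\<forall>\<gamma> \<gamma>' a. integral_curve A W X \<gamma> \<longrightarrow> integral_curve A W X \<gamma>' \<longrightarrow>
           (\<forall>t\<ge>a. \<gamma> t \<in> bd) \<longrightarrow> dist (\<gamma> a) (\<gamma>' a) < \<delta> \<longrightarrow> (\<forall>t\<in>{a..a + 1}. dist (\<gamma> t) (\<gamma>' t) < \<epsilon>)"
          using integral_curves_close[OF compact_bd tame_X \<epsilon>, of 1] by blast
        show ?thesis
        proof (intro exI[of _ \<delta>] conjI ballI allI impI \<delta>(1))
          fix p q :: 'a and k :: nat and t
          assume p: "p \<in> complete_points" and q: "q \<in> complete_points"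
            and d: "dist (flow p (clock p (real k))) (flow q (clock q (real k))) < \<delta>" and t: "t \<in> {real
                k..real k + 1}"
          show "dist (flow p (clock p t)) (flow q (clock q t)) < \<epsilon>"
            using \<delta>(2)[rule_format, OF hamiltonian_curve[OF p] hamiltonian_curve[OF q] flow(3)[OF p] d t] .
        qed
      qed
    qed (use pos flow_complete clock reeb_time_one_power hamiltonian_time_one_power in auto)
    then show ?thesis
    proof (rule h_top_pos_isometric_embedding[where i = "\<lambda>p. p"])
      show "(\<lambda>p. p) ` complete_points \<subseteq> W"
        using cP bd_subset by blast
      show "hamiltonian_time_one W A \<alpha> H p \<in> complete_points" if "p \<in> complete_points" for p
        using hamiltonian_time_one_power[OF that, of 1] flow_complete[OF that] by simp
    qed auto
  qed
qed

end

section \<open>Codimension 0 submanifolds\<close>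

text \<open>An ambient atlas with a form whose differential is nondegenerate, and a subset
  \<open>S\<close>. Charts in \<open>sub_atlas B S\<close> are by definition compatible with those
  of \<open>B\<close> only, so two of them are compared through a chart of \<open>B\<close>.\<close>

locale form_atlas =
  fixes M :: "'a::metric_space set" and B :: "('a, 'e::euclidean_space) chart set"
    and \<beta> :: "('a, 'e) one_form" and S :: "'a set"
  assumes chart_B: "b \<in> B \<Longrightarrow> is_chart M b"
    and cover_B: "M \<subseteq> (\<Union>b\<in>B. fst b)"
    and smooth_B: "b \<in> B \<Longrightarrow> b' \<in> B \<Longrightarrow> smooth_in (overlap b b') (coord_change b b')"
    and form_B: "b \<in> B \<Longrightarrow> smooth_form_in (\<beta> b) (img b)"
    and form_change_B: "b \<in> B \<Longrightarrow> b' \<in> B \<Longrightarrow> x \<in> overlap b b' \<Longrightarrow> \<beta> b x v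
      = \<beta> b' (coord_change b b' x) (frechet_derivative (coord_change b b') (at x within overlap b b') v)"
    and nondeg_B: "b \<in> B \<Longrightarrow> x \<in> img b \<Longrightarrow> nondegenerate (ext_deriv \<beta> b x)"
    and sub: "S \<subseteq> M"
begin

abbreviation SA where "SA \<equiv> sub_atlas B S"
abbreviation SF where "SF \<equiv> sub_form B \<beta>"

lemma chart_SA: "d \<in> SA \<Longrightarrow> is_chart S d"
  by (simp add: sub_atlas_def)

lemma smooth_SA:
  assumes "d \<in> SA" "b \<in> B"
  shows "smooth_in (overlap d b) (coord_change d b)" "smooth_in (overlap b d) (coord_change b d)"
  using assms by (auto simp: sub_atlas_def compatible_def)

lemma openin_overlap_SA:
  assumes "d \<in> SA" "b \<in> B"
  shows "openin (top_of_set (img d)) (overlap d b)"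
proof -
  have "fst d \<subseteq> M"
    using is_chart_subset[OF chart_SA[OF assms(1)]] sub by blast
  moreover have "openin (top_of_set M) (fst b)"
    using chart_B[OF assms(2)] by (simp add: is_chart_def)
  ultimately have "openin (top_of_set (fst d)) (fst d \<inter> fst b)"
    by (rule openin_Int_subset)
  then show ?thesis
    by (rule openin_overlap[OF chart_SA[OF assms(1)]])
qed

lemma hs_open_SA: "d \<in> SA \<Longrightarrow> hs_open (img d)"
  by (rule is_chart_hs_open[OF chart_SA])

lemma hs_open_overlap_SA: "d \<in> SA \<Longrightarrow> b \<in> B \<Longrightarrow> hs_open (overlap d b)"
  by (rule hs_open_openin[OF hs_open_SA openin_overlap_SA])

lemma coord_change_image_SA: "d \<in> SA \<Longrightarrow> coord_change d b ` overlap d b \<subseteq> overlap b d"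
  using coord_change_in_overlap[OF chart_SA] by blast

lemma SA_cover:
  assumes "d \<in> SA" "y \<in> img d"
  obtains b where "b \<in> B" "y \<in> overlap d b"
proof -
  have "chart_inv d y \<in> M"
    using chart_inv_in[OF assms(2)] is_chart_subset[OF chart_SA[OF assms(1)]] sub by blast
  then obtain b where "b \<in> B" "chart_inv d y \<in> fst b"
    using cover_B by blast
  then show thesis
    using that overlap_iff[OF chart_SA[OF assms(1)]] assms(2) by blast
qed

definition E where
  "E d b y = frechet_derivative (coord_change d b) (at y within overlap d b)"

lemma E_has_derivative:
  "d \<in> SA \<Longrightarrow> b \<in> B \<Longrightarrow> y \<in> overlap d b \<Longrightarrow> (coord_change d b has_derivative E d b y) (at y within overlap d b)"
  unfolding E_def by (rule smooth_in_has_derivative[OF smooth_SA(1)])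

lemma E_inverse:
  assumes "d \<in> SA" "b \<in> B" "y \<in> overlap d b"
  shows "E b d (coord_change d b y) (E d b y v) = v"
    and "(coord_change b d has_derivative E b d (coord_change d b y)) (at (coord_change d b y) within
        overlap b d)"
proof -
  show *: "(coord_change b d has_derivative E b d (coord_change d b y)) (at (coord_change d b y) within
      overlap b d)"
    unfolding E_def
    by (rule smooth_in_has_derivative[OF smooth_SA(2)[OF assms(1,2)] coord_change_in_overlap[OF
        chart_SA[OF assms(1)] assms(3)]])
  show "E b d (coord_change d b y) (E d b y v) = v"
  proof (rule left_inverse_derivative[OF hs_open_overlap_SA[OF assms(1,2)] assms(3) E_has_derivative[OF
      assms] *])
    show "coord_change d b ` overlap d b \<subseteq> overlap b d"
      using coord_change_image_SA[OF assms(1)] .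
    show "coord_change b d (coord_change d b x) = x" if "x \<in> overlap d b" for x
      by (rule coord_change_inverse[OF chart_SA[OF assms(1)] chart_B[OF assms(2)] that])
  qed
qed

lemma surj_E:
  assumes "d \<in> SA" "b \<in> B" "y \<in> overlap d b"
  shows "surj (E d b y)" "E d b y (E b d (coord_change d b y) w) = w"
  using linear_left_inverse_bij[OF has_derivative_linear[OF E_has_derivative[OF assms]] E_inverse(1)[OF
      assms]] by auto

text \<open>Independence of the chart chosen by \<open>SOME\<close>: the chain rule on the common
  part \<open>V\<close> of two overlaps, combined with the transformation rule of
  \<open>\<beta>\<close>.\<close>

lemma sub_form_eq:
  assumes "d \<in> SA" "b \<in> B" "y \<in> overlap d b"
  shows "SF d y v = \<beta> b (coord_change d b y) (E d b y v)"
proof -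
  define a where "a = (SOME c. c \<in> B \<and> chart_inv d y \<in> fst c)"
  have y: "y \<in> img d" "chart_inv d y \<in> fst b"
    using assms(3) overlap_iff[OF chart_SA[OF assms(1)]] by auto
  have "a \<in> B \<and> chart_inv d y \<in> fst a"
    unfolding a_def using assms(2) y(2) by (rule someI[of "\<lambda>c. c \<in> B \<and> chart_inv d y \<in> fst c", OF conjI])
  then have a: "a \<in> B" "chart_inv d y \<in> fst a" by auto
  then have ya: "y \<in> overlap d a"
    using y(1) overlap_iff[OF chart_SA[OF assms(1)]] by auto
  have x: "coord_change d a y \<in> overlap a b"
    using a(2) y(2) by (auto simp: coord_change_def overlap_def)
  have cc: "coord_change d b y' = coord_change a b (coord_change d a y')" if "y' \<in> overlap d a" for y'
    using that overlap_iff[OF chart_SA[OF assms(1)]] chart_inv_snd[OF chart_B[OF a(1)]] by (simp add: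
        coord_change_def)
  define V where "V = overlap d a \<inter> overlap d b"
  have V: "openin (top_of_set (overlap d a)) V" "openin (top_of_set (overlap d b)) V" "y \<in> V"
  proof -
    have oa: "openin (top_of_set (img d)) (overlap d a)" and ob: "openin (top_of_set (img d)) (overlap d b)"
      using openin_overlap_SA assms a by auto
    show "openin (top_of_set (overlap d a)) V"
      unfolding V_def using openin_Int_subset[OF openin_imp_subset[OF oa] ob] .
    show "openin (top_of_set (overlap d b)) V"
      unfolding V_def using openin_Int_subset[OF openin_imp_subset[OF ob] oa] by (simp add: Int_commute)
    show "y \<in> V" using ya assms(3) by (simp add: V_def)
  qed
  define K where "K = frechet_derivative (coord_change a b) (at (coord_change d a y) within overlap a b)"
  have K: "(coord_change a b has_derivative K) (at (coord_change d a y) within overlap a b)"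
    unfolding K_def by (rule smooth_in_has_derivative[OF smooth_B[OF a(1) assms(2)] x])
  have "coord_change d a ` V \<subseteq> overlap a b"
    by (auto simp: V_def coord_change_def overlap_def[of a b] overlap_iff[OF chart_SA[OF assms(1)]])
  note image = this
  have der: "(coord_change d a has_derivative E d a y) (at y within V)"
    using E_has_derivative[OF assms(1) a(1) ya] unfolding at_within_openin[OF V(1,3)] .
  have "((\<lambda>y. coord_change a b (coord_change d a y)) has_derivative (\<lambda>v. K (E d a y v))) (at y within V)"
    by (rule has_derivative_in_compose[OF der has_derivative_subset[OF K image]])
  then have "(coord_change d b has_derivative (\<lambda>v. K (E d a y v))) (at y within V)"
    by (rule has_derivative_transform[OF V(3), rotated]) (simp add: cc V_def)
  then have "E d b y = (\<lambda>v. K (E d a y v))"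
    unfolding E_def[of d b] at_within_openin[OF V(2,3)]
    by (rule hs_open_frechet_derivative[OF hs_open_overlap_SA[OF assms(1,2)] assms(3)])
  moreover have "SF d y v = \<beta> a (coord_change d a y) (E d a y v)"
    by (simp add: sub_form_def a_def E_def Let_def)
  ultimately show ?thesis
    using form_change_B[OF a(1) assms(2) x, of "E d a y v"] cc[OF ya] by (simp add: K_def)
qed

lemma coord_change_img_B:
  assumes "d \<in> SA"
  shows "coord_change d b ` overlap d b \<subseteq> img b"
  by (rule order_trans[OF coord_change_image_SA[OF assms] overlap_subset_img])

lemma smooth_sub_form:
  assumes "d \<in> SA"
  shows "smooth_form_in (SF d) (img d)"
proof -
  have loc: "smooth_form_in (SF d) (overlap d b)" if b: "b \<in> B" for b
    by (rule smooth_form_in_pullback[OF hs_open_overlap_SA[OF assms b] smooth_SA(1)[OF assms b]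
        coord_change_img_B[OF assms] form_B[OF b]])
      (simp add: sub_form_eq[OF assms b] E_def)
  show ?thesis
    unfolding smooth_form_in_def
  proof (intro conjI ballI allI)
    fix y assume "y \<in> img d"
    then obtain b where b: "b \<in> B" "y \<in> overlap d b" by (rule SA_cover[OF assms])
    then show "linear (SF d y)" using loc[OF b(1)] by (simp add: smooth_form_in_def)
  next
    fix v
    show "smooth_in (img d) (\<lambda>y. SF d y v)"
    proof (rule smooth_in_local)
      fix y assume "y \<in> img d"
      then obtain b where b: "b \<in> B" "y \<in> overlap d b" by (rule SA_cover[OF assms])
      obtain V where "open V" "overlap d b = img d \<inter> V"
        using openin_overlap_SA[OF assms b(1)] by (auto simp: openin_open)
      then show "\<exists>V. open V \<and> y \<in> V \<and> smooth_in (img d \<inter> V) (\<lambda>y. SF d y v)"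
        using loc[OF b(1)] b(2) by (intro exI[of _ V]) (auto simp: smooth_form_in_def)
    qed
  qed
qed

lemma ext_deriv_sub_form:
  assumes "d \<in> SA" "b \<in> B" "y \<in> overlap d b"
  shows "ext_deriv SF d y u v = ext_deriv \<beta> b (coord_change d b y) (E d b y u) (E d b y v)"
proof -
  have "SF d z w = \<beta> b (coord_change d b z) (frechet_derivative (coord_change d b) (at z within overlap d
      b) w)"
    if "z \<in> overlap d b" for z w
    using sub_form_eq[OF assms(1,2) that] by (simp add: E_def)
  from d1_form_pullback[OF hs_open_overlap_SA[OF assms(1,2)] is_chart_hs_open[OF chart_B[OF assms(2)]]
      smooth_SA(1)[OF assms(1,2)]
      coord_change_img_B[OF assms(1)] form_B[OF assms(2)] this assms(3)]
  show ?thesis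
    by (simp add: ext_deriv_d1_form E_def d1_form_openin[OF openin_overlap_SA[OF assms(1,2)] assms(3)])
qed

lemma nondeg_sub_form:
  assumes "d \<in> SA" "y \<in> img d"
  shows "nondegenerate (ext_deriv SF d y)"
  unfolding nondegenerate_def
proof (intro allI impI)
  fix u assume u: "\<forall>v. ext_deriv SF d y u v = 0"
  obtain b where b: "b \<in> B" "y \<in> overlap d b" using SA_cover[OF assms] .
  have "ext_deriv \<beta> b (coord_change d b y) (E d b y u) w = 0" for w
    using u ext_deriv_sub_form[OF assms(1) b, of u] surj_E(2)[OF assms(1) b, of w] by metis
  moreover have "coord_change d b y \<in> img b"
    using coord_change_img_B[OF assms(1)] b(2) by blast
  ultimately have "E d b y u = 0"
    using nondeg_B[OF b(1)] unfolding nondegenerate_def by blast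
  then show "u = 0"
    using E_inverse(1)[OF assms(1) b, of u] linear_0[OF has_derivative_linear[OF E_inverse(2)[OF assms(1)
        b]]] by simp
qed

text \<open>The two charts of \<open>S\<close> are compared where a chart \<open>b\<close> of
  \<open>B\<close> is defined as well. There the coordinate change is a composite through
  \<open>b\<close>, hence smooth with smooth inverse, and \<open>boundary_tangent\<close>
  applies.\<close>

lemma SA_boundary:
  assumes d: "d \<in> SA" "d' \<in> SA" "q \<in> fst d" "q \<in> fst d'" and \<nu>': "inward_normal d' (snd d' q) \<nu>'"
    and \<nu>: "openin (top_of_set (half_space \<nu>)) (img d)"
  shows "\<nu> \<noteq> 0 \<and> snd d q \<bullet> \<nu> = 0"
proof -
  have "q \<in> M" using is_chart_subset[OF chart_SA[OF d(1)]] sub d(3) by blast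
  then obtain b where b: "b \<in> B" "q \<in> fst b" using cover_B by blast
  define T where "T = overlap d b \<inter> overlap d d'"
  define Q where "Q = overlap d' b \<inter> overlap d' d"
  have T: "y \<in> T \<longleftrightarrow> y \<in> img d \<and> chart_inv d y \<in> fst b \<and> chart_inv d y \<in> fst d'" for y
    using overlap_iff[OF chart_SA[OF d(1)]] by (auto simp: T_def)
  have Q: "y \<in> Q \<longleftrightarrow> y \<in> img d' \<and> chart_inv d' y \<in> fst b \<and> chart_inv d' y \<in> fst d" for y
    using overlap_iff[OF chart_SA[OF d(2)]] by (auto simp: Q_def)
  have TQ: "coord_change d d' ` T \<subseteq> Q"
    using snd_in_img[of _ d'] chart_inv_in[of _ d] chart_inv_snd[OF chart_SA[OF d(2)]] by (auto simp: T Q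
        coord_change_def)
  have oT: "openin (top_of_set (img d)) T"
    unfolding T_def using openin_overlap_SA[OF d(1) b(1)] openin_overlap[OF chart_SA[OF d(1)]
        openin_chart_Int[OF chart_SA[OF d(1)] chart_SA[OF d(2)]]]
    by (rule openin_Int)
  have hT: "hs_open T" by (rule hs_open_openin[OF hs_open_SA[OF d(1)] oT])
  have xT: "snd d q \<in> T"
    using d b snd_in_overlap[of q d b] snd_in_overlap[of q d d'] by (auto simp: T_def)
  have trans: "smooth_in T' (coord_change e e')" if e: "e \<in> SA" "e' \<in> SA" and T': "T' = overlap e b \<inter>
      overlap e e'" for e e' T'
  proof -
    have T'': "y \<in> T' \<longleftrightarrow> y \<in> img e \<and> chart_inv e y \<in> fst b \<and> chart_inv e y \<in> fst e'" for y
      using overlap_iff[OF chart_SA[OF e(1)]] by (auto simp: T')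
    have "smooth_in T' (\<lambda>y. coord_change b e' (coord_change e b y))"
    proof (rule smooth_in_compose[OF smooth_in_subset[OF smooth_SA(1)[OF e(1) b(1)]] smooth_SA(2)[OF e(2)
        b(1)]])
      show "coord_change e b ` T' \<subseteq> overlap b e'"
        by (auto simp: T'' coord_change_def overlap_def)
    qed (simp add: T')
    then show ?thesis
      by (rule smooth_in_cong) (simp add: T'' coord_change_def chart_inv_snd[OF chart_B[OF b(1)]])
  qed
  have sT: "smooth_in T (coord_change d d')" and sQ: "smooth_in Q (coord_change d' d)"
    using trans d T_def Q_def by blast+
  define D where "D = frechet_derivative (coord_change d d') (at (snd d q) within T)"
  have D: "(coord_change d d' has_derivative D) (at (snd d q) within T)"
    unfolding D_def by (rule smooth_in_has_derivative[OF sT xT])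
  have yQ: "coord_change d d' (snd d q) \<in> Q" using TQ xT by blast
  have "frechet_derivative (coord_change d' d) (at (coord_change d d' (snd d q)) within Q) (D v) = v" for v
  proof (rule left_inverse_derivative[OF hT xT D smooth_in_has_derivative[OF sQ yQ] TQ])
    show "coord_change d' d (coord_change d d' y) = y" if "y \<in> T" for y
      using that by (intro coord_change_inverse[OF chart_SA[OF d(1)] chart_SA[OF d(2)]]) (simp add: T_def)
  qed
  then have "surj D"
    using linear_left_inverse_bij(1)[OF has_derivative_linear[OF D]] by blast
  moreover have "coord_change d d' ` T \<subseteq> half_space \<nu>'"
  proof -
    have "coord_change d d' ` T \<subseteq> img d'" using TQ by (auto simp: Q)
    then show ?thesis using inward_normal_subset[OF \<nu>'] by blast
  qed
  moreover have "coord_change d d' (snd d q) = snd d' q"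
    by (rule coord_change_snd[OF chart_SA[OF d(1)] d(3)])
  ultimately show ?thesis
    using boundary_tangent[OF openin_trans[OF oT \<nu>] xT D, of \<nu>'] \<nu>' by (auto simp: inward_normal_def)
qed

text \<open>\<open>q\<close> is a boundary point of the ambient manifold \<open>M\<close>, with conormal \<open>\<mu>\<close>, that lies in \<open>S\<close>; for the
  tube this is the binding \<open>\<partial>W \<times> {0}\<close>.\<close>

lemma sub_form_reeb:
  assumes d: "d \<in> SA" "q \<in> fst d" and b: "b \<in> B" "q \<in> fst b"
    and \<mu>: "\<mu> \<noteq> 0" "img b \<subseteq> half_space \<mu>" "snd b q \<bullet> \<mu> = 0"
    and r: "reeb_vector (\<beta> b (snd b q)) (ext_deriv \<beta> b (snd b q)) \<mu> r"
  obtains \<nu> where "inward_normal d (snd d q) \<nu>"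
    "reeb_vector (SF d (snd d q)) (ext_deriv SF d (snd d q)) \<nu> (E b d (snd b q) r)"
    "reeb_field SF d (snd d q) = E b d (snd b q) r"
proof -
  define y where "y = snd d q"
  have y: "y \<in> overlap d b" "y \<in> img d" "coord_change d b y = snd b q"
    using d b snd_in_overlap[of q d b] snd_in_img[of q d] coord_change_snd[OF chart_SA[OF d(1)] d(2)] by
        (auto simp: y_def)
  note db = d(1) b(1) y(1)
  obtain \<nu> where \<nu>: "openin (top_of_set (half_space \<nu>)) (img d)"
    using chart_SA[OF d(1)] by (auto simp: is_chart_def)
  have "coord_change d b ` overlap d b \<subseteq> half_space \<mu>"
    using coord_change_img_B[OF d(1)] \<mu>(2) by blast
  \<comment> \<open>Applied to the coordinate change into the ambient chart: \<open>q\<close> is a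
    boundary point of \<open>S\<close> because it is one of the ambient manifold, and tangent
    vectors of the one boundary go to tangent vectors of the other.\<close>
  then have tan: "\<nu> \<noteq> 0" "y \<bullet> \<nu> = 0" "\<And>v. v \<bullet> \<nu> = 0 \<Longrightarrow> E d b y v \<bullet> \<mu> = 0"
    using boundary_tangent[OF openin_trans[OF openin_overlap_SA[OF d(1) b(1)] \<nu>] y(1) E_has_derivative[OF
        db] surj_E(1)[OF db], of \<mu>] \<mu> y(3)
    by auto
  have in\<nu>: "inward_normal d y \<nu>"
    using tan \<nu> y(2) by (simp add: inward_normal_def)
  define R where "R = E b d (snd b q) r"
  have ER: "E d b y R = r"
    using surj_E(2)[OF db, of r] y(3) by (simp add: R_def)
  have lin: "linear (\<lambda>v. E d b y v \<bullet> \<mu>)"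
    using linear_compose[OF has_derivative_linear[OF E_has_derivative[OF db]] bounded_linear.linear[OF
        bounded_linear_inner_left]]
    by (simp add: o_def)
  \<comment> \<open>The conormal \<open>\<mu>\<close> pulls back to \<open>k\<close> times
    \<open>\<nu>\<close>; as \<open>k \<noteq> 0\<close>, tangency of \<open>R\<close> can be tested
    after applying \<open>E d b y\<close>.\<close>
  define k where "k = E d b y \<nu> \<bullet> \<mu> / (\<nu> \<bullet> \<nu>)"
  have k: "E d b y v \<bullet> \<mu> = k * (v \<bullet> \<nu>)" for v
    unfolding k_def by (rule functional_vanishing_on_hyperplane[OF lin tan(1) tan(3)])
  have "k \<noteq> 0"
  proof
    assume "k = 0"
    moreover obtain v where "E d b y v = \<mu>" using surj_E(1)[OF db] by (metis surjD)
    ultimately show False using k[of v] \<mu>(1) by simp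
  qed
  then have R\<nu>: "R \<bullet> \<nu> = 0"
    using k[of R] ER r by (simp add: reeb_vector_def)
  have rv: "reeb_vector (SF d y) (ext_deriv SF d y) \<nu> R"
    unfolding reeb_vector_def sub_form_eq[OF db] ext_deriv_sub_form[OF db] ER y(3)
    using r R\<nu> tan(3) by (simp add: reeb_vector_def)
  have "reeb_field SF d y = R"
    by (rule reeb_field_eq[OF in\<nu> smooth_sub_form[OF d(1)] nondeg_sub_form[OF d(1) y(2)] rv])
  then show thesis
    using in\<nu> rv that unfolding y_def R_def by blast
qed

lemma sub_form_tame:
  assumes d: "d \<in> SA" "q \<in> fst d" and b: "b \<in> B" "q \<in> fst b"
    and \<mu>: "\<mu> \<noteq> 0" "img b \<subseteq> half_space \<mu>" "snd b q \<bullet> \<mu> = 0"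
    and r: "reeb_vector (\<beta> b (snd b q)) (ext_deriv \<beta> b (snd b q)) \<mu> r"
  shows "tame_at SA (mfd_boundary SA) (\<lambda>t. reeb_field SF) q"
proof -
  obtain \<nu> where \<nu>: "inward_normal d (snd d q) \<nu>"
    "reeb_vector (SF d (snd d q)) (ext_deriv SF d (snd d q)) \<nu> (E b d (snd b q) r)"
    "reeb_field SF d (snd d q) = E b d (snd b q) r"
    using sub_form_reeb[OF assms] .
  have qb: "q \<in> mfd_boundary SA"
    unfolding mfd_boundary_def using d \<nu>(1) by blast
  have bS: "mfd_boundary SA \<subseteq> S"
    using is_chart_subset[OF chart_SA] by (auto simp: mfd_boundary_def)
  show ?thesis
  proof (rule lip_near_imp_tame_at[OF chart_SA[OF d(1)] d(1) bS qb d(2) _ zero_less_one, where Y =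
      "reeb_field SF d"])
    have "lip_near (img d \<inter> {y. y \<bullet> \<nu> = 0}) (snd d q) (reeb_field SF d)"
      by (rule reeb_field_lip_near[OF \<nu>(1) smooth_sub_form[OF d(1)] nondeg_sub_form[OF d(1) snd_in_img[OF
          d(2)]] \<nu>(2)])
    then show "lip_near (snd d ` (mfd_boundary SA \<inter> fst d)) (snd d q) (reeb_field SF d)"
    proof (rule lip_near_subset)
      show "snd d ` (mfd_boundary SA \<inter> fst d) \<subseteq> img d \<inter> {y. y \<bullet> \<nu> = 0}"
      proof
        fix y assume "y \<in> snd d ` (mfd_boundary SA \<inter> fst d)"
        then obtain p where p: "p \<in> mfd_boundary SA" "p \<in> fst d" "y = snd d p" by blast
        then obtain d' \<nu>' where "d' \<in> SA" "p \<in> fst d'" "inward_normal d' (snd d' p) \<nu>'"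
          unfolding mfd_boundary_def by blast
        then have "snd d p \<bullet> \<nu> = 0"
          using SA_boundary[OF d(1) _ p(2), of d' \<nu>' \<nu>] \<nu>(1) by (simp add: inward_normal_def)
        then show "y \<in> img d \<inter> {y. y \<bullet> \<nu> = 0}"
          using p snd_in_img[of p d] by auto
      qed
    qed
  qed simp
qed

end

section \<open>The product with the complex plane\<close>

lemma fst_prod_chart: "fst (prod_chart c) = fst c \<times> UNIV"
  and snd_prod_chart: "snd (prod_chart c) p = (snd c (fst p), snd p)"
  by (auto simp: prod_chart_def split: prod.split)

lemma img_prod_chart: "img (prod_chart c) = img c \<times> UNIV"
proof -
  have "snd (prod_chart c) ` (fst c \<times> UNIV) = snd c ` fst c \<times> UNIV"
    by (force simp: snd_prod_chart image_iff)
  then show ?thesis by (simp add: img_def fst_prod_chart)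
qed

lemma inv_prod_chart: "inv prod_chart (prod_chart c) = c"
  by (rule inv_f_f[OF inj_prod_chart])

lemma prod_form_prod_chart:
  "prod_form \<alpha> (prod_chart c) x v
    = \<alpha> c (fst x) (fst v) + (Re (snd x) * Im (snd v) - Im (snd x) * Re (snd v)) / 2"
  by (simp add: prod_form_def inv_prod_chart split: prod.split)

lemma openin_Times_UNIV:
  "openin (top_of_set S) T \<Longrightarrow> openin (top_of_set (S \<times> UNIV)) (T \<times> UNIV)"
  by (rule openin_Times) auto

lemma half_space_Times: "half_space (\<nu>, 0 :: complex) = half_space \<nu> \<times> UNIV"
  by (auto simp: half_space_def)

lemma is_chart_prod_chart:
  assumes "is_chart M c"
  shows "is_chart (M \<times> UNIV) (prod_chart c)"
    and "x \<in> img c \<Longrightarrow> chart_inv (prod_chart c) (x, z) = (chart_inv c x, z)"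
proof -
  have inj: "inj_on (snd (prod_chart c)) (fst c \<times> UNIV)"
    using chart_inv_snd[OF assms] by (auto simp: inj_on_def snd_prod_chart) metis
  show ci: "chart_inv (prod_chart c) (x, z) = (chart_inv c x, z)" if "x \<in> img c" for x z
    unfolding chart_inv_def[of "prod_chart c"] fst_prod_chart
    by (rule inv_into_f_eq[OF inj]) (use that in \<open>auto simp: snd_prod_chart chart_inv_in snd_chart_inv\<close>)
  note hom = is_chart_homeomorphism[OF assms]
  have "homeomorphism (fst c \<times> (UNIV :: complex set)) (img c \<times> UNIV) (\<lambda>p. (snd c (fst p), snd p)) (\<lambda>p.
      (chart_inv c (fst p), snd p))"
    unfolding homeomorphism_def
  proof (intro conjI ballI)
    show "continuous_on (fst c \<times> (UNIV :: complex set)) (\<lambda>p. (snd c (fst p), snd p))"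
      by (intro continuous_intros continuous_on_compose2[OF homeomorphism_cont1[OF hom]]) auto
    show "continuous_on (img c \<times> (UNIV :: complex set)) (\<lambda>p. (chart_inv c (fst p), snd p))"
      by (intro continuous_intros continuous_on_compose2[OF homeomorphism_cont2[OF hom]]) auto
    show "(\<lambda>p. (snd c (fst p), snd p)) ` (fst c \<times> (UNIV :: complex set)) = img c \<times> UNIV"
      using img_prod_chart[of c] by (simp add: img_def fst_prod_chart snd_prod_chart[abs_def])
    show "(\<lambda>p. (chart_inv c (fst p), snd p)) ` (img c \<times> (UNIV :: complex set)) = fst c \<times> (UNIV :: complex
        set)"
      using homeomorphism_image2[OF hom] by (force simp: image_iff)
  qed (auto simp: chart_inv_snd[OF assms] snd_chart_inv)
  then have "homeomorphism (fst (prod_chart c)) (img (prod_chart c)) (snd (prod_chart c)) (chart_inv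
      (prod_chart c))"
    by (rule homeomorphism_cong) (auto simp: fst_prod_chart img_prod_chart snd_prod_chart ci)
  moreover obtain \<nu> where "openin (top_of_set (half_space \<nu>)) (img c)" "openin (top_of_set M) (fst c)"
    using assms by (auto simp: is_chart_def)
  then have "openin (top_of_set (half_space (\<nu>, 0))) (img (prod_chart c))" "openin (top_of_set (M \<times>
      UNIV)) (fst (prod_chart c))"
    by (simp_all add: img_prod_chart fst_prod_chart half_space_Times openin_Times_UNIV)
  ultimately show "is_chart (M \<times> UNIV) (prod_chart c)"
    unfolding is_chart_def by blast
qed

lemma hs_open_Times_UNIV: "hs_open T \<Longrightarrow> hs_open (T \<times> (UNIV :: complex set))"
  unfolding hs_open_def by (metis half_space_Times openin_Times_UNIV)

lemma overlap_prod_chart: "overlap (prod_chart c) (prod_chart d) = overlap c d \<times> UNIV"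
proof -
  have "snd (prod_chart c) ` ((fst c \<inter> fst d) \<times> UNIV) = snd c ` (fst c \<inter> fst d) \<times> UNIV"
    by (force simp: snd_prod_chart image_iff)
  then show ?thesis
    by (simp add: overlap_def fst_prod_chart Times_Int_Times)
qed

lemma coord_change_prod_chart:
  assumes "is_chart M c" "fst x \<in> img c"
  shows "coord_change (prod_chart c) (prod_chart d) x = (coord_change c d (fst x), snd x)"
  using is_chart_prod_chart(2)[OF assms, of "snd x"] by (simp add: coord_change_def snd_prod_chart)

lemma smooth_in_fst: "smooth_in S f \<Longrightarrow> smooth_in (S \<times> UNIV) (\<lambda>x. f (fst x))"
  by (rule smooth_in_compose[OF smooth_in_linear[OF bounded_linear_fst]]) auto

lemma has_derivative_comp_fst:
  assumes "(f has_derivative F) (at (fst x) within S)"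
  shows "((\<lambda>y. f (fst y)) has_derivative (\<lambda>u. F (fst u))) (at x within S \<times> UNIV)"
proof -
  have "fst ` (S \<times> UNIV) \<subseteq> S" by auto
  from has_derivative_in_compose[OF bounded_linear_imp_has_derivative[OF bounded_linear_fst]
      has_derivative_subset[OF assms this]]
  show ?thesis .
qed

text \<open>On a fixed vector the form (x dy - y dx) / 2 is linear in the point, which gives its
  smoothness and its derivative at once.\<close>

lemma bounded_linear_area:
  "bounded_linear (\<lambda>x :: 'e::euclidean_space \<times> complex. (Re (snd x) * a - Im (snd x) * b) / 2)"
  unfolding linear_conv_bounded_linear[symmetric] by (rule linearI) (simp_all add: field_simps)

lemma smooth_form_in_prod_form:
  fixes \<alpha> :: "('a, 'e::euclidean_space) one_form"
  assumes "smooth_form_in (\<alpha> c) (img c)"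
  shows "smooth_form_in (prod_form \<alpha> (prod_chart c)) (img (prod_chart c))"
  unfolding smooth_form_in_def img_prod_chart
proof (intro conjI ballI allI)
  fix x :: "'e \<times> complex" assume "x \<in> img c \<times> UNIV"
  then have "linear (\<alpha> c (fst x))" using assms by (auto simp: smooth_form_in_def)
  then show "linear (prod_form \<alpha> (prod_chart c) x)"
    by (intro linearI) (simp_all add: prod_form_prod_chart linear_add linear_scale field_simps)
next
  fix v :: "'e \<times> complex"
  have "smooth_in (img c \<times> UNIV) (\<lambda>x. \<alpha> c (fst x) (fst v))"
    using assms by (intro smooth_in_fst) (auto simp: smooth_form_in_def)
  moreover have "smooth_in (img c \<times> UNIV) (\<lambda>x :: 'e \<times> complex. (Re (snd x) * Im (snd v) - Im (snd x) * Re
      (snd v)) / 2)"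
    by (rule smooth_in_linear[OF bounded_linear_area])
  ultimately show "smooth_in (img c \<times> UNIV) (\<lambda>x. prod_form \<alpha> (prod_chart c) x v)"
    unfolding prod_form_prod_chart by (rule smooth_in_add)
qed

lemma ext_deriv_prod_form:
  assumes \<alpha>: "smooth_form_in (\<alpha> c) (img c)" and hs: "hs_open (img c)" and x: "fst x \<in> img c"
  shows "ext_deriv (prod_form \<alpha>) (prod_chart c) x u v
    = ext_deriv \<alpha> c (fst x) (fst u) (fst v) + (Re (snd u) * Im (snd v) - Im (snd u) * Re (snd v))"
proof -
  have x': "x \<in> img c \<times> UNIV" using x by (cases x) auto
  have d: "frechet_derivative (\<lambda>y. prod_form \<alpha> (prod_chart c) y w) (at x within img c \<times> UNIV)
      = (\<lambda>u. frechet_derivative (\<lambda>y. \<alpha> c y (fst w)) (at (fst x) within img c) (fst u)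
          + (Re (snd u) * Im (snd w) - Im (snd u) * Re (snd w)) / 2)" for w
  proof (rule hs_open_frechet_derivative[OF hs_open_Times_UNIV[OF hs] x'])
    have "((\<lambda>y. \<alpha> c y (fst w)) has_derivative frechet_derivative (\<lambda>y. \<alpha> c y (fst w)) (at (fst x) within
        img c)) (at (fst x) within img c)"
      using \<alpha> x by (intro smooth_in_has_derivative) (auto simp: smooth_form_in_def)
    then have "((\<lambda>y. \<alpha> c (fst y) (fst w)) has_derivative
       (\<lambda>u. frechet_derivative (\<lambda>y. \<alpha> c y (fst w)) (at (fst x) within img c) (fst u))) (at x within img c
           \<times> UNIV)"
      by (rule has_derivative_comp_fst)
    moreover have "((\<lambda>y. (Re (snd y) * Im (snd w) - Im (snd y) * Re (snd w)) / 2) has_derivative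
       (\<lambda>u. (Re (snd u) * Im (snd w) - Im (snd u) * Re (snd w)) / 2)) (at x within img c \<times> UNIV)"
      by (rule bounded_linear_imp_has_derivative[OF bounded_linear_area])
    ultimately show "((\<lambda>y. prod_form \<alpha> (prod_chart c) y w) has_derivative
       (\<lambda>u. frechet_derivative (\<lambda>y. \<alpha> c y (fst w)) (at (fst x) within img c) (fst u)
          + (Re (snd u) * Im (snd w) - Im (snd u) * Re (snd w)) / 2)) (at x within img c \<times> UNIV)"
      unfolding prod_form_prod_chart by (rule has_derivative_add)
  qed
  show ?thesis
    unfolding ext_deriv_def img_prod_chart d by (simp add: field_simps)
qed

context liouville_hamiltonian
begin

lemma prod_D_has_derivative:
  assumes "c \<in> A" "d \<in> A" "x \<in> overlap (prod_chart c) (prod_chart d)"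
  shows "frechet_derivative (coord_change (prod_chart c) (prod_chart d)) (at x within overlap (prod_chart
      c) (prod_chart d))
      = (\<lambda>v. (D c d (fst x) (fst v), snd v))"
  unfolding overlap_prod_chart
proof (rule hs_open_frechet_derivative)
  show "hs_open (overlap c d \<times> (UNIV :: complex set))"
    by (rule hs_open_Times_UNIV[OF hs_open_overlap[OF assms(1,2)]])
  show x: "x \<in> overlap c d \<times> UNIV"
    using assms(3) by (simp add: overlap_prod_chart)
  then have x1: "fst x \<in> overlap c d" by (cases x) auto
  have "((\<lambda>y. coord_change c d (fst y)) has_derivative (\<lambda>v. D c d (fst x) (fst v))) (at x within overlap
      c d \<times> UNIV)"
    by (rule has_derivative_comp_fst[OF D_has_derivative[OF assms(1,2) x1]])
  moreover have "(snd has_derivative snd) (at x within overlap c d \<times> UNIV)"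
    by (rule bounded_linear_imp_has_derivative[OF bounded_linear_snd])
  ultimately have "((\<lambda>y. (coord_change c d (fst y), snd y)) has_derivative (\<lambda>v. (D c d (fst x) (fst v),
      snd v))) (at x within overlap c d \<times> UNIV)"
    by (rule has_derivative_Pair)
  then show "(coord_change (prod_chart c) (prod_chart d) has_derivative (\<lambda>v. (D c d (fst x) (fst v), snd
      v))) (at x within overlap c d \<times> UNIV)"
  proof (rule has_derivative_transform[OF x, rotated])
    fix y :: "'e \<times> complex" assume "y \<in> overlap c d \<times> UNIV"
    then have "fst y \<in> img c" using overlap_subset_img[of c d] by auto
    then show "coord_change (prod_chart c) (prod_chart d) y = (coord_change c d (fst y), snd y)"
      by (rule coord_change_prod_chart[OF chart[OF assms(1)]])
  qed
qed

lemma tube_subset: "tube W H \<subseteq> W \<times> UNIV"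
  by (auto simp: tube_def)

sublocale form_atlas "W \<times> UNIV" "prod_chart ` A" "prod_form \<alpha>" "tube W H"
proof
  show "W \<times> UNIV \<subseteq> (\<Union>b\<in>prod_chart ` A. fst b)"
    using W_eq by (auto simp: fst_prod_chart)
  show "tube W H \<subseteq> W \<times> UNIV" by (rule tube_subset)
next
  fix b :: "('a \<times> complex, 'e \<times> complex) chart" assume "b \<in> prod_chart ` A"
  then obtain c where c: "c \<in> A" "b = prod_chart c" by blast
  show "is_chart (W \<times> UNIV) b"
    unfolding c(2) by (rule is_chart_prod_chart(1)[OF chart[OF c(1)]])
  show "smooth_form_in (prod_form \<alpha> b) (img b)"
    unfolding c(2) by (rule smooth_form_in_prod_form[where \<alpha> = \<alpha> and c = c, OF smooth_form[OF c(1)]])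
  show "nondegenerate (ext_deriv (prod_form \<alpha>) b x)" if "x \<in> img b" for x
    unfolding nondegenerate_def
  proof (intro allI impI)
    fix u assume u: "\<forall>v. ext_deriv (prod_form \<alpha>) b x u v = 0"
    have x: "fst x \<in> img c" using that by (auto simp: c(2) img_prod_chart)
    note e = ext_deriv_prod_form[where \<alpha> = \<alpha> and c = c, OF smooth_form[OF c(1)] hs_open_img[OF c(1)] x, of u]
    have z: "ext_deriv \<alpha> c (fst x) (fst u) 0 = 0"
      using linear_0[OF linear_d1_form_right[OF smooth_form[OF c(1)] hs_open_img[OF c(1)] x]] by (simp
          add: ext_deriv_d1_form)
    have "ext_deriv \<alpha> c (fst x) (fst u) v = 0" for v
      using u[rule_format, of "(v, 0)"] unfolding c(2) e by simp
    then have "fst u = 0"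
      using nondeg[OF c(1) x] unfolding nondegenerate_def by blast
    \<comment> \<open>Pairing with (0, i) and (0, 1) reads off the two real components;
      \<open>z\<close> removes the contribution of \<open>\<alpha>\<close>.\<close>
    moreover have "Re (snd u) = 0" "Im (snd u) = 0"
      using u[rule_format, of "(0, \<i>)"] u[rule_format, of "(0, 1)"] z unfolding c(2) e by simp_all
    ultimately show "u = 0"
      by (simp add: prod_eq_iff complex_eq_iff)
  qed
  fix b' :: "('a \<times> complex, 'e \<times> complex) chart" assume "b' \<in> prod_chart ` A"
  then obtain d where d: "d \<in> A" "b' = prod_chart d" by blast
  show "smooth_in (overlap b b') (coord_change b b')"
  proof -
    have "smooth_in (overlap c d \<times> UNIV) (\<lambda>x :: 'e \<times> complex. (coord_change c d (fst x), snd x))"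
      by (intro smooth_in_Pair smooth_in_fst smooth_coord_change c d smooth_in_linear bounded_linear_snd)
    then show ?thesis
      unfolding c(2) d(2) overlap_prod_chart
    proof (rule smooth_in_cong)
      fix y :: "'e \<times> complex" assume "y \<in> overlap c d \<times> UNIV"
      then have "fst y \<in> img c" using overlap_subset_img[of c d] by auto
      then show "(coord_change c d (fst y), snd y) = coord_change (prod_chart c) (prod_chart d) y"
        by (rule coord_change_prod_chart[OF chart[OF c(1)], symmetric])
    qed
  qed
  show "prod_form \<alpha> b x v = prod_form \<alpha> b' (coord_change b b' x)
      (frechet_derivative (coord_change b b') (at x within overlap b b') v)" if "x \<in> overlap b b'" for x v
  proof -
    have x: "x \<in> overlap (prod_chart c) (prod_chart d)" using that by (simp add: c d)
    then have x1: "fst x \<in> overlap c d" "fst x \<in> img c"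
      using overlap_subset_img[of c d] by (auto simp: overlap_prod_chart)
    show ?thesis
      unfolding c(2) d(2) prod_D_has_derivative[OF c(1) d(1) x] coord_change_prod_chart[OF chart[OF c(1)]
          x1(2)] prod_form_prod_chart
      using form_coord_change[OF c(1) d(1) x1(1), of "fst v"] by (simp add: D_def)
  qed
qed

lemma SA_tube_atlas: "tube_atlas W A H = SA" and SF_tube_form: "tube_form A \<alpha> = SF"
  by (simp_all add: tube_atlas_def tube_form_def)

text \<open>Every complex number has a polar form, so once the value of H does not depend on the
  angle the quantifiers in \<open>tube\<close> disappear. This includes z = 0, where the angle is
  arbitrary.\<close>

lemma mem_tube_autonomous:
  assumes "w \<in> W" "\<And>t. H t w = H 0 w"
  shows "(w, z) \<in> tube W H \<longleftrightarrow> pi * (cmod z)\<^sup>2 \<le> H 0 w"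
proof -
  have "z = of_real (cmod z) * cis (2 * pi * (Arg z / (2 * pi)))"
    using rcis_cmod_Arg[of z] by (simp add: rcis_def)
  then have "\<exists>r t. 0 \<le> r \<and> z = complex_of_real r * cis (2 * pi * t)"
    by (intro exI[of _ "cmod z"] exI[of _ "Arg z / (2 * pi)"]) simp
  moreover have "(w, z) \<in> tube W H \<longleftrightarrow>
      (\<exists>r t. 0 \<le> r \<and> z = complex_of_real r * cis (2 * pi * t) \<and> pi * (cmod z)\<^sup>2 \<le> H t w)"
    using assms(1) by (simp add: tube_def)
  ultimately show ?thesis
    using assms(2) by metis
qed

end

text \<open>Bootstrapping: the derivative of \<open>\<Psi>\<close> is a smooth function of
  \<open>\<Psi>\<close> itself, so each order of differentiability yields the next.\<close>

lemma Ck_on_inverse_function: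
  assumes V: "open V" and U: "open U" and F: "\<And>k w. Ck_on k U (F w)" and im: "\<Psi> ` V \<subseteq> U"
    and der: "\<And>y. y \<in> V \<Longrightarrow> (\<Psi> has_derivative (\<lambda>w. F w (\<Psi> y))) (at y)"
  shows "Ck_on k V \<Psi>"
proof (induction k)
  case 0
  then show ?case
    using der has_derivative_continuous by (force intro: continuous_at_imp_continuous_on)
next
  case (Suc k)
  show ?case
    by (rule Ck_on_SucI[OF V der]) (auto intro: Ck_on_compose[OF V U Suc F im])
qed

text \<open>\<open>\<Phi>\<close> straightens the hypersurface \<open>\<pi> |z|\<^sup>2 = g x\<close>.\<close>

lemma straightening:
  fixes g :: "'e::euclidean_space \<Rightarrow> real"
  assumes Q: "open Q" "x0 \<in> Q" and g: "\<And>k. Ck_on k Q g" and \<nu>: "norm \<nu> = 1"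
    and pos: "\<And>x. x \<in> Q \<Longrightarrow> 0 < frechet_derivative g (at x) \<nu>"
  defines "\<Phi> \<equiv> \<lambda>q :: 'e \<times> complex. (fst q + (g (fst q) - pi * (cmod (snd q))\<^sup>2 - fst q \<bullet> \<nu>) *\<^sub>R \<nu>, snd q)"
  obtains U V \<Psi> where "open U" "U \<subseteq> Q \<times> UNIV" "(x0, 0) \<in> U" "open V" "homeomorphism U V \<Phi> \<Psi>"
    "smooth_in U \<Phi>" "smooth_in V \<Psi>"
proof -
  define \<Omega> where "\<Omega> = Q \<times> (UNIV :: complex set)"
  have \<Omega>: "open \<Omega>" using Q by (simp add: \<Omega>_def open_Times)
  have \<nu>1: "\<nu> \<bullet> \<nu> = 1" using \<nu> by (simp add: dot_square_norm)
  have compg: "Ck_on k \<Omega> (\<lambda>q. h (fst q))" if "Ck_on k Q h" for k and h :: "'e \<Rightarrow> real"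
    by (rule Ck_on_compose[OF \<Omega> Q(1) Ck_on_linear[OF \<Omega> bounded_linear_fst] that]) (auto simp: \<Omega>_def)
  note Ck_intros = Ck_on_add[OF \<Omega>] Ck_on_Pair[OF \<Omega>] Ck_on_const[OF \<Omega>] Ck_on_bounded_bilinear[OF \<Omega>
      bounded_bilinear_scaleR]
    Ck_on_bounded_bilinear[OF \<Omega> bounded_bilinear_mult] Ck_on_bounded_linear[OF \<Omega> bounded_linear_minus[OF
        bounded_linear_ident]]
  have C\<Phi>: "Ck_on k \<Omega> \<Phi>" for k
  proof -
    have "Ck_on k \<Omega> (\<lambda>q. snd q \<bullet> snd q)"
      by (intro Ck_on_bounded_bilinear[OF \<Omega> bounded_bilinear_inner] Ck_on_linear[OF \<Omega> bounded_linear_snd])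
    then have "Ck_on k \<Omega> (\<lambda>q. (fst q + (g (fst q) + - (pi * (snd q \<bullet> snd q)) + - (fst q \<bullet> \<nu>)) *\<^sub>R \<nu>, snd q))"
      by (intro Ck_intros compg[OF g] Ck_on_linear[OF \<Omega> bounded_linear_fst] Ck_on_linear[OF \<Omega>
          bounded_linear_snd]
          Ck_on_linear[OF \<Omega> bounded_linear_compose[OF bounded_linear_inner_left bounded_linear_fst]])
    moreover have "(\<lambda>q. (fst q + (g (fst q) + - (pi * (snd q \<bullet> snd q)) + - (fst q \<bullet> \<nu>)) *\<^sub>R \<nu>, snd q)) = \<Phi>"
      by (simp add: \<Phi>_def fun_eq_iff dot_square_norm)
    ultimately show ?thesis by simp
  qed
  define G where "G x = frechet_derivative g (at x)" for x
  have G: "(g has_derivative G x) (at x)" if "x \<in> Q" for x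
    unfolding G_def using Ck_on_Suc_has_derivative[OF g that] .
  have Glin: "linear (G x)" if "x \<in> Q" for x
    using G[OF that] has_derivative_linear by blast
  have CG: "Ck_on k Q (\<lambda>x. G x v)" for k v
    using g[of "Suc k"] by (simp add: G_def)
  define D\<Phi> where "D\<Phi> q w = (fst w + (G (fst q) (fst w) - 2 * pi * (snd q \<bullet> snd w) - fst w \<bullet> \<nu>) *\<^sub>R \<nu>, snd
      w)" for q w :: "'e \<times> complex"
  have D\<Phi>: "(\<Phi> has_derivative D\<Phi> q) (at q)" if q: "q \<in> \<Omega>" for q
  proof -
    have gq: "((\<lambda>q. g (fst q)) has_derivative (\<lambda>w. G (fst q) (fst w))) (at q)"
      using has_derivative_compose[OF bounded_linear_imp_has_derivative[OF bounded_linear_fst] G[of "fst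
          q"]] q
      by (auto simp: \<Omega>_def)
    have eq: "\<Phi> = (\<lambda>q. (fst q + (g (fst q) - pi * (snd q \<bullet> snd q) - fst q \<bullet> \<nu>) *\<^sub>R \<nu>, snd q))"
      by (simp add: \<Phi>_def fun_eq_iff dot_square_norm)
    show ?thesis
      unfolding eq
      by (rule has_derivative_eq_rhs) (auto intro!: derivative_eq_intros gq simp: D\<Phi>_def fun_eq_iff
          inner_commute algebra_simps)
  qed
  have frD: "frechet_derivative \<Phi> (at q) = D\<Phi> q" if "q \<in> \<Omega>" for q
    using frechet_derivative_at[OF D\<Phi>[OF that]] by simp
  \<comment> \<open>The preimage of \<open>w\<close> under \<open>D\<Phi> q\<close>, found by
    solving for the component along \<open>\<nu>\<close>; \<open>pos\<close> permits the division.
    Having it in closed form is what makes the inverse map smooth.\<close>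
  define F where "F w q = (fst w + ((fst w \<bullet> \<nu> + 2 * pi * (snd q \<bullet> snd w) - G (fst q) (fst w)) * inverse
      (G (fst q) \<nu>)) *\<^sub>R \<nu>, snd w)" for w q :: "'e \<times> complex"
  have DF: "D\<Phi> q (F w q) = w" if q: "q \<in> \<Omega>" for q w
  proof -
    have fq: "fst q \<in> Q" using q by (auto simp: \<Omega>_def)
    have "G (fst q) \<nu> \<noteq> 0" using pos[OF fq] by (simp add: G_def)
    then show ?thesis
      by (simp add: D\<Phi>_def F_def linear_add[OF Glin[OF fq]] linear_scale[OF Glin[OF fq]] inner_add_left
          \<nu>1 prod_eq_iff scaleR_left_distrib[symmetric] mult.assoc)
  qed
  have CF: "Ck_on k \<Omega> (F w)" for k w
  proof -
    have i: "Ck_on k \<Omega> (\<lambda>q. inverse (G (fst q) \<nu>))"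
      using pos by (intro Ck_on_inverse[OF \<Omega>] compg[OF CG]) (force simp: G_def \<Omega>_def)
    have "Ck_on k \<Omega> (\<lambda>q. (fst w + ((fst w \<bullet> \<nu> + 2 * pi * (snd q \<bullet> snd w) + - G (fst q) (fst w)) * inverse
        (G (fst q) \<nu>)) *\<^sub>R \<nu>, snd w))"
      by (intro Ck_intros i compg[OF CG] Ck_on_bounded_linear[OF \<Omega> bounded_linear_inner_left]
          Ck_on_linear[OF \<Omega> bounded_linear_snd])
    then show ?thesis by (simp add: F_def[abs_def])
  qed
  define f' where "f' q = Blinfun (D\<Phi> q)" for q
  have f': "blinfun_apply (f' q) = D\<Phi> q" if "q \<in> \<Omega>" for q
    unfolding f'_def using has_derivative_bounded_linear[OF D\<Phi>[OF that]] by (rule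
        bounded_linear_Blinfun_apply)
  have contf': "continuous_on \<Omega> f'"
  proof (rule continuous_on_blinfun_componentwise)
    fix i :: "'e \<times> complex" assume "i \<in> Basis"
    have "continuous_on \<Omega> (\<lambda>q. frechet_derivative \<Phi> (at q) i)"
      using C\<Phi>[of "Suc 0"] unfolding Ck_on.simps by (elim conjE allE)
    then show "continuous_on \<Omega> (\<lambda>q. blinfun_apply (f' q) i)"
      by (rule continuous_on_eq) (simp add: f' frD)
  qed
  have q0: "(x0, 0) \<in> \<Omega>" using Q by (simp add: \<Omega>_def)
  have surjD: "surj (D\<Phi> q)" if "q \<in> \<Omega>" for q
    by (rule surjI[where f = "\<lambda>w. F w q"]) (rule DF[OF that])
  have linD: "linear (D\<Phi> q)" if "q \<in> \<Omega>" for q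
    using D\<Phi>[OF that] has_derivative_linear by blast
  have injD: "inj (D\<Phi> q)" if "q \<in> \<Omega>" for q
    using linear_surjective_imp_injective[OF linD[OF that] surjD[OF that]] by simp
  obtain L where L: "linear L" "L \<circ> D\<Phi> (x0, 0) = id"
    using linear_injective_left_inverse[OF linD[OF q0] injD[OF q0]] by blast
  have "Blinfun L o\<^sub>L f' (x0, 0) = id_blinfun"
  proof (rule blinfun_eqI)
    fix w
    have "bounded_linear L" using L(1) linear_conv_bounded_linear by blast
    then show "blinfun_apply (Blinfun L o\<^sub>L f' (x0, 0)) w = blinfun_apply id_blinfun w"
      using fun_cong[OF L(2), of w] by (simp add: f'[OF q0] bounded_linear_Blinfun_apply)
  qed
  then obtain U V \<Psi> \<Psi>' where U: "open U" "U \<subseteq> \<Omega>" "(x0, 0) \<in> U" and V: "open V" and hom: "homeomorphism U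
      V \<Phi> \<Psi>"
    and der: "\<And>y. y \<in> V \<Longrightarrow> (\<Psi> has_derivative \<Psi>' y) (at y)"
    and \<Psi>': "\<And>y. y \<in> V \<Longrightarrow> \<Psi>' y = inv (blinfun_apply (f' (\<Psi> y)))"
    using inverse_function_theorem[OF \<Omega> _ contf' q0] D\<Phi> f' by metis
  have im: "\<Psi> ` V \<subseteq> U" using homeomorphism_image2[OF hom] by simp
  have "\<Psi>' y = (\<lambda>w. F w (\<Psi> y))" if y: "y \<in> V" for y
  proof
    fix w
    have m: "\<Psi> y \<in> \<Omega>" using im y U(2) by blast
    show "\<Psi>' y w = F w (\<Psi> y)"
      unfolding \<Psi>'[OF y] f'[OF m] by (rule inv_f_eq[OF injD[OF m] DF[OF m]])
  qed
  then have "Ck_on k V \<Psi>" for k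
    using der by (intro Ck_on_inverse_function[OF V U(1) _ im, of F] Ck_on_subset[OF CF U(2)]) metis
  then have "smooth_in V \<Psi>" by (rule smooth_in_Ck_on[OF V])
  moreover have "smooth_in U \<Phi>"
    by (rule smooth_in_Ck_on[OF U(1) Ck_on_subset[OF C\<Phi> U(2)]])
  ultimately show thesis
    using that U V hom unfolding \<Omega>_def by blast
qed

section \<open>A chart of the tube at the binding\<close>

context liouville_hamiltonian
begin

text \<open>H lives on the chart image, while straightening needs an open set, hence the extension
  \<open>g\<close>. It vanishes on the boundary hyperplane and increases along \<open>\<nu>\<close>,
  so it is negative outside the image: within \<open>Q\<close>, the condition
  \<open>0 \<le> g x\<close> alone places a point in the manifold.\<close>

lemma tube_defining_function:
  assumes p: "p \<in> bd" "c \<in> A" "p \<in> fst c"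
  shows "\<exists>\<nu> Q g. norm \<nu> = 1 \<and> inward_normal c (snd c p) \<nu> \<and> open Q \<and> snd c p \<in> Q \<and> (\<forall>k. Ck_on k Q g) \<and>
    (\<forall>x\<in>Q. 0 < frechet_derivative g (at x) \<nu>) \<and>
    (\<forall>x\<in>Q \<inter> img c. g x = H 0 (chart_inv c x) \<and> (\<forall>t. H t (chart_inv c x) = H 0 (chart_inv c x))) \<and>
    (\<forall>x\<in>Q. 0 \<le> g x \<longrightarrow> x \<in> img c)"
proof -
  define x0 where "x0 = snd c p"
  have x0: "x0 \<in> img c" using snd_in_img[OF p(3)] by (simp add: x0_def)
  obtain \<nu> where \<nu>: "inward_normal c x0 \<nu>" "norm \<nu> = 1"
    using bd_normal[OF p] by (auto simp: x0_def)
  have \<nu>1: "\<nu> \<bullet> \<nu> = 1" using \<nu>(2) by (simp add: dot_square_norm)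
  obtain U g where U: "open U" "x0 \<in> U" "\<And>k. Ck_on k U g" "\<And>y. y \<in> img c \<Longrightarrow> y \<in> U \<Longrightarrow> g y = H 0 (chart_inv c y)"
    using smooth_inE[OF smooth_H[OF p(2)] x0] by blast
  obtain k where k: "k > 0" "\<And>v. dH 0 c x0 v = k * (v \<bullet> \<nu>)"
    using boundary_X(3)[OF p(2) \<nu>(1)] by blast
  have "frechet_derivative g (at x0) = dH 0 c x0"
    unfolding dH_def using frechet_derivative_extension[OF hs_open_img[OF p(2)] x0 U(1,2,3) U(4)] by simp
  then have d0: "0 < frechet_derivative g (at x0) \<nu>"
    using k \<nu>1 by simp
  have "continuous_on U (\<lambda>x. frechet_derivative g (at x) \<nu>)"
    using U(3)[of "Suc 0"] by simp
  then have "open (U \<inter> (\<lambda>x. frechet_derivative g (at x) \<nu>) -` {0<..})"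
    by (rule continuous_open_preimage[OF _ U(1)]) simp
  moreover have "x0 \<in> U \<inter> (\<lambda>x. frechet_derivative g (at x) \<nu>) -` {0<..}"
    using d0 U(2) by simp
  ultimately obtain e1 where e1: "e1 > 0" "ball x0 e1 \<subseteq> U \<inter> (\<lambda>x. frechet_derivative g (at x) \<nu>) -` {0<..}"
    using open_contains_ball by meson
  obtain e2 where e2: "e2 > 0" "ball x0 e2 \<inter> half_space \<nu> \<subseteq> img c"
    using \<nu>(1) x0 unfolding inward_normal_def openin_contains_ball by blast
  obtain e3 where e3: "e3 > 0" "\<forall>x\<in>img c \<inter> ball x0 e3. \<forall>t. H t (chart_inv c x) = H 0 (chart_inv c x)"
    using autonomous_in_chart[OF p] unfolding x0_def by blast
  define Q where "Q = ball x0 (min e1 (min e2 e3))"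
  have Q: "open Q" "x0 \<in> Q" "Q \<subseteq> U" "\<And>x. x \<in> Q \<Longrightarrow> 0 < frechet_derivative g (at x) \<nu>" "Q \<inter> half_space \<nu> \<subseteq> img c"
    "Q \<subseteq> ball x0 e3"
    using e1 e2 e3 by (auto simp: Q_def)
  have neg: "g x < 0" if x: "x \<in> Q" "x \<bullet> \<nu> < 0" for x
  proof -
    \<comment> \<open>The foot of the perpendicular on the boundary hyperplane. It is no farther
      from \<open>x0\<close> than \<open>x\<close> is, so the ball \<open>Q\<close> contains it and,
      by convexity, the segment up to it, along which \<open>g\<close> increases to the value
      0.\<close>
    define y where "y = x - (x \<bullet> \<nu>) *\<^sub>R \<nu>"
    have x0\<nu>: "x0 \<bullet> \<nu> = 0" using \<nu>(1) by (simp add: inward_normal_def)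
    have "(norm (u - (u \<bullet> \<nu>) *\<^sub>R \<nu>))\<^sup>2 = (norm u)\<^sup>2 - (u \<bullet> \<nu>)\<^sup>2" for u
      unfolding power2_norm_eq_inner power2_eq_square[of "u \<bullet> \<nu>"]
      using \<nu>1 by (simp add: inner_diff_left inner_diff_right inner_commute)
    from this[of "x - x0"] have "(norm (y - x0))\<^sup>2 = (norm (x - x0))\<^sup>2 - (x \<bullet> \<nu>)\<^sup>2"
      using x0\<nu> by (simp add: y_def inner_diff_left algebra_simps)
    then have "(norm (y - x0))\<^sup>2 \<le> (norm (x - x0))\<^sup>2"
      using zero_le_power2[of "x \<bullet> \<nu>"] by linarith
    then have "norm (y - x0) \<le> norm (x - x0)"
      by (rule power2_le_imp_le) simp
    then have yQ: "y \<in> Q"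
      using x(1) by (simp add: Q_def dist_norm norm_minus_commute)
    have y\<nu>: "y \<bullet> \<nu> = 0" using \<nu>1 by (simp add: y_def inner_diff_left)
    then have yc: "y \<in> img c" using Q(5) yQ by (auto simp: half_space_def)
    have "inward_normal c y \<nu>"
      using \<nu>(1) y\<nu> yc by (simp add: inward_normal_def)
    then have gy: "g y = 0"
      using U(4)[OF yc] Q(3) yQ H_bd inward_normal_imp_bd[OF p(2)] by auto
    have "g (x + 0 *\<^sub>R \<nu>) < g (x + (- (x \<bullet> \<nu>)) *\<^sub>R \<nu>)"
    proof (rule DERIV_pos_imp_increasing[of 0 "- (x \<bullet> \<nu>)" "\<lambda>s. g (x + s *\<^sub>R \<nu>)"])
      fix s :: real assume s: "0 \<le> s" "s \<le> - (x \<bullet> \<nu>)"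
      define u where "u = s / - (x \<bullet> \<nu>)"
      have u: "0 \<le> u" "u \<le> 1"
        using s x(2) by (simp_all add: u_def divide_nonneg_neg neg_le_divide_eq)
      have "u * (x \<bullet> \<nu>) = - s" using x(2) by (simp add: u_def)
      then have "x + s *\<^sub>R \<nu> = (1 - u) *\<^sub>R x + u *\<^sub>R y"
        by (simp add: y_def algebra_simps)
      moreover have "convex Q" by (simp add: Q_def)
      ultimately have m: "x + s *\<^sub>R \<nu> \<in> Q"
        using convexD_alt[OF _ x(1) yQ u] by simp
      have "(g has_derivative frechet_derivative g (at (x + s *\<^sub>R \<nu>))) (at (x + s *\<^sub>R \<nu>))"
        using Ck_on_Suc_has_derivative[OF U(3)] m Q(3) by blast
      moreover from this have "linear (frechet_derivative g (at (x + s *\<^sub>R \<nu>)))"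
        by (rule has_derivative_linear)
      moreover have "((\<lambda>s. x + s *\<^sub>R \<nu>) has_derivative (\<lambda>r. r *\<^sub>R \<nu>)) (at s)"
        by (auto intro!: derivative_eq_intros)
      ultimately have "((\<lambda>s. g (x + s *\<^sub>R \<nu>)) has_real_derivative frechet_derivative g (at (x + s *\<^sub>R \<nu>))
          \<nu>) (at s)"
        using has_derivative_compose[of "\<lambda>s. x + s *\<^sub>R \<nu>" "\<lambda>r. r *\<^sub>R \<nu>" s UNIV g "frechet_derivative g (at
            (x + s *\<^sub>R \<nu>))"]
        by (simp add: has_field_derivative_def linear_scale mult_commute_abs)
      then show "\<exists>d. ((\<lambda>s. g (x + s *\<^sub>R \<nu>)) has_real_derivative d) (at s) \<and> d > 0"
        using Q(4)[OF m] by blast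
    qed (use x in simp)
    moreover have "x + (- (x \<bullet> \<nu>)) *\<^sub>R \<nu> = y" by (simp add: y_def)
    ultimately show ?thesis using gy by simp
  qed
  show ?thesis
  proof (intro exI[of _ \<nu>] exI[of _ Q] exI[of _ g] conjI \<nu>(2) Q(1) allI ballI impI)
    show "inward_normal c (snd c p) \<nu>" "snd c p \<in> Q"
      using \<nu>(1) Q(2) by (simp_all add: x0_def)
    show "Ck_on k Q g" for k
      using U(3) Q(3) by (rule Ck_on_subset)
    show "0 < frechet_derivative g (at x) \<nu>" if "x \<in> Q" for x
      using Q(4) that by blast
    show "g x = H 0 (chart_inv c x)" if "x \<in> Q \<inter> img c" for x
      using U(4) Q(3) that by blast
    show "H t (chart_inv c x) = H 0 (chart_inv c x)" if "x \<in> Q \<inter> img c" for x t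
      using Q(6) e3(2) that by blast
    show "x \<in> img c" if "x \<in> Q" "0 \<le> g x" for x
    proof -
      have "0 \<le> x \<bullet> \<nu>" using neg[OF that(1)] that(2) by linarith
      then show ?thesis using Q(5) that(1) by (auto simp: half_space_def)
    qed
  qed
qed

text \<open>Near the binding the tube is the set where g - \<pi> |z|^2 is nonnegative, and this
  function is the coordinate of \<open>\<Phi>\<close> along \<open>(\<nu>, 0)\<close>. A product
  chart followed by \<open>\<Phi>\<close> therefore maps the tube onto an open piece of a
  half-space.\<close>

lemma tube_chart:
  assumes p: "p \<in> bd"
  shows "\<exists>d\<in>SA. (p, 0) \<in> fst d"
proof -
  obtain c where c: "c \<in> A" "p \<in> fst c" using p bd_subset W_eq by blast
  obtain \<nu> Q g where *: "norm \<nu> = 1 \<and> inward_normal c (snd c p) \<nu> \<and> open Q \<and> snd c p \<in> Q \<and> (\<forall>k. Ck_on k Q g) \<and>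
    (\<forall>x\<in>Q. 0 < frechet_derivative g (at x) \<nu>) \<and>
    (\<forall>x\<in>Q \<inter> img c. g x = H 0 (chart_inv c x) \<and> (\<forall>t. H t (chart_inv c x) = H 0 (chart_inv c x))) \<and>
    (\<forall>x\<in>Q. 0 \<le> g x \<longrightarrow> x \<in> img c)"
    using tube_defining_function[OF p c] by (elim exE)
  then have \<nu>: "norm \<nu> = 1" "inward_normal c (snd c p) \<nu>"
    and Q: "open Q" "snd c p \<in> Q" "\<And>k. Ck_on k Q g" "\<And>x. x \<in> Q \<Longrightarrow> 0 < frechet_derivative g (at x) \<nu>"
    and gH: "\<And>x. x \<in> Q \<Longrightarrow> x \<in> img c \<Longrightarrow> g x = H 0 (chart_inv c x) \<and> (\<forall>t. H t (chart_inv c x) = H 0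
        (chart_inv c x))"
    and gimg: "\<And>x. x \<in> Q \<Longrightarrow> 0 \<le> g x \<Longrightarrow> x \<in> img c"
    by blast+
  define \<Phi> where "\<Phi> = (\<lambda>q :: 'e \<times> complex. (fst q + (g (fst q) - pi * (cmod (snd q))\<^sup>2 - fst q \<bullet> \<nu>) *\<^sub>R \<nu>,
      snd q))"
  obtain U V \<Psi> where U: "open U" "U \<subseteq> Q \<times> UNIV" "(snd c p, 0) \<in> U" and V: "open V" and hom:
      "homeomorphism U V \<Phi> \<Psi>"
    and smooth: "smooth_in U \<Phi>" "smooth_in V \<Psi>"
    unfolding \<Phi>_def by (rule straightening[OF Q(1,2,3) \<nu>(1) Q(4)])
  have \<nu>1: "\<nu> \<bullet> \<nu> = 1" using \<nu>(1) by (simp add: dot_square_norm)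
  have \<Phi>\<nu>: "\<Phi> q \<bullet> (\<nu>, 0) = g (fst q) - pi * (cmod (snd q))\<^sup>2" for q
    by (simp add: \<Phi>_def inner_add_left \<nu>1)
  define b where "b = prod_chart c"
  have b: "b \<in> prod_chart ` A" using c by (simp add: b_def)
  note chb = chart_B[OF b]
  define d where "d = ({q \<in> fst b. snd b q \<in> U} \<inter> tube W H, \<lambda>q. \<Phi> (snd b q))"
  \<comment> \<open>Over \<open>U\<close> the Hamiltonian is autonomous and given by
    \<open>g\<close>, which reduces the tube to one inequality.\<close>
  have fstd: "q \<in> fst d \<longleftrightarrow> q \<in> fst b \<and> snd b q \<in> U \<and> 0 \<le> \<Phi> (snd b q) \<bullet> (\<nu>, 0)" for q
  proof -
    have "q \<in> tube W H \<longleftrightarrow> 0 \<le> \<Phi> (snd b q) \<bullet> (\<nu>, 0)" if q: "q \<in> fst b" "snd b q \<in> U"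
    proof -
      obtain w z where wz: "q = (w, z)" by (cases q)
      have w: "w \<in> fst c" "snd b q = (snd c w, z)"
        using q(1) by (auto simp: b_def fst_prod_chart snd_prod_chart wz)
      have "snd c w \<in> Q" using q(2) U(2) w(2) by auto
      then have "g (snd c w) = H 0 w" "\<And>t. H t w = H 0 w"
        using gH[OF _ snd_in_img[OF w(1)]] chart_inv_snd[OF chart[OF c(1)] w(1)] by auto
      moreover have "w \<in> W" using w(1) c(1) W_eq by blast
      ultimately show ?thesis
        using mem_tube_autonomous[of w z] by (simp add: \<Phi>\<nu> w(2)[unfolded wz] wz)
    qed
    then show ?thesis by (auto simp: d_def)
  qed
  have sndd: "snd d q = \<Phi> (snd b q)" for q by (simp add: d_def)
  define k where "k y = chart_inv b (\<Psi> y)" for y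
  have kI: "k y \<in> fst d" "snd d (k y) = y" if y: "y \<in> V" "0 \<le> y \<bullet> (\<nu>, 0)" for y
  proof -
    have \<Psi>y: "\<Psi> y \<in> U" "\<Phi> (\<Psi> y) = y"
      using homeomorphism_image2[OF hom] homeomorphism_apply2[OF hom] y(1) by auto
    \<comment> \<open>In the straightened half-space \<open>g\<close> is at least \<pi> |z|^2, hence
      nonnegative; \<open>gimg\<close> then shows that the point lies over the chart image and not
      beyond the boundary of \<open>W\<close>.\<close>
    have "0 \<le> g (fst (\<Psi> y)) - pi * (cmod (snd (\<Psi> y)))\<^sup>2"
      using \<Phi>\<nu>[of "\<Psi> y"] \<Psi>y(2) y(2) by simp
    moreover have "0 \<le> pi * (cmod (snd (\<Psi> y)))\<^sup>2" by simp
    ultimately have "0 \<le> g (fst (\<Psi> y))" by linarith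
    moreover have "fst (\<Psi> y) \<in> Q" using \<Psi>y(1) U(2) by auto
    ultimately have "fst (\<Psi> y) \<in> img c" by (intro gimg)
    then have "\<Psi> y \<in> img b" by (simp add: b_def img_prod_chart mem_Times_iff)
    then have "k y \<in> fst b" "snd b (k y) = \<Psi> y"
      by (simp_all add: k_def chart_inv_in snd_chart_inv)
    then show "k y \<in> fst d" "snd d (k y) = y"
      using \<Psi>y y(2) by (simp_all add: fstd sndd)
  qed
  have dV: "snd d q \<in> V" "0 \<le> snd d q \<bullet> (\<nu>, 0)" "k (snd d q) = q" if q: "q \<in> fst d" for q
  proof -
    have q': "q \<in> fst b" "snd b q \<in> U" "0 \<le> \<Phi> (snd b q) \<bullet> (\<nu>, 0)" using q by (auto simp: fstd)
    then show "snd d q \<in> V" "0 \<le> snd d q \<bullet> (\<nu>, 0)"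
      using homeomorphism_image1[OF hom] by (auto simp: sndd)
    show "k (snd d q) = q"
      using q' homeomorphism_apply1[OF hom] chart_inv_snd[OF chb] by (simp add: k_def sndd)
  qed
  have imgd: "img d = half_space (\<nu>, 0) \<inter> V"
  proof
    show "img d \<subseteq> half_space (\<nu>, 0) \<inter> V"
      using dV by (auto simp: img_def half_space_def)
    show "half_space (\<nu>, 0) \<inter> V \<subseteq> img d"
    proof
      fix y assume "y \<in> half_space (\<nu>, 0) \<inter> V"
      then have "k y \<in> fst d" "y = snd d (k y)"
        using kI[of y] by (auto simp: half_space_def)
      then show "y \<in> img d" unfolding img_def by blast
    qed
  qed
  have kinv: "chart_inv d y = k y" if "y \<in> img d" for y
  proof -
    have "inj_on (snd d) (fst d)" using dV(3) by (metis inj_onI)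
    moreover have "k y \<in> fst d" "snd d (k y) = y"
      using that kI[of y] by (auto simp: imgd half_space_def)
    ultimately show ?thesis
      unfolding chart_inv_def by (rule inv_into_f_eq)
  qed
  have fstd_b: "fst d \<subseteq> fst b" by (auto simp: fstd)
  have "is_chart (tube W H) d"
    unfolding is_chart_def
  proof (intro conjI)
    have "openin (top_of_set (fst b)) (fst b \<inter> snd b -` U)"
      by (rule continuous_openin_preimage_gen[OF homeomorphism_cont1[OF is_chart_homeomorphism[OF chb]] U(1)])
    then have "openin (top_of_set (W \<times> UNIV)) (fst b \<inter> snd b -` U)"
      using chb openin_trans unfolding is_chart_def by metis
    from openin_Int_subset[OF tube_subset this]
    have "openin (top_of_set (tube W H)) (tube W H \<inter> (fst b \<inter> snd b -` U))" .
    moreover have "tube W H \<inter> (fst b \<inter> snd b -` U) = fst d" by (auto simp: d_def)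
    ultimately show "openin (top_of_set (tube W H)) (fst d)" by simp
    show "\<exists>\<mu>. openin (top_of_set (half_space \<mu>)) (img d)"
      unfolding imgd using V by blast
    have "homeomorphism (fst d) (img d) (snd d) k"
      unfolding homeomorphism_def
    proof (intro conjI ballI)
      show "continuous_on (fst d) (snd d)"
        unfolding sndd[abs_def] d_def snd_conv
        by (rule continuous_on_compose2[OF homeomorphism_cont1[OF hom]
              continuous_on_subset[OF homeomorphism_cont1[OF is_chart_homeomorphism[OF chb]]]]) auto
      have "\<Psi> ` img d \<subseteq> img b"
      proof
        fix x assume "x \<in> \<Psi> ` img d"
        then obtain q where q: "q \<in> fst d" "x = \<Psi> (snd d q)" by (auto simp: img_def)
        then have "x = snd b q"
          using homeomorphism_apply1[OF hom] by (simp add: fstd sndd)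
        then show "x \<in> img b" using q(1) fstd_b snd_in_img[of q b] by auto
      qed
      then show "continuous_on (img d) k"
        unfolding k_def[abs_def]
        by (intro continuous_on_compose2[OF homeomorphism_cont2[OF is_chart_homeomorphism[OF chb]]
              continuous_on_subset[OF homeomorphism_cont2[OF hom]]]) (auto simp: imgd)
      show "snd d ` fst d = img d" by (simp add: img_def)
      show "k ` img d = fst d"
        using dV(3) by (force simp: img_def)
    qed (use dV(3) kI in \<open>auto simp: imgd half_space_def\<close>)
    then show "homeomorphism (fst d) (img d) (snd d) (chart_inv d)"
      by (rule homeomorphism_cong) (auto simp: kinv)
  qed
  moreover have "compatible b' d" if b': "b' \<in> prod_chart ` A" for b'
    unfolding compatible_def
  proof
    note chb' = chart_B[OF b']
    have ov: "y \<in> overlap b' d \<longleftrightarrow> y \<in> img b' \<and> chart_inv b' y \<in> fst d" for y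
      by (rule overlap_iff[OF chb'])
    have ovb: "overlap b' d \<subseteq> overlap b' b"
      using fstd_b by (auto simp: overlap_def)
    have "smooth_in (overlap b' d) (\<lambda>y. \<Phi> (coord_change b' b y))"
      by (rule smooth_in_compose[OF smooth_in_subset[OF smooth_B[OF b' b] ovb] smooth(1)])
        (auto simp: ov fstd coord_change_def)
    then show "smooth_in (overlap b' d) (coord_change b' d)"
      by (rule smooth_in_cong) (simp add: coord_change_def sndd)
    have ov': "y \<in> V \<and> \<Psi> y \<in> overlap b b' \<and> coord_change b b' (\<Psi> y) = coord_change d b' y" if y: "y \<in>
        overlap d b'" for y
    proof -
      obtain q where q: "q \<in> fst d" "q \<in> fst b'" "y = snd d q" using y by (auto simp: overlap_def)
      have "y \<in> img d" using q by (auto simp: img_def)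
      moreover have "\<Psi> y = snd b q"
        using q homeomorphism_apply1[OF hom] by (simp add: fstd sndd)
      moreover have "q \<in> fst b" using q(1) fstd_b by blast
      ultimately show ?thesis
        using q dV(1)[OF q(1)] dV(3)[OF q(1)] kinv[of y] chart_inv_snd[OF chb] by (auto simp: overlap_def
            coord_change_def)
    qed
    have "smooth_in (overlap d b') (\<lambda>y. coord_change b b' (\<Psi> y))"
      by (rule smooth_in_compose[OF smooth_in_subset[OF smooth(2)] smooth_B[OF b b']]) (use ov' in auto)
    then show "smooth_in (overlap d b') (coord_change d b')"
      by (rule smooth_in_cong) (use ov' in auto)
  qed
  ultimately have "d \<in> SA" by (simp add: sub_atlas_def)
  moreover have "(p, 0) \<in> fst d"
  proof -
    have "g (snd c p) = 0"
      using gH[OF Q(2) snd_in_img[OF c(2)]] H_bd[OF p] chart_inv_snd[OF chart[OF c(1)] c(2)] by simp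
    then show ?thesis
      using c(2) U(3) by (simp add: fstd b_def fst_prod_chart snd_prod_chart \<Phi>\<nu>)
  qed
  ultimately show ?thesis by blast
qed

text \<open>At z = 0 the form \<pi> r^2 dt vanishes, and its differential is zero on any pair in
  which one vector has no component in the complex plane.\<close>

lemma prod_reeb_vector:
  assumes "c \<in> A" "inward_normal c x \<nu>"
  shows "reeb_vector (prod_form \<alpha> (prod_chart c) (x, 0)) (ext_deriv (prod_form \<alpha>) (prod_chart c) (x, 0))
      (\<nu>, 0)
    (reeb_field \<alpha> c x, 0)"
proof -
  have "x \<in> img c" using assms(2) by (simp add: inward_normal_def)
  then show ?thesis
    using boundary_X(4)[OF assms] ext_deriv_prod_form[where \<alpha> = \<alpha> and c = c, OF smooth_form[OF assms(1)]
        hs_open_img[OF assms(1)], of "(x, 0)"]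
    by (simp add: reeb_vector_def prod_form_prod_chart)
qed

lemma binding:
  assumes p: "p \<in> bd" and d: "d \<in> SA" "(p, 0) \<in> fst d" and c: "c \<in> A" "p \<in> fst c"
  shows "\<exists>\<nu>. inward_normal d (snd d (p, 0)) \<nu>"
    "reeb_field SF d (snd d (p, 0)) = E (prod_chart c) d (snd c p, 0) (reeb_field \<alpha> c (snd c p), 0)"
    "tame_at SA (mfd_boundary SA) (\<lambda>t. reeb_field SF) (p, 0)"
proof -
  obtain \<nu> where \<nu>: "inward_normal c (snd c p) \<nu>" using bd_normal[OF p c] by blast
  have b: "prod_chart c \<in> prod_chart ` A" "(p, 0) \<in> fst (prod_chart c)"
    using c by (auto simp: fst_prod_chart)
  have sb: "snd (prod_chart c) (p, 0) = (snd c p, 0)" by (simp add: snd_prod_chart)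
  have \<mu>: "(\<nu>, 0 :: complex) \<noteq> 0" "img (prod_chart c) \<subseteq> half_space (\<nu>, 0)" "snd (prod_chart c) (p, 0) \<bullet>
      (\<nu>, 0) = 0"
    using \<nu> inward_normal_subset[OF \<nu>] by (auto simp: img_prod_chart half_space_Times sb
        inward_normal_def zero_prod_def)
  note r = prod_reeb_vector[OF c(1) \<nu>, folded sb]
  show "tame_at SA (mfd_boundary SA) (\<lambda>t. reeb_field SF) (p, 0)"
    by (rule sub_form_tame[OF d b \<mu> r])
  obtain \<nu>' where "inward_normal d (snd d (p, 0)) \<nu>'"
    "reeb_field SF d (snd d (p, 0)) = E (prod_chart c) d (snd (prod_chart c) (p, 0)) (reeb_field \<alpha> c (snd
        c p), 0)"
    by (rule sub_form_reeb[OF d b \<mu> r])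
  then show "\<exists>\<nu>. inward_normal d (snd d (p, 0)) \<nu>"
    "reeb_field SF d (snd d (p, 0)) = E (prod_chart c) d (snd c p, 0) (reeb_field \<alpha> c (snd c p), 0)"
    unfolding sb by blast+
qed

lemma binding_boundary:
  assumes "p \<in> bd"
  shows "(p, 0) \<in> mfd_boundary SA" "tame_at SA (mfd_boundary SA) (\<lambda>t. reeb_field SF) (p, 0)"
proof -
  obtain d where d: "d \<in> SA" "(p, 0) \<in> fst d" using tube_chart[OF assms] by blast
  obtain c where c: "c \<in> A" "p \<in> fst c" using assms bd_subset W_eq by blast
  show "(p, 0) \<in> mfd_boundary SA"
    unfolding mfd_boundary_def using d binding(1)[OF assms d c] by blast
  show "tame_at SA (mfd_boundary SA) (\<lambda>t. reeb_field SF) (p, 0)"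
    by (rule binding(3)[OF assms d c])
qed

lemma binding_curve:
  assumes "p \<in> complete_points"
  shows "integral_curve SA (mfd_boundary SA) (\<lambda>t. reeb_field SF) (\<lambda>t. (flow p t, 0))"
  unfolding integral_curve_def
proof (intro conjI allI ballI impI)
  show "range (\<lambda>t. (flow p t, 0)) \<subseteq> mfd_boundary SA"
    using binding_boundary(1)[OF flow(3)[OF assms]] by blast
  have cont: "continuous_on UNIV (flow p)"
    using flow(1)[OF assms] by (simp add: integral_curve_def)
  then show cont': "continuous_on UNIV (\<lambda>t. (flow p t, 0 :: complex))"
    by (intro continuous_on_Pair continuous_on_const)
  fix t and d :: "('a \<times> complex, 'e \<times> complex) chart" assume d: "d \<in> SA" "(flow p t, 0) \<in> fst d"
  have q: "flow p t \<in> bd" by (rule flow(3)[OF assms])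
  then obtain c where c: "c \<in> A" "flow p t \<in> fst c" using bd_subset W_eq by blast
  define b where "b = prod_chart c"
  have b: "b \<in> prod_chart ` A" using c by (simp add: b_def)
  define r where "r = reeb_field \<alpha> c (snd c (flow p t))"
  \<comment> \<open>The open set of times at which the orbit lies in both charts; there the
    coordinates in \<open>d\<close> are those in the product chart followed by the coordinate
    change.\<close>
  define N where "N = {s. flow p s \<in> fst c \<and> (flow p s, 0) \<in> fst d}"
  have "open N"
  proof -
    obtain O1 where O1: "open O1" "fst c = W \<inter> O1"
      using chart[OF c(1)] by (auto simp: is_chart_def openin_open)
    obtain O2 where O2: "open O2" "fst d = tube W H \<inter> O2"
      using chart_SA[OF d(1)] by (auto simp: is_chart_def openin_open)
    have "mfd_boundary SA \<subseteq> tube W H"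
      using is_chart_subset[OF chart_SA] by (auto simp: mfd_boundary_def)
    then have "N = flow p -` O1 \<inter> (\<lambda>s. (flow p s, 0)) -` O2"
      using flow(3)[OF assms] bd_subset binding_boundary(1)[OF flow(3)[OF assms]] by (auto simp: N_def O1 O2)
    moreover have "open (flow p -` O1)" "open ((\<lambda>s. (flow p s, 0 :: complex)) -` O2)"
      using O1(1) O2(1) cont cont' by (auto intro: open_vimage)
    ultimately show ?thesis by (simp only: open_Int)
  qed
  have tN: "t \<in> N" using c d by (simp add: N_def)
  have "((\<lambda>s. snd c (flow p s)) has_vector_derivative r) (at t)"
    using flow(1)[OF assms] c unfolding r_def by (auto simp: integral_curve_def)
  then have "((\<lambda>s. (snd c (flow p s), 0 :: complex)) has_derivative (\<lambda>h. (h *\<^sub>R r, 0))) (at t within N)"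
    unfolding has_vector_derivative_def by (rule has_derivative_Pair[OF has_derivative_at_withinI
        has_derivative_const])
  moreover have "(coord_change b d has_derivative E b d (snd c (flow p t), 0)) (at (snd c (flow p t), 0)
      within (\<lambda>s. (snd c (flow p s), 0)) ` N)"
  proof (rule has_derivative_subset)
    have y: "snd d (flow p t, 0) \<in> overlap d b"
      using d(2) c(2) by (intro snd_in_overlap) (auto simp: b_def fst_prod_chart)
    have "coord_change d b (snd d (flow p t, 0)) = (snd c (flow p t), 0)"
      using coord_change_snd[OF chart_SA[OF d(1)] d(2)] by (simp add: b_def snd_prod_chart)
    then show "(coord_change b d has_derivative E b d (snd c (flow p t), 0)) (at (snd c (flow p t), 0)
        within overlap b d)"
      using E_inverse(2)[OF d(1) b y] by simp
    show "(\<lambda>s. (snd c (flow p s), 0)) ` N \<subseteq> overlap b d"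
    proof
      fix y :: "'e \<times> complex" assume "y \<in> (\<lambda>s. (snd c (flow p s), 0)) ` N"
      then obtain s where s: "s \<in> N" "y = snd b (flow p s, 0)" by (auto simp: b_def snd_prod_chart)
      then show "y \<in> overlap b d"
        by (auto simp: N_def b_def fst_prod_chart intro!: snd_in_overlap)
    qed
  qed
  ultimately have "((\<lambda>s. coord_change b d (snd c (flow p s), 0)) has_derivative (\<lambda>h. E b d (snd c (flow p
      t), 0) (h *\<^sub>R r, 0))) (at t within N)"
    by (rule has_derivative_in_compose)
  then have "((\<lambda>s. snd d (flow p s, 0)) has_derivative (\<lambda>h. E b d (snd c (flow p t), 0) (h *\<^sub>R r, 0))) (at
      t within N)"
  proof (rule has_derivative_transform[OF tN, rotated])
    fix s assume "s \<in> N"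
    then have "(flow p s, 0) \<in> fst b" by (simp add: N_def b_def fst_prod_chart)
    from coord_change_snd[OF chart_B[OF b] this, of d]
    show "snd d (flow p s, 0) = coord_change b d (snd c (flow p s), 0)"
      by (simp add: b_def snd_prod_chart)
  qed
  then have der: "((\<lambda>s. snd d (flow p s, 0)) has_derivative (\<lambda>h. E b d (snd c (flow p t), 0) (h *\<^sub>R r,
      0))) (at t)"
    unfolding at_within_open[OF tN \<open>open N\<close>] .
  have R: "reeb_field SF d (snd d (flow p t, 0)) = E b d (snd c (flow p t), 0) (r, 0)"
    unfolding b_def r_def by (rule binding(2)[OF q d c])
  interpret der: linear "\<lambda>h. E b d (snd c (flow p t), 0) (h *\<^sub>R r, 0)"
    using der by (rule has_derivative_linear)
  have "(\<lambda>h. E b d (snd c (flow p t), 0) (h *\<^sub>R r, 0)) = (\<lambda>h. h *\<^sub>R reeb_field SF d (snd d (flow p t, 0)))"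
    using der.scale[of _ 1] by (simp add: R fun_eq_iff)
  with der show "((\<lambda>s. snd d (flow p s, 0)) has_vector_derivative reeb_field SF d (snd d (flow p t, 0)))
      (at t)"
    by (simp add: has_vector_derivative_def)
qed

lemma tube_reeb_entropy:
  assumes "0 < h_top bd (reeb_time_one A \<alpha>)"
  shows "0 < h_top (mfd_boundary SA) (reeb_time_one SA SF)"
proof (rule h_top_pos_isometric_embedding[OF reeb_entropy_complete_points[OF assms], where i = "\<lambda>p. (p, 0)"])
  show "(\<lambda>p. (p, 0)) ` complete_points \<subseteq> mfd_boundary SA"
    using binding_boundary(1) complete_points_subset by blast
  show "dist (p, 0 :: complex) (q, 0) = dist p q" for p q :: 'a
    by (simp add: dist_Pair_Pair)
  show "reeb_time_one A \<alpha> p \<in> complete_points" if "p \<in> complete_points" for p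
    using reeb_time_one_power[OF that, of 1] flow_complete[OF that] by simp
  show "reeb_time_one SA SF (p, 0) = (reeb_time_one A \<alpha> p, 0)" if p: "p \<in> complete_points" for p
  proof -
    \<comment> \<open>Tameness is established along the binding; with this \<open>K\<close>,
      \<open>time_one_map_eq\<close> still excludes competing integral curves in the whole boundary
      of the tube.\<close>
    have K: "compact (bd \<times> {0 :: complex})"
      by (intro compact_Times compact_bd) simp
    have tame: "tame_at SA (mfd_boundary SA) (\<lambda>t. reeb_field SF) q" if "q \<in> bd \<times> {0}" for q
      using that binding_boundary(2) by auto
    have "reeb_time_one SA SF (flow p 0, 0) = (flow p 1, 0)"
      unfolding reeb_time_one_def
      by (rule time_one_map_eq[OF K tame binding_curve[OF p]]) (use flow(3)[OF p] in auto)
    then show ?thesis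
      using flow(2)[OF p] reeb_time_one_power[OF p, of 1] by simp
  qed
qed

end

theorem corollary1p12:
  fixes W :: "'a::metric_space set"
    and A :: "('a, 'e::euclidean_space) chart set"
    and \<alpha> :: "('a, 'e) one_form"
    and H :: "real \<Rightarrow> 'a \<Rightarrow> real"
  assumes "liouville_domain W A \<alpha>"
    and "0 < h_top (mfd_boundary A) (reeb_time_one A \<alpha>)"
    and "H \<in> admissible_hamiltonians W A \<alpha>"
  shows "0 < h_top (mfd_boundary (tube_atlas W A H))
               (reeb_time_one (tube_atlas W A H) (tube_form A \<alpha>))
       \<and> 0 < h_top W (hamiltonian_time_one W A \<alpha> H)"
proof -
  interpret liouville_hamiltonian W A \<alpha> H
    using assms(1,3) by unfold_locales
  show ?thesis
    using tube_reeb_entropy[OF assms(2)] hamiltonian_entropy[OF assms(2)]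
    by (simp add: SA_tube_atlas SF_tube_form)
qed

end
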